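(* Let $d\ge1$, $\sigma=2/d$, $\lambda<0$, and $\Omega\in C(\mathbf{R};\mathbf{R})$. There exist $T>0$ and $u\in C(]0,T];\Sigma)$ solving $$i\partial_t u+\tfrac12\Delta u=\tfrac12\Omega(t)|x|^2u+\lambda|u|^{2\sigma}u$$ on $]0,T]\times\mathbf{R}^d$, such that $$\|\nabla u(t)\|_{L^2(\mathbf{R}^d)}\to\infty\quad\text{as } t\to0^+.$$
   Context: $u$ is complex-valued. $\Sigma=\{f\in H^1(\mathbf{R}^d):\ x\mapsto |x|f(x)\in L^2(\mathbf{R}^d)\}$. *)

theory Defs
  imports "HOL-Analysis.Analysis"
begin

text \<open>
  Function spaces on a Euclidean space \<open>'a\<close>. Elements of \<open>L\<^sup>2\<close>, \<open>H\<^sup>1\<close> and \<open>\<Sigma>\<close> are represented by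
  functions; two representatives of the same class are identified only through the norms below.
\<close>

definition L2 :: "('a::euclidean_space \<Rightarrow> complex) set" where
  "L2 = {f. f \<in> borel_measurable lebesgue \<and> integrable lebesgue (\<lambda>x. (cmod (f x))\<^sup>2)}"

definition L2_norm :: "('a::euclidean_space \<Rightarrow> complex) \<Rightarrow> real" where
  "L2_norm f = sqrt (\<integral>x. (cmod (f x))\<^sup>2 \<partial>lebesgue)"

definition loc_integrable :: "('a::euclidean_space \<Rightarrow> complex) \<Rightarrow> bool" where
  "loc_integrable f \<longleftrightarrow> (\<forall>K. compact K \<longrightarrow> set_integrable lebesgue K f)"

text \<open>Classical partial derivative in the direction of a basis vector.\<close>

definition partial :: "'a::euclidean_space \<Rightarrow> ('a \<Rightarrow> complex) \<Rightarrow> 'a \<Rightarrow> complex" where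
  "partial i f x = frechet_derivative f (at x) i"

definition laplacian :: "('a::euclidean_space \<Rightarrow> complex) \<Rightarrow> 'a \<Rightarrow> complex" where
  "laplacian f x = (\<Sum>i\<in>Basis. partial i (partial i f) x)"

fun C_k :: "nat \<Rightarrow> ('a::euclidean_space \<Rightarrow> complex) \<Rightarrow> bool" where
  "C_k 0 f \<longleftrightarrow> continuous_on UNIV f"
| "C_k (Suc k) f \<longleftrightarrow> (\<forall>x. f differentiable (at x)) \<and> (\<forall>i\<in>Basis. C_k k (partial i f))"

definition test_function :: "('a::euclidean_space \<Rightarrow> complex) \<Rightarrow> bool" where
  "test_function \<phi> \<longleftrightarrow> (\<forall>k. C_k k \<phi>) \<and> compact (closure {x. \<phi> x \<noteq> 0})"

text \<open>
  The action of the distribution associated with a locally integrable function. The pairing is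
  bilinear (no complex conjugation).
\<close>

definition pairing :: "('a::euclidean_space \<Rightarrow> complex) \<Rightarrow> ('a \<Rightarrow> complex) \<Rightarrow> complex" where
  "pairing f \<phi> = (\<integral>x. f x * \<phi> x \<partial>lebesgue)"

definition is_weak_partial ::
  "'a::euclidean_space \<Rightarrow> ('a \<Rightarrow> complex) \<Rightarrow> ('a \<Rightarrow> complex) \<Rightarrow> bool" where
  "is_weak_partial i f g \<longleftrightarrow> (\<forall>\<phi>. test_function \<phi> \<longrightarrow> pairing g \<phi> = - pairing f (partial i \<phi>))"

definition H1 :: "('a::euclidean_space \<Rightarrow> complex) set" where
  "H1 = {f \<in> L2. \<forall>i\<in>Basis. \<exists>g\<in>L2. is_weak_partial i f g}"

text \<open>For \<open>f \<in> H1\<close> the chosen function is determined up to a null set.\<close>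

definition weak_partial :: "'a::euclidean_space \<Rightarrow> ('a \<Rightarrow> complex) \<Rightarrow> 'a \<Rightarrow> complex" where
  "weak_partial i f = (SOME g. g \<in> L2 \<and> is_weak_partial i f g)"

definition grad_L2_norm :: "('a::euclidean_space \<Rightarrow> complex) \<Rightarrow> real" where
  "grad_L2_norm f = sqrt (\<Sum>i\<in>Basis. (L2_norm (weak_partial i f))\<^sup>2)"

definition Sigma_space :: "('a::euclidean_space \<Rightarrow> complex) set" where
  "Sigma_space = {f \<in> H1. (\<lambda>x. of_real (norm x) * f x) \<in> L2}"

definition Sigma_norm :: "('a::euclidean_space \<Rightarrow> complex) \<Rightarrow> real" where
  "Sigma_norm f =
     sqrt ((L2_norm f)\<^sup>2 + (grad_L2_norm f)\<^sup>2 + (L2_norm (\<lambda>x. of_real (norm x) * f x))\<^sup>2)"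

text \<open>The space \<open>C(I; \<Sigma>)\<close>, for the norm topology of \<open>\<Sigma>\<close>.\<close>

definition continuous_into_Sigma :: "real set \<Rightarrow> (real \<Rightarrow> 'a::euclidean_space \<Rightarrow> complex) \<Rightarrow> bool" where
  "continuous_into_Sigma I u \<longleftrightarrow>
     (\<forall>t\<in>I. u t \<in> Sigma_space) \<and>
     (\<forall>t\<in>I. ((\<lambda>s. Sigma_norm (\<lambda>x. u s x - u t x)) \<longlongrightarrow> 0) (at t within I))"

definition nls_rhs ::
  "real \<Rightarrow> real \<Rightarrow> (real \<Rightarrow> real) \<Rightarrow> (real \<Rightarrow> 'a::euclidean_space \<Rightarrow> complex) \<Rightarrow> real \<Rightarrow> 'a \<Rightarrow> complex" where
  "nls_rhs \<sigma> \<kappa> \<Omega> u t x =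
     of_real (1/2 * \<Omega> t * (norm x)\<^sup>2) * u t x
     + of_real (\<kappa> * cmod (u t x) powr (2 * \<sigma>)) * u t x"

text \<open>
  The equation \<open>\<i> \<partial>\<^sub>t u + (1/2) \<Delta>u = (1/2) \<Omega>(t) |x|\<^sup>2 u + \<kappa> |u|\<^bsup>2\<sigma>\<^esup> u\<close> on \<open>I\<close>: it holds in the sense
  of distributions on space at every time \<open>t \<in> I\<close>, where \<open>\<partial>\<^sub>t u\<close> is the derivative of the
  distribution-valued map \<open>u\<close> (one-sided at an end point belonging to \<open>I\<close>). For continuous
  \<open>u : I \<rightarrow> \<Sigma>\<close> this contains the equation in the sense of distributions on the interior of
  \<open>I\<close> times space.
\<close>

definition solves_nls ::
  "real \<Rightarrow> real \<Rightarrow> (real \<Rightarrow> real) \<Rightarrow> real set \<Rightarrow> (real \<Rightarrow> 'a::euclidean_space \<Rightarrow> complex) \<Rightarrow> bool" where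
  "solves_nls \<sigma> \<kappa> \<Omega> I u \<longleftrightarrow>
     (\<forall>t\<in>I. loc_integrable (nls_rhs \<sigma> \<kappa> \<Omega> u t) \<and>
       (\<forall>\<phi>. test_function \<phi> \<longrightarrow>
         (\<exists>D. ((\<lambda>s. pairing (u s) \<phi>) has_vector_derivative D) (at t within I) \<and>
              \<i> * D + 1/2 * pairing (u t) (laplacian \<phi>) = pairing (nls_rhs \<sigma> \<kappa> \<Omega> u t) \<phi>)))"

end

theory Submission
  imports Defs
begin

text \<open>
  A standing wave of the equation without potential is carried by a lens transform to a solution of
  the equation with potential that concentrates at time \<open>0\<close>; since \<open>\<sigma> = 2/d\<close> is the critical power, the
  transform only needs a solution \<open>b\<close> of \<open>b'' = -\<Omega> b\<close>, \<open>b(0) = 0\<close>, \<open>b'(0) = 1\<close>, and the gradient norm is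
  at least of order \<open>1/b\<close>. The profile of the standing wave, a decaying radial solution of
  \<open>\<Delta>v = e v - |v|\<^bsup>4/d\<^esup> v\<close>, is found by shooting in the frequency \<open>e\<close> with \<open>v(0) = 1\<close>: at \<open>e = 0\<close> the profile crosses
  zero by Pohozaev's identity, for large \<open>e\<close> its energy is negative, and at the supremum of the
  frequencies with a zero crossing the profile is positive with nonnegative energy, which forces
  exponential decay.
\<close>

section \<open>Parametrised radial differential equations\<close>

text \<open>The recurrent obstacle is the origin, where polar coordinates are singular. The radial
  derivative is therefore written \<open>v' = r h\<close>, and \<open>h\<close> is carried along as
  an unknown: \<open>x h(|x|)\<close> is a continuous gradient, and the Laplacian is
  \<open>G + d h\<close> with \<open>G = r h'\<close> vanishing at 0. The radial equation is kept in
  flux form \<open>(r^d h)' = r^(d-1) (...)\<close>, which has no singular coefficient. Criticality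
  enters through the amplitude \<open>b^(-d/2)\<close>, which keeps the mass constant: its power
  \<open>4/d\<close> is \<open>b^(-2)\<close>, the factor that the scaling \<open>x / b\<close> puts
  on the Laplacian, so the profile equation does not depend on time. The quadratic phase cancels the
  transport terms and contributes \<open>b'' / b = -\<Omega>\<close>, the potential. The remaining
  phase is a primitive of \<open>(e/2) / b^2\<close>, which has no finite limit at 0; hence the
  half-open time interval. The order \<open>1/b\<close> comes from a fixed mass concentrated in a
  region of size \<open>b\<close>.\<close>

lemma real_antiderivative:
  fixes f :: "real \<Rightarrow> real"
  assumes "continuous_on UNIV f"
  shows "\<exists>F. \<forall>x. (F has_real_derivative f x) (at x)"
proof -
  have "\<exists>F. \<forall>x::real. (-\<infinity>::ereal) < x \<longrightarrow> x < (\<infinity>::ereal) \<longrightarrow> (F has_vector_derivative f x) (at x)"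
    using assms by (intro einterval_antiderivative) (auto simp: continuous_on_eq_continuous_at)
  then show ?thesis
    by (simp add: has_real_derivative_iff_has_vector_derivative)
qed

lemma continuous_on_unit_interval_integral:
  fixes f :: "'a::topological_space \<Rightarrow> real \<Rightarrow> 'b::banach"
  assumes "continuous_on (U \<times> {0..1}) (\<lambda>x. f (fst x) (snd x))"
  shows "continuous_on U (\<lambda>x. integral {0..1} (f x))"
  using integral_continuous_on_param[of U 0 1 f] assms by (simp add: split_beta)

text \<open>The substitution \<open>x = r s\<close> identifies the left side with the primitive of
  \<open>x^k f x\<close> vanishing at 0. The average over [0,1] makes sense for every sign of
  \<open>r\<close> and stays continuous at \<open>r = 0\<close>, so the equations can be posed on
  the whole line without one-sided derivatives.\<close>

lemma averaged_primitive_has_derivative: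
  fixes f :: "real \<Rightarrow> real"
  assumes f: "continuous_on UNIV f"
  shows "((\<lambda>r. r^(k+1) * integral {0..1} (\<lambda>s. s^k * f (r * s))) has_real_derivative r^k * f r) (at r)"
proof -
  have "continuous_on UNIV (\<lambda>s. s^k * f s)"
    using f by (intro continuous_intros)
  then obtain F where F: "\<And>x. (F has_real_derivative x^k * f x) (at x)"
    using real_antiderivative by blast
  have eq: "r^(k+1) * integral {0..1} (\<lambda>s. s^k * f (r * s)) = F r - F 0" for r
  proof -
    have "((\<lambda>s. (r * s)^k * f (r * s) * r) has_integral F (r*1) - F (r*0)) {0..1}"
    proof (rule fundamental_theorem_of_calculus)
      fix s :: real
      have "((\<lambda>s. F (r * s)) has_real_derivative (r * s)^k * f (r * s) * r) (at s within {0..1})"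
        by (rule DERIV_chain2[OF F]) (auto intro!: derivative_eq_intros)
      then show "((\<lambda>s. F (r * s)) has_vector_derivative (r * s)^k * f (r * s) * r) (at s within {0..1})"
        by (simp add: has_real_derivative_iff_has_vector_derivative)
    qed simp
    then have "integral {0..1} (\<lambda>s. r^(k+1) * (s^k * f (r * s))) = F r - F 0"
      by (simp add: has_integral_iff power_mult_distrib algebra_simps)
    then show ?thesis by simp
  qed
  show ?thesis
    unfolding eq by (auto intro!: derivative_eq_intros F)
qed

text \<open>The left side is exactly \<open>(exp (K * \<rho>) - 1) / K\<close>. The gained factor
  \<open>1/K\<close> is what turns the integral operator into a contraction.\<close>

lemma exp_average_le:
  fixes \<rho> K :: real
  assumes "\<rho> \<ge> 0" "K > 0"
  shows "\<rho> * integral {0..1} (\<lambda>s. exp (K * (\<rho> * s))) \<le> exp (K * \<rho>) / K"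
proof -
  have "((\<lambda>s. \<rho> * exp (K * (\<rho> * s))) has_integral exp (K*(\<rho>*1))/K - exp (K*(\<rho>*0))/K) {0..1}"
    using assms
    by (intro fundamental_theorem_of_calculus[where f="\<lambda>s. exp (K * (\<rho> * s)) / K"])
       (auto simp: has_real_derivative_iff_has_vector_derivative[symmetric] intro!: derivative_eq_intros)
  from integral_unique[OF this]
  have "\<rho> * integral {0..1} (\<lambda>s. exp (K * (\<rho> * s))) = exp (K*\<rho>)/K - 1/K"
    unfolding integral_mult_right by (simp only: mult_1_right mult_zero_right exp_zero)
  then show ?thesis using assms by (simp add: field_simps)
qed

lemma abs_integral_le:
  fixes f g :: "real \<Rightarrow> real"
  assumes "continuous_on {0..1} f" "continuous_on {0..1} g" "\<And>s. 0 \<le> s \<Longrightarrow> s \<le> 1 \<Longrightarrow> \<bar>f s\<bar> \<le> g s"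
  shows "\<bar>integral {0..1} f\<bar> \<le> integral {0..1} g"
  using integral_norm_bound_integral[of f "{0..1}" g] assms
  by (auto intro!: integrable_continuous_interval)

text \<open>
  The integral equation for \<open>v'' + (k/r) v' = H\<close> is a contraction for the weight \<open>exp (-K \<bar>r\<bar>)\<close>;
  solving it on functions of the parameter \<open>e\<close> and of \<open>r\<close> at once makes continuous dependence automatic.
\<close>

lemma radial_ode:
  fixes H :: "real \<Rightarrow> real \<Rightarrow> real \<Rightarrow> real"
  assumes cont: "continuous_on UNIV (\<lambda>(e,s,y). H e s y)"
    and lip: "\<And>e s y z. \<bar>H e s y - H e s z\<bar> \<le> L * \<bar>y - z\<bar>"
    and bdd: "\<And>e s. \<bar>H e s 0\<bar> \<le> C"
  obtains v h :: "real \<Rightarrow> real \<Rightarrow> real"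
  where "continuous_on UNIV (\<lambda>(e,r). v e r)" "continuous_on UNIV (\<lambda>(e,r). h e r)"
    "\<And>e. v e 0 = a0"
    "\<And>e r. (v e has_real_derivative a1 + r * h e r) (at r)"
    "\<And>e r. ((\<lambda>r. r^(k+1) * h e r) has_real_derivative r^k * H e r (v e r)) (at r)"
    "\<And>e. h e 0 = H e 0 a0 / (k+1)"
proof -
  have L0: "L \<ge> 0" using order_trans[OF abs_ge_zero lip[of 0 0 1 0]] by simp
  have C0: "C \<ge> 0" using bdd[of 0 0] by linarith
  \<comment> \<open>Two integrations gain \<open>1/K\<close> each, and
    \<open>K * K \<ge> 2 * L\<close> makes the contraction constant \<open>L / (K * K)\<close> at
    most 1/2.\<close>
  define K where "K = 1 + L"
  have K: "K > 0" "K \<ge> 1" "2 * L \<le> K * K"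
    using L0 by (auto simp: K_def algebra_simps)
  have Hc: "continuous_on S (\<lambda>x. H (f x) (g x) (w x))"
    if "continuous_on S f" "continuous_on S g" "continuous_on S w"
    for f g w and S :: "'x::topological_space set"
    using continuous_on_compose2[OF cont continuous_on_Pair[OF that(1) continuous_on_Pair[OF that(2,3)]]]
    by simp
  \<comment> \<open>The unknown \<open>y\<close> is the profile without its weight: the profile is
    \<open>exp (K * \<bar>r\<bar>) * y (e, r)\<close>. \<open>hh\<close> is the integrated flux
    divided by \<open>r^(k+1)\<close>, \<open>V\<close> integrates \<open>a1 + r h\<close> from the
    value \<open>a0\<close>, and \<open>TT\<close> removes the weight again.\<close>
  define hh where "hh y e r = integral {0..1} (\<lambda>s. s^k * H e (r * s) (exp (K * \<bar>r * s\<bar>) * y (e, r * s)))"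
    for y :: "real \<times> real \<Rightarrow> real" and e r
  define V where "V y e r = a0 + a1 * r + r^2 * integral {0..1} (\<lambda>s. s * hh y e (r * s))"
    for y :: "real \<times> real \<Rightarrow> real" and e r
  define TT where "TT y = (\<lambda>(e,r). exp (- (K * \<bar>r\<bar>)) * V y e r)"
    for y :: "real \<times> real \<Rightarrow> real"
  have yc: "continuous_on S (\<lambda>x. y (f x, g x))"
    if "continuous_on UNIV y" "continuous_on S f" "continuous_on S g"
    for f g and y :: "real \<times> real \<Rightarrow> real" and S :: "'x::topological_space set"
    using continuous_on_compose2[OF that(1) continuous_on_Pair[OF that(2,3)]] by simp
  have hh_cont: "continuous_on UNIV (\<lambda>(e,r). hh y e r)" if y: "continuous_on UNIV y" for y
  proof -
    have "continuous_on UNIV (\<lambda>x. integral {0..1} (\<lambda>s. s^k * H (fst x) (snd x * s) (exp (K * \<bar>snd x * s\<bar>) * y (fst x, snd x * s))))"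
      by (intro continuous_on_unit_interval_integral continuous_intros Hc yc y)
    then show ?thesis
      by (simp add: hh_def split_beta)
  qed
  have hc: "continuous_on S (\<lambda>x. hh y (f x) (g x))"
    if "continuous_on UNIV y" "continuous_on S f" "continuous_on S g"
    for f g and y :: "real \<times> real \<Rightarrow> real" and S :: "'x::topological_space set"
    using continuous_on_compose2[OF hh_cont[OF that(1)] continuous_on_Pair[OF that(2,3)]] by simp
  have V_cont: "continuous_on UNIV (\<lambda>(e,r). V y e r)" if y: "continuous_on UNIV y" for y
  proof -
    have "continuous_on UNIV (\<lambda>x. integral {0..1} (\<lambda>s. s * hh y (fst x) (snd x * s)))"
      by (intro continuous_on_unit_interval_integral continuous_intros hc y)
    then show ?thesis
      by (auto simp: V_def split_beta intro!: continuous_intros)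
  qed
  have T_cont: "continuous_on UNIV (TT y)" if y: "continuous_on UNIV y" for y
    using V_cont[OF y] by (auto simp: TT_def split_beta intro!: continuous_intros)
  \<comment> \<open>\<open>exp_average_le\<close> is applied to the inner integral at radius
    \<open>\<bar>r\<bar> * s\<close> and to the outer one at radius \<open>\<bar>r\<bar>\<close>,
    whence \<open>1 / (K * K)\<close>.\<close>
  have ker: "r^2 * integral {0..1} (\<lambda>s. s * integral {0..1} (\<lambda>t. exp (K * \<bar>r * s*t\<bar>))) \<le> exp (K * \<bar>r\<bar>) / (K*K)"
    for r
  proof -
    let ?I = "integral {0..1} (\<lambda>s. s * integral {0..1} (\<lambda>t. exp (K * \<bar>r * s*t\<bar>)))"
    have ic: "continuous_on {0..1} (\<lambda>s. integral {0..1} (\<lambda>t. exp (K * \<bar>r * s*t\<bar>)))"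
      by (intro continuous_on_unit_interval_integral continuous_intros)
    have "\<bar>r\<bar> * ?I
        = integral {0..1} (\<lambda>s. (\<bar>r\<bar> * s) * integral {0..1} (\<lambda>t. exp (K * \<bar>r * s*t\<bar>)))"
      by (simp add: mult.assoc)
    also have "\<dots> \<le> integral {0..1} (\<lambda>s. exp (K * (\<bar>r\<bar> * s)) / K)"
    proof (rule integral_le)
      fix s :: real assume s: "s \<in> {0..1}"
      have "integral {0..1} (\<lambda>t. exp (K * \<bar>r * s*t\<bar>)) = integral {0..1} (\<lambda>t. exp (K * ((\<bar>r\<bar> * s)*t)))"
        by (rule integral_cong) (use s in \<open>auto simp: abs_mult\<close>)
      then show "(\<bar>r\<bar> * s) * integral {0..1} (\<lambda>t. exp (K * \<bar>r * s*t\<bar>)) \<le> exp (K * (\<bar>r\<bar> * s)) / K"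
        using exp_average_le[of "\<bar>r\<bar> * s" K] s K by simp
    qed (use K in \<open>auto intro!: integrable_continuous_interval continuous_intros ic\<close>)
    also have "\<dots> = integral {0..1} (\<lambda>s. exp (K * (\<bar>r\<bar> * s))) / K"
      by simp
    finally have "\<bar>r\<bar> * (\<bar>r\<bar> * ?I)
       \<le> \<bar>r\<bar> * (integral {0..1} (\<lambda>s. exp (K * (\<bar>r\<bar> * s))) / K)"
      by (rule mult_left_mono) simp
    also have "\<dots> = (\<bar>r\<bar> * integral {0..1} (\<lambda>s. exp (K * (\<bar>r\<bar> * s)))) / K"
      by simp
    also have "\<dots> \<le> (exp (K * \<bar>r\<bar>) / K) / K"
      using exp_average_le[of "\<bar>r\<bar>" K] K by (intro divide_right_mono) auto
    finally show ?thesis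
      unfolding power2_abs[of r, symmetric] power2_eq_square by (simp only: mult.assoc divide_divide_eq_left)
  qed
  \<comment> \<open>The power \<open>t^k\<close> is absorbed in \<open>Y\<close>, being at most 1 on
    the unit interval; the same estimate then serves for boundedness of the image and for the
    contraction.\<close>
  have est: "\<bar>r^2 * integral {0..1} (\<lambda>s. s * integral {0..1} (\<lambda>t. Y (r * s*t) t))\<bar> \<le> D * exp (K*\<bar>r\<bar>) / (K*K)"
    if Y: "\<And>x t. 0 \<le> t \<Longrightarrow> t \<le> 1 \<Longrightarrow> \<bar>Y x t\<bar> \<le> D * exp (K * \<bar>x\<bar>)" and Yc: "continuous_on UNIV (\<lambda>(x,t). Y x t)" and D: "D \<ge> 0"
    for r D and Y :: "real \<Rightarrow> real \<Rightarrow> real"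
  proof -
    let ?I = "integral {0..1} (\<lambda>s. s * integral {0..1} (\<lambda>t. exp (K * \<bar>r * s*t\<bar>)))" and ?Y = "integral {0..1} (\<lambda>s. s * integral {0..1} (\<lambda>t. Y (r * s*t) t))"
    have Yc': "continuous_on S (\<lambda>x. Y (f x) (g x))"
      if "continuous_on S f" "continuous_on S g" for f g and S :: "'x::topological_space set"
      using continuous_on_compose2[OF Yc continuous_on_Pair[OF that]] by simp
    have ic: "continuous_on {0..1} (\<lambda>s. integral {0..1} (\<lambda>t. exp (K * \<bar>r * s*t\<bar>)))"
      by (intro continuous_on_unit_interval_integral continuous_intros)
    have iY: "continuous_on {0..1} (\<lambda>s. integral {0..1} (\<lambda>t. Y (r * s*t) t))"
      by (intro continuous_on_unit_interval_integral continuous_intros Yc')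
    have "\<bar>?Y\<bar>
      \<le> integral {0..1} (\<lambda>s. D * (s * integral {0..1} (\<lambda>t. exp (K * \<bar>r * s*t\<bar>))))"
    proof (rule abs_integral_le)
      fix s :: real assume s: "0 \<le> s" "s \<le> 1"
      have "\<bar>integral {0..1} (\<lambda>t. Y (r * s*t) t)\<bar> \<le> integral {0..1} (\<lambda>t. D * exp (K * \<bar>r * s*t\<bar>))"
        by (rule abs_integral_le) (auto intro!: continuous_intros Yc' Y)
      then show "\<bar>s * integral {0..1} (\<lambda>t. Y (r * s*t) t)\<bar> \<le> D * (s * integral {0..1} (\<lambda>t. exp (K * \<bar>r * s*t\<bar>)))"
        using s mult_left_mono[OF _ s(1), of "\<bar>integral {0..1} (\<lambda>t. Y (r * s*t) t)\<bar>"
            "D * integral {0..1} (\<lambda>t. exp (K * \<bar>r * s*t\<bar>))"]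
        unfolding abs_mult[of s] integral_mult_right by (simp only: mult.left_commute abs_of_nonneg)
    qed (auto intro!: continuous_intros ic iY)
    also have "\<dots> = D * ?I"
      by simp
    finally have "\<bar>r^2 * ?Y\<bar>
       \<le> D * (r^2 * ?I)"
      using mult_left_mono[of "\<bar>?Y\<bar>" _ "r^2"]
      by (simp add: abs_mult[of "r^2"] mult.left_commute[of _ "r^2"])
    also have "\<dots> \<le> D * (exp (K * \<bar>r\<bar>) / (K*K))"
      by (intro mult_left_mono ker D)
    finally show ?thesis by simp
  qed
  have T_bdd: "\<exists>B. \<forall>x. norm (TT y x) \<le> B" if y: "continuous_on UNIV y" and B: "\<And>x. norm (y x) \<le> B" for y B
  proof -
    have B0: "B \<ge> 0" using B[of undefined] norm_ge_zero order_trans by blast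
    have Hb: "\<bar>H e x (exp (K * \<bar>x\<bar>) * y (e,x))\<bar> \<le> (C + L * B) * exp (K * \<bar>x\<bar>)" for e x
    proof -
      have "\<bar>H e x (exp (K * \<bar>x\<bar>) * y (e,x))\<bar> \<le> C + L * (exp (K * \<bar>x\<bar>) * \<bar>y (e,x)\<bar>)"
        using lip[of e x "exp (K * \<bar>x\<bar>) * y (e,x)" 0] bdd[of e x] by (simp add: abs_mult)
      also have "\<dots> \<le> C * exp (K * \<bar>x\<bar>) + L * (exp (K * \<bar>x\<bar>) * B)"
        using C0 L0 K B[of "(e,x)"] by (intro add_mono mult_left_mono) (auto intro!: mult_left_le[of C "exp _", simplified mult.commute] simp: mult_le_cancel_left1)
      finally show ?thesis by (simp add: algebra_simps)
    qed
    have "\<bar>r^2 * integral {0..1} (\<lambda>s. s * hh y e (r * s))\<bar> \<le> (C + L*B) * exp (K*\<bar>r\<bar>) / (K*K)" for e r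
    proof -
      have *: "\<bar>t ^ k * H e x (exp (K * \<bar>x\<bar>) * y (e, x))\<bar> \<le> (C + L * B) * exp (K * \<bar>x\<bar>)"
        if "0 \<le> t" "t \<le> 1" for x t
        using Hb[of e x] mult_left_le_one_le[of "\<bar>H e x (exp (K * \<bar>x\<bar>) * y (e, x))\<bar>" "t^k"] that
        by (simp add: abs_mult power_le_one)
      show ?thesis
        unfolding hh_def
        using C0 L0 B0 
        by (intro est[of "\<lambda>x t. t^k * H e x (exp (K * \<bar>x\<bar>) * y (e, x))"] *)
           (auto simp: split_beta intro!: continuous_intros Hc yc y)
    qed
    then have *: "\<bar>V y e r\<bar> \<le> \<bar>a0\<bar> + \<bar>a1\<bar> * \<bar>r\<bar> + (C + L*B) * exp (K*\<bar>r\<bar>) / (K*K)" for e r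
      unfolding V_def
      by (intro order_trans[OF abs_triangle_ineq] add_mono) (auto simp: abs_mult)
    have "norm (TT y x) \<le> \<bar>a0\<bar> + \<bar>a1\<bar> + (C + L*B) / (K*K)" for x
    proof -
      obtain e r where x: "x = (e,r)" by (cases x)
      have r: "\<bar>r\<bar> \<le> exp (K * \<bar>r\<bar>)"
      proof -
        have "\<bar>r\<bar> \<le> K * \<bar>r\<bar>" using K by (simp add: mult_le_cancel_right1)
        also have "\<dots> \<le> exp (K * \<bar>r\<bar>)" using exp_ge_add_one_self[of "K*\<bar>r\<bar>"] by linarith
        finally show ?thesis .
      qed
      have "\<bar>V y e r\<bar> \<le> \<bar>a0\<bar> * exp (K*\<bar>r\<bar>) + \<bar>a1\<bar> * exp (K*\<bar>r\<bar>) + (C + L*B) * exp (K*\<bar>r\<bar>) / (K*K)"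
        using *[of e r] r mult_left_mono[OF r, of "\<bar>a1\<bar>"] mult_left_mono[of 1 "exp (K*\<bar>r\<bar>)" "\<bar>a0\<bar>"] K by simp
      also have "\<dots> = exp (K*\<bar>r\<bar>) * (\<bar>a0\<bar> + \<bar>a1\<bar> + (C + L*B) / (K*K))"
        by (simp add: field_simps)
      finally have "exp (-(K*\<bar>r\<bar>)) * \<bar>V y e r\<bar> \<le> exp (-(K*\<bar>r\<bar>)) * (exp (K*\<bar>r\<bar>) * (\<bar>a0\<bar> + \<bar>a1\<bar> + (C + L*B) / (K*K)))"
        by (intro mult_left_mono) auto
      then show ?thesis
        by (simp add: TT_def x abs_mult mult.assoc[symmetric] exp_add[symmetric])
    qed
    then show ?thesis by blast
  qed
  have T_in: "TT (apply_bcontfun y) \<in> bcontfun" for y :: "(real\<times>real) \<Rightarrow>\<^sub>C real"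
    using T_bdd[of "apply_bcontfun y" "norm y"] T_cont[of "apply_bcontfun y"]
    by (metis bcontfun_normI continuous_on_apply_bcontfun norm_bounded)
  define T where "T y = Bcontfun (TT (apply_bcontfun y))" for y
  have T_ap: "apply_bcontfun (T y) = TT (apply_bcontfun y)" for y
    unfolding T_def by (rule Bcontfun_inverse[OF T_in])
  have contr: "dist (T y) (T z) \<le> (1/2) * dist y z" for y z
  proof (rule dist_bound)
    fix x :: "real \<times> real"
    obtain e r where x: "x = (e,r)" by (cases x)
    let ?y = "apply_bcontfun y" and ?z = "apply_bcontfun z"
    let ?Y = "\<lambda>w x t. t^k * H e x (exp (K * \<bar>x\<bar>) * w (e, x))"
    have yz: "continuous_on UNIV ?y" "continuous_on UNIV ?z" by auto
    have *: "\<bar>?Y ?y x t - ?Y ?z x t\<bar> \<le> (L * dist y z) * exp (K * \<bar>x\<bar>)"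
      if t: "0 \<le> t" "t \<le> 1" for x t
    proof -
      have "\<bar>?Y ?y x t - ?Y ?z x t\<bar> = t^k * \<bar>H e x (exp (K * \<bar>x\<bar>) * ?y (e, x)) - H e x (exp (K * \<bar>x\<bar>) * ?z (e, x))\<bar>"
        using t by (simp add: right_diff_distrib[symmetric] abs_mult)
      also have "\<dots> \<le> 1 * \<bar>H e x (exp (K * \<bar>x\<bar>) * ?y (e, x)) - H e x (exp (K * \<bar>x\<bar>) * ?z (e, x))\<bar>"
        using t by (intro mult_right_mono) (auto simp: power_le_one)
      also have "\<dots> \<le> L * \<bar>exp (K * \<bar>x\<bar>) * ?y (e, x) - exp (K * \<bar>x\<bar>) * ?z (e, x)\<bar>"
        using lip by simp
      also have "\<dots> = L * (exp (K * \<bar>x\<bar>) * dist (?y (e,x)) (?z (e,x)))"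
        by (simp add: right_diff_distrib[symmetric] abs_mult dist_real_def)
      also have "\<dots> \<le> L * (exp (K * \<bar>x\<bar>) * dist y z)"
        using L0 dist_bounded[of y _ z] by (intro mult_left_mono) auto
      finally show ?thesis by (simp add: mult_ac)
    qed
    have hd: "hh ?y e q - hh ?z e q = integral {0..1} (\<lambda>t. ?Y ?y (q*t) t - ?Y ?z (q*t) t)" for q
      unfolding hh_def
      by (subst integral_diff) (auto intro!: integrable_continuous_interval continuous_intros Hc yc yz)
    have "V ?y e r - V ?z e r = r^2 * (integral {0..1} (\<lambda>s. s * hh ?y e (r * s)) - integral {0..1} (\<lambda>s. s * hh ?z e (r * s)))"
      by (simp add: V_def algebra_simps)
    also have "\<dots> = r^2 * integral {0..1} (\<lambda>s. s * hh ?y e (r * s) - s * hh ?z e (r * s))"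
      by (subst integral_diff) (auto intro!: integrable_continuous_interval continuous_intros hc yz)
    also have "\<dots> = r^2 * integral {0..1} (\<lambda>s. s * integral {0..1} (\<lambda>t. ?Y ?y (r * s*t) t - ?Y ?z (r * s*t) t))"
      by (simp add: right_diff_distrib[symmetric] hd)
    also have "\<bar>\<dots>\<bar> \<le> (L * dist y z) * exp (K*\<bar>r\<bar>) / (K*K)"
      using L0
      by (intro est[of "\<lambda>x t. ?Y ?y x t - ?Y ?z x t"] *)
         (auto simp: split_beta intro!: continuous_intros Hc yc yz)
    finally have "\<bar>V ?y e r - V ?z e r\<bar> \<le> (L * dist y z) * exp (K*\<bar>r\<bar>) / (K*K)" .
    then have "exp (-(K*\<bar>r\<bar>)) * \<bar>V ?y e r - V ?z e r\<bar> \<le> exp (-(K*\<bar>r\<bar>)) * ((L * dist y z) * exp (K*\<bar>r\<bar>) / (K*K))"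
      by (intro mult_left_mono) auto
    also have "\<dots> = (L / (K*K)) * dist y z"
      by (simp add: exp_minus field_simps)
    also have "\<dots> \<le> (1/2) * dist y z"
      using K by (intro mult_right_mono) (auto simp: field_simps)
    finally show "dist (apply_bcontfun (T y) x) (apply_bcontfun (T z) x) \<le> (1/2) * dist y z"
      by (simp add: T_ap TT_def x dist_real_def right_diff_distrib[symmetric] abs_mult)
  qed
  obtain y where y: "T y = y"
    using banach_fix_type[of "1/2" T] contr by auto
  let ?y = "apply_bcontfun y"
  have yc': "continuous_on UNIV ?y" by simp
  define v where "v e r = exp (K * \<bar>r\<bar>) * ?y (e,r)" for e r
  define h where "h = hh ?y"
  have vV: "v e r = V ?y e r" for e r
  proof -
    have "apply_bcontfun (T y) (e,r) = exp (- (K * \<bar>r\<bar>)) * V ?y e r"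
      by (simp add: T_ap TT_def)
    note eq = this[unfolded y]
    show ?thesis unfolding v_def by (subst eq) (simp add: exp_minus)
  qed
  have h_eq: "h e r = integral {0..1} (\<lambda>s. s^k * H e (r * s) (v e (r * s)))" for e r
    by (simp add: h_def hh_def v_def)
  have vc: "continuous_on UNIV (\<lambda>(e,r). v e r)"
    using V_cont[OF yc'] by (simp add: vV)
  have hcc: "continuous_on UNIV (\<lambda>(e,r). h e r)"
    unfolding h_def by (rule hh_cont[OF yc'])
  have vr: "continuous_on UNIV (v e)" for e
    unfolding v_def by (intro continuous_intros yc yc')
  show ?thesis
  proof (rule that[of v h])
    show "v e 0 = a0" for e by (simp add: vV V_def)
    show "(v e has_real_derivative a1 + r * h e r) (at r)" for e r
    proof -
      have "((\<lambda>r. r^(1+1) * integral {0..1} (\<lambda>s. s^1 * h e (r * s))) has_real_derivative r^1 * h e r) (at r)"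
        unfolding h_def by (rule averaged_primitive_has_derivative) (intro hc yc' continuous_intros)
      from DERIV_add[OF _ this, of "\<lambda>r. a0 + a1 * r" a1]
      have "((\<lambda>r. a0 + a1 * r + r^(1+1) * integral {0..1} (\<lambda>s. s^1 * h e (r * s))) has_real_derivative (a1 + r * h e r)) (at r)"
        by (simp add: DERIV_add[OF DERIV_const DERIV_cmult_Id, simplified])
      moreover have "v e = (\<lambda>r. a0 + a1 * r + r^(1+1) * integral {0..1} (\<lambda>s. s^1 * h e (r * s)))"
        by (simp add: fun_eq_iff vV V_def h_def numeral_2_eq_2)
      ultimately show ?thesis by simp
    qed
    show "((\<lambda>r. r^(k+1) * h e r) has_real_derivative r^k * H e r (v e r)) (at r)" for e r
      unfolding h_eq by (rule averaged_primitive_has_derivative) (intro Hc vr continuous_intros)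
    show "h e 0 = H e 0 a0 / (k+1)" for e
    proof -
      have "h e 0 = integral {0..1} (\<lambda>s. s^k) * H e 0 a0"
        by (simp add: h_eq vV V_def)
      moreover have "((\<lambda>s::real. s^k) has_integral (1^(k+1)/(k+1) - 0^(k+1)/(k+1))) {0..1}"
        by (rule fundamental_theorem_of_calculus)
           (auto simp: has_real_derivative_iff_has_vector_derivative[symmetric] field_simps
                 simp del: of_nat_Suc power_Suc intro!: derivative_eq_intros)
      ultimately show ?thesis
        by (simp add: has_integral_iff)
    qed
  qed (use vc hcc in auto)
qed

section \<open>The radial ground state\<close>

definition truncated_power :: "real \<Rightarrow> real \<Rightarrow> real" where
  "truncated_power q y = (let c = max (-1) (min 1 y) in \<bar>c\<bar> powr q * c)"

lemma abs_powr_has_derivative: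
  assumes "q > 0"
  shows "((\<lambda>c. \<bar>c\<bar> powr q * c) has_real_derivative (q + 1) * \<bar>c\<bar> powr q) (at c)"
proof (cases c "0::real" rule: linorder_cases)
  case less
  have "((\<lambda>c. (- c) powr q * c) has_real_derivative (q + 1) * (- c) powr q) (at c)"
    using less by (auto intro!: derivative_eq_intros simp: powr_diff field_simps)
  then have "((\<lambda>c. \<bar>c\<bar> powr q * c) has_real_derivative (q + 1) * (- c) powr q) (at c)"
    by (rule has_field_derivative_transform_within_open[where S="{..<0}"]) (use less in auto)
  then show ?thesis using less by simp
next
  case equal
  have "((\<lambda>h. \<bar>h\<bar> powr q) \<longlongrightarrow> \<bar>0\<bar> powr q) (at (0::real))"
    using assms by (intro tendsto_powr' tendsto_intros) auto
  moreover have "eventually (\<lambda>h. \<bar>h\<bar> powr q = (\<bar>0 + h\<bar> powr q * (0 + h) - \<bar>0\<bar> powr q * 0) / h) (at (0::real))"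
    by (auto simp: eventually_at_filter)
  ultimately have "((\<lambda>h. (\<bar>0 + h\<bar> powr q * (0 + h) - \<bar>0\<bar> powr q * 0) / h) \<longlongrightarrow> \<bar>0\<bar> powr q) (at (0::real))"
    by (rule Lim_transform_eventually)
  then show ?thesis using equal by (simp add: DERIV_def)
next
  case greater
  have "((\<lambda>c. c powr q * c) has_real_derivative (q + 1) * c powr q) (at c)"
    using greater by (auto intro!: derivative_eq_intros simp: powr_diff field_simps)
  then have "((\<lambda>c. \<bar>c\<bar> powr q * c) has_real_derivative (q + 1) * c powr q) (at c)"
    by (rule has_field_derivative_transform_within_open[where S="{0<..}"]) (use greater in auto)
  then show ?thesis using greater by simp
qed

text \<open>Clamping is 1-Lipschitz, and \<open>\<bar>c\<bar> powr q * c\<close> has derivative at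
  most \<open>q + 1\<close> on [-1,1]. The global bound is what \<open>radial_ode\<close> requires
  and the reason for truncating; the profile finally found has values in [0,1], where the truncation
  does nothing.\<close>

lemma truncated_power_lipschitz:
  assumes "q > 0"
  shows "\<bar>truncated_power q a - truncated_power q b\<bar> \<le> (q + 1) * \<bar>a - b\<bar>"
proof -
  define c where "c y = max (-1) (min 1 y)" for y :: real
  have "norm (\<bar>c a\<bar> powr q * c a - \<bar>c b\<bar> powr q * c b) \<le> (q + 1) * norm (c a - c b)"
  proof (rule field_differentiable_bound[where S="{-1..1}"])
    show "((\<lambda>c. \<bar>c\<bar> powr q * c) has_field_derivative (q + 1) * \<bar>z\<bar> powr q) (at z within {-1..1})" for z
      using abs_powr_has_derivative[OF assms] by (rule has_field_derivative_at_within)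
    show "norm ((q + 1) * \<bar>z\<bar> powr q) \<le> q + 1" if "z \<in> {-1..1}" for z
      using that assms by (auto simp: abs_mult powr_le1 intro!: mult_left_le)
  qed (auto simp: c_def)
  also have "\<dots> \<le> (q + 1) * \<bar>a - b\<bar>"
    using assms by (intro mult_left_mono) (auto simp: c_def max_def min_def)
  finally show ?thesis
    by (simp add: truncated_power_def c_def Let_def)
qed

lemma continuous_on_truncated_power:
  assumes "q > 0"
  shows "continuous_on S (truncated_power q)"
  using assms truncated_power_lipschitz
  by (intro lipschitz_on_continuous_on[of "q + 1"] lipschitz_onI) (auto simp: dist_real_def)

lemma nonpos_of_pos_mult_nonpos: "0 < a \<Longrightarrow> a * b \<le> 0 \<Longrightarrow> b \<le> 0" for a b :: real
  by (meson mult_pos_pos not_le)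

lemma truncated_power_0 [simp]: "truncated_power q 0 = 0"
  by (simp add: truncated_power_def)

lemma truncated_power_unit: "0 \<le> y \<Longrightarrow> y \<le> 1 \<Longrightarrow> truncated_power q y = y powr q * y"
  by (simp add: truncated_power_def)

lemma truncated_power_nonneg: "0 \<le> y \<Longrightarrow> truncated_power q y \<ge> 0"
  by (simp add: truncated_power_def Let_def)

text \<open>\<open>B\<close> is the potential in the radial energy. The difference from the closed
  form has zero derivative inside the interval and is continuous at 0, so the power is never
  differentiated at 0.\<close>

lemma truncated_power_primitive:
  assumes q: "q > 0"
  shows "\<exists>B. B 0 = 0 \<and> (\<forall>y. (B has_real_derivative truncated_power q y) (at y)) \<and>
    (\<forall>y. 0 \<le> y \<longrightarrow> y \<le> 1 \<longrightarrow> B y = y powr q * y^2 / (q + 2))"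
proof -
  obtain F where F: "\<And>y. (F has_real_derivative truncated_power q y) (at y)"
    using real_antiderivative[OF continuous_on_truncated_power[OF q]] by blast
  define B where "B y = F y - F 0" for y
  have B: "(B has_real_derivative truncated_power q y) (at y)" for y
    unfolding B_def by (auto intro!: derivative_eq_intros F)
  have "B y = y powr q * y^2 / (q + 2)" if y: "0 \<le> y" "y \<le> 1" for y
  proof (cases "y = 0")
    case False
    let ?f = "\<lambda>y. B y - y powr q * y^2 / (q + 2)"
    have "?f y = ?f 0"
    proof (rule DERIV_isconst_end[of 0 y ?f])
      show "continuous_on {0..y} ?f"
        using q by (intro continuous_intros continuous_on_powr' DERIV_continuous_on[OF has_field_derivative_at_within[OF B]]) auto
      fix x assume x: "0 < x" "x < y"
      have "((\<lambda>y. y powr q * y^2) has_real_derivative (q + 2) * (x powr q * x)) (at x)"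
        using x by (auto intro!: derivative_eq_intros simp: powr_diff field_simps power2_eq_square)
      from DERIV_diff[OF B DERIV_cdivide[OF this, of "q + 2"]]
      show "(?f has_real_derivative 0) (at x)"
        using x y q by (simp add: truncated_power_unit)
    qed (use False y in auto)
    then show ?thesis by (simp add: B_def)
  qed (simp add: B_def)
  then show ?thesis using B by (intro exI[of _ B]) (auto simp: B_def)
qed

text \<open>The function \<open>f + \<delta> ln r\<close> is nonincreasing and the logarithm is
  unbounded. The witness multiplies \<open>r0\<close> by the factor for which
  \<open>\<delta> ln r\<close> grows by exactly \<open>\<bar>f r0\<bar> + 1\<close>. This is how a
  nonnegative profile is contradicted below.\<close>

lemma eventually_negative_of_log_decay:
  fixes f f' :: "real \<Rightarrow> real"
  assumes "r0 > 0" "\<delta> > 0"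
    and f: "\<And>r. r \<ge> r0 \<Longrightarrow> (f has_real_derivative f' r) (at r)"
    and f': "\<And>r. r \<ge> r0 \<Longrightarrow> r * f' r \<le> - \<delta>"
  shows "\<exists>r\<ge>r0. f r < 0"
proof -
  define r where "r = r0 * exp ((\<bar>f r0\<bar> + 1) / \<delta>)"
  have r: "r \<ge> r0" using assms by (simp add: r_def)
  have "f r + \<delta> * ln r \<le> f r0 + \<delta> * ln r0"
  proof (rule DERIV_nonpos_imp_nonincreasing[OF r])
    fix x assume x: "r0 \<le> x" "x \<le> r"
    then have "((\<lambda>r. f r + \<delta> * ln r) has_real_derivative f' x + \<delta> * (1 / x)) (at x)"
      using assms(1) by (auto intro!: derivative_eq_intros f)
    moreover have "f' x + \<delta> * (1 / x) \<le> 0"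
      using f'[OF x(1)] x assms(1) by (simp add: field_simps)
    ultimately show "\<exists>y. ((\<lambda>r. f r + \<delta> * ln r) has_real_derivative y) (at x) \<and> y \<le> 0" by blast
  qed
  moreover have "ln r = ln r0 + (\<bar>f r0\<bar> + 1) / \<delta>"
    using assms by (simp add: r_def ln_mult)
  ultimately have "f r + (\<bar>f r0\<bar> + 1) \<le> f r0"
    using assms(2) by (simp only: distrib_left) simp
  then show ?thesis using r by (intro exI[of _ r]) auto
qed

text \<open>The derivative of the Pohozaev quantity with its entries made abstract: \<open>p\<close>
  is \<open>r^k\<close>, \<open>H\<close> is \<open>h\<close>, \<open>D\<close> the dimension,
  \<open>Q\<close> is \<open>q + 2\<close>, and \<open>W * v\<close> is the power
  \<open>v^(q+2)\<close>. The hypothesis is the profile equation at zero frequency. Replacing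
  \<open>1/Q\<close> by \<open>s\<close> makes the identity polynomial.\<close>

lemma pohozaev_algebra:
  fixes r h' W D H Q p v :: real
  assumes "r * h' = - W - D * H" "Q \<noteq> 0"
  shows "(((D + 2) * (r^2 * p)) * H^2 + (2 * H * h') * (r^3 * p)) / 2
      + ((D * p) * (W * v) + (Q * W * (r * H)) * (r * p)) / Q
      + (D - 2) / 2 * ((D * p) * (v * H) + ((r * H) * H + h' * v) * (r * p))
      = (D / Q - (D - 2) / 2) * (p * (W * v))"
proof -
  define s where "s = inverse Q"
  have s: "Q * s = 1" using assms by (simp add: s_def)
  have "((D + 2) * (r^2 * p)) * H^2 + (2 * H * h') * (r^3 * p)
      + 2 * ((D * p) * (W * v) + (Q * W * (r * H)) * (r * p)) * s
      + (D - 2) * ((D * p) * (v * H) + ((r * H) * H + h' * v) * (r * p))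
      = (2 * D * s - (D - 2)) * (p * (W * v))"
    using assms(1) s by algebra
  then show ?thesis
    unfolding divide_inverse[of _ Q] s_def[symmetric] by (simp add: field_simps)
qed

text \<open>
  Shooting in the frequency \<open>e\<close> with the height \<open>v e 0 = 1\<close> kept fixed: the limiting
  Lane--Emden problem is the ordinary parameter value \<open>e = 0\<close>.
\<close>

locale radial_shooting =
  fixes d k :: nat and q :: real and v h :: "real \<Rightarrow> real \<Rightarrow> real"
  assumes d: "d = Suc k" and q: "q = 4 / real d"
    and v_cont: "continuous_on UNIV (\<lambda>(e,r). v e r)"
    and h_cont: "continuous_on UNIV (\<lambda>(e,r). h e r)"
    and v_0: "\<And>e. v e 0 = 1"
    and v_deriv: "\<And>e r. (v e has_real_derivative r * h e r) (at r)"
    and flux_deriv: "\<And>e r. 0 \<le> e \<Longrightarrow> e \<le> 1 \<Longrightarrow>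
      ((\<lambda>r. r^d * h e r) has_real_derivative r^k * (e * v e r - truncated_power q (v e r))) (at r)"
    and h_0: "\<And>e. 0 \<le> e \<Longrightarrow> e \<le> 1 \<Longrightarrow> h e 0 = (e - 1) / d"
begin

section \<open>Basic properties of the shooting family\<close>

lemma q_pos: "q > 0" using q d by simp

lemma vc: "continuous_on S f \<Longrightarrow> continuous_on S g \<Longrightarrow> continuous_on S (\<lambda>x. v (f x) (g x))"
  for S :: "'x::topological_space set"
  using continuous_on_compose2[OF v_cont continuous_on_Pair, of S f g] by simp

lemma hc: "continuous_on S f \<Longrightarrow> continuous_on S g \<Longrightarrow> continuous_on S (\<lambda>x. h (f x) (g x))"
  for S :: "'x::topological_space set"
  using continuous_on_compose2[OF h_cont continuous_on_Pair, of S f g] by simp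

lemma power_d_deriv: "((\<lambda>r. r^d) has_real_derivative d * r^k) (at r)" for r :: real
  using DERIV_pow[of d r] by (simp add: d)

lemma h_deriv:
  assumes e: "0 \<le> e" "e \<le> 1" and r: "r > 0"
  shows "(h e has_real_derivative (e * v e r - truncated_power q (v e r) - d * h e r) / r) (at r)"
proof -
  let ?G = "e * v e r - truncated_power q (v e r)"
  have "((\<lambda>r. (r^d * h e r) / r^d) has_real_derivative
      (r^k * ?G * r^d - r^d * h e r * (d * r^k)) / (r^d * r^d)) (at r)"
    using r by (intro DERIV_divide flux_deriv e power_d_deriv) auto
  moreover have "(r^k * ?G * r^d - r^d * h e r * (d * r^k)) / (r^d * r^d) = (?G - d * h e r) / r"
    using r by (simp add: d field_simps)
  ultimately have "((\<lambda>r. (r^d * h e r) / r^d) has_real_derivative (?G - d * h e r) / r) (at r)"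
    by simp
  then show ?thesis
    by (rule has_field_derivative_transform_within_open[where S="{0<..}"]) (use r in auto)
qed

text \<open>Backward uniqueness: \<open>v^2 + (r h)^2\<close> satisfies a Gronwall inequality on
  every [s, r0] with \<open>s > 0\<close>, so it vanishes there. The Gronwall constant blows up as
  \<open>s\<close> tends to 0 because of the damping, hence the initial value 1 is contradicted only
  through continuity at 0.\<close>

lemma no_double_zero:
  assumes e: "0 \<le> e" "e \<le> 1" and r: "r0 > 0" and z: "v e r0 = 0" "h e r0 = 0"
  shows False
proof -
  have "v e s = 0" if s: "0 < s" "s < r0" for s
  proof -
    \<comment> \<open>The derivative of \<open>v^2 + w^2\<close> has a cross term
      \<open>2 v w\<close>, bounded with constant 1, a nonlinear term bounded with constant
      \<open>q + 2\<close>, and the damping, bounded with constant \<open>2 d / s\<close> since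
      \<open>r \<ge> s\<close>.\<close>
    define M where "M = 2 + (q + 2) + 2 * d / s"
    define w where "w r = r * h e r" for r
    let ?y = "\<lambda>r. ((v e r)^2 + (w r)^2)"
    have "?y s * exp (M * s) \<le> ?y r0 * exp (M * r0)"
    proof (rule DERIV_nonneg_imp_nondecreasing[of s r0 "\<lambda>r. ?y r * exp (M * r)"])
      fix r assume r: "s \<le> r" "r \<le> r0"
      let ?G = "e * v e r - truncated_power q (v e r)" and ?w = "w r"
      have r0: "r > 0" using r s by simp
      have dw: "(w has_real_derivative h e r + (?G - d * h e r)) (at r)"
        unfolding w_def using r0 by (auto intro!: derivative_eq_intros h_deriv e)
      have dv: "(v e has_real_derivative ?w) (at r)"
        unfolding w_def by (rule v_deriv)
      have D: "((\<lambda>r. ?y r * exp (M * r)) has_real_derivative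
          (2 * v e r * ?w + 2 * ?w * (h e r + (?G - d * h e r)) + M * ?y r) * exp (M * r)) (at r)"
        by (auto intro!: derivative_eq_intros dv dw simp: algebra_simps power2_eq_square)
      have G: "\<bar>?G\<bar> \<le> (q + 2) * \<bar>v e r\<bar>"
      proof -
        have "\<bar>e * v e r\<bar> \<le> \<bar>v e r\<bar>" using e by (simp add: abs_mult mult_left_le_one_le)
        then show ?thesis
          using truncated_power_lipschitz[OF q_pos, of "v e r" 0] by (simp add: algebra_simps)
      qed
      have ab: "2 * \<bar>a * b\<bar> \<le> a^2 + b^2" for a b :: real
        using sum_squares_bound[of "\<bar>a\<bar>" "\<bar>b\<bar>"] by (simp add: abs_mult)
      have 1: "\<bar>2 * v e r * ?w\<bar> \<le> ?y r"
        using ab[of "v e r" ?w] by (simp add: abs_mult)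
      have 2: "\<bar>2 * ?w * ?G\<bar> \<le> (q + 2) * ?y r"
      proof -
        have "\<bar>2 * ?w * ?G\<bar> = 2 * \<bar>?w\<bar> * \<bar>?G\<bar>" by (simp add: abs_mult)
        also have "\<dots> \<le> 2 * \<bar>?w\<bar> * ((q + 2) * \<bar>v e r\<bar>)"
          by (intro mult_left_mono G) auto
        also have "\<dots> = (q + 2) * (2 * \<bar>v e r * ?w\<bar>)" by (simp add: abs_mult)
        also have "\<dots> \<le> (q + 2) * ?y r"
          using ab[of "v e r" ?w] q_pos by (intro mult_left_mono) auto
        finally show ?thesis .
      qed
      have 3: "2 * ?w * (h e r - d * h e r) \<ge> - (2 * d / s) * ?y r"
      proof -
        have "2 * ?w * (h e r - d * h e r) = - (2 * k / r) * ?w^2"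
          using r0 by (simp add: d w_def field_simps power2_eq_square)
        moreover have "(2 * k / r) * ?w^2 \<le> (2 * d / s) * ?y r"
          using r s r0 by (intro mult_mono frac_le) (auto simp: d)
        ultimately show ?thesis by simp
      qed
      have "2 * v e r * ?w + 2 * ?w * (h e r + (?G - d * h e r)) + M * ?y r
          = 2 * v e r * ?w + 2 * ?w * ?G + 2 * ?w * (h e r - d * h e r) + M * ?y r"
        by (simp add: algebra_simps)
      moreover have "M * ?y r = ?y r + ?y r + (q + 2) * ?y r + (2 * d / s) * ?y r"
        by (simp add: M_def algebra_simps)
      moreover have "?y r \<ge> 0" by simp
      ultimately have "0 \<le> 2 * v e r * ?w + 2 * ?w * (h e r + (?G - d * h e r)) + M * ?y r"
        using 1 2 3 by linarith
      from mult_nonneg_nonneg[OF this exp_ge_zero[of "M * r"]]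
      show "\<exists>y. ((\<lambda>r. ?y r * exp (M * r)) has_real_derivative y) (at r) \<and> 0 \<le> y"
        using D by blast
    qed (use s in auto)
    then have "?y s * exp (M * s) \<le> 0" using z by (simp add: w_def)
    then have "?y s \<le> 0" by (simp add: mult_le_0_iff not_le)
    then show "v e s = 0" by (simp add: sum_power2_le_zero_iff)
  qed
  then have "eventually (\<lambda>s. v e s = 0) (at_right 0)"
    using r by (auto simp: eventually_at_right_field)
  then have "(v e \<longlongrightarrow> 0) (at_right 0)"
    by (rule tendsto_eventually)
  moreover have "(v e \<longlongrightarrow> v e 0) (at_right 0)"
    using DERIV_isCont[OF v_deriv[of e 0]] by (simp add: isCont_def filterlim_at_split)
  ultimately have "v e 0 = 0"
    using tendsto_unique trivial_limit_at_right_real by blast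
  then show False by (simp add: v_0)
qed

text \<open>A zero of a nonnegative profile is a local minimum, so the slope vanishes with the
  value, which \<open>no_double_zero\<close> excludes.\<close>

lemma pos_of_nonneg:
  assumes e: "0 \<le> e" "e \<le> 1" and nn: "\<And>r. r \<ge> 0 \<Longrightarrow> v e r \<ge> 0" and r: "r \<ge> 0"
  shows "v e r > 0"
proof (rule ccontr)
  assume "\<not> v e r > 0"
  then have z: "v e r = 0" using nn[OF r] by simp
  then have r0: "r > 0" using v_0 r by (cases "r = 0") auto
  have "r * h e r = 0"
  proof (rule DERIV_local_min[OF v_deriv r0])
    show "\<forall>y. \<bar>r - y\<bar> < r \<longrightarrow> v e r \<le> v e y" using nn z by auto
  qed
  then show False using no_double_zero[OF e r0 z] r0 by simp
qed

text \<open>If the profile stayed nonnegative, the Pohozaev quantity \<open>P\<close> would increase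
  from 0 and stay above \<open>P 1 > 0\<close>, while the decay forced by the equation makes it at
  most \<open>M / r^2\<close>. In dimension one the profile would be concave with a negative slope,
  which is already absurd.\<close>

lemma lane_emden_crosses: "\<exists>r>0. v 0 r < 0"
proof (rule ccontr)
  assume "\<not> ?thesis"
  then have nn: "v 0 r \<ge> 0" if "r \<ge> 0" for r
    using that v_0[of 0] by (cases "r = 0") (force simp: not_less not_le)+
  let ?v = "v 0" and ?h = "h 0"
  have vpos: "?v r > 0" if "r \<ge> 0" for r
    using pos_of_nonneg[of 0 r] nn that by simp
  have fl: "((\<lambda>r. r^d * ?h r) has_real_derivative - (r^k * truncated_power q (?v r))) (at r)" for r
    using flux_deriv[of 0 r] by simp
  have hle: "?h r \<le> 0" if r: "r > 0" for r
  proof -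
    have "r^d * ?h r \<le> 0^d * ?h 0"
      by (rule DERIV_nonpos_imp_nonincreasing[of 0 r "\<lambda>r. r^d * ?h r"])
         (use r fl nn truncated_power_nonneg in \<open>auto intro!: exI conjI\<close>)
    then show ?thesis
      using r nonpos_of_pos_mult_nonpos[of "r^d" "?h r"] by (simp add: d)
  qed
  have rh: "r * ?h r \<le> 0" if "r \<ge> 0" for r
    using hle[of r] that by (cases "r = 0") (auto simp: mult_le_0_iff)
  have vle: "?v r \<le> 1" if r: "r \<ge> 0" for r
    using DERIV_nonpos_imp_nonincreasing[OF r, of ?v] v_deriv[of 0] rh v_0 by (metis order_refl)
  have N: "truncated_power q (?v r) = ?v r powr q * ?v r" if "r \<ge> 0" for r
    using that vpos vle by (simp add: truncated_power_unit less_imp_le)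
  have vq: "((\<lambda>r. ?v r powr a) has_real_derivative a * ?v r powr (a - 1) * (r * ?h r)) (at r)" if "r \<ge> 0" for a r
    using vpos[OF that] by (auto intro!: derivative_eq_intros v_deriv)
  have vpow: "?v r powr (a - 1) * ?v r = ?v r powr a" if "r \<ge> 0" for a r
    using vpos[OF that] by (simp add: powr_diff)
  \<comment> \<open>Because \<open>v\<close> decreases, the flux \<open>- r^d h\<close>, an integral
    of \<open>s^k v^(q+1)\<close>, is at least its value with \<open>v\<close> frozen at the end
    point \<open>r\<close>.\<close>
  have hv: "?h r \<le> - (?v r powr q * ?v r) / d" if r: "r > 0" for r
  proof -
    have "r^d * ?h r + r^d * (?v r powr (q+1)) / d \<le> 0^d * ?h 0 + 0^d * (?v 0 powr (q+1)) / d"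
    proof (rule DERIV_nonpos_imp_nonincreasing[of 0 r])
      fix x assume x: "0 \<le> x" "x \<le> r"
      have "((\<lambda>r. r^d * ?h r + r^d * (?v r powr (q+1)) / d) has_real_derivative
         - (x^k * truncated_power q (?v x)) + ((d * x^k) * (?v x powr (q+1)) + ((q+1) * ?v x powr (q+1-1) * (x * ?h x)) * x^d) / d) (at x)"
        using x by (intro DERIV_add fl DERIV_cdivide DERIV_mult vq power_d_deriv)
      moreover have eq: "- (x^k * truncated_power q (?v x)) + ((d * x^k) * (?v x powr (q+1)) + ((q+1) * ?v x powr (q+1-1) * (x * ?h x)) * x^d) / d
         = (q+1) * ?v x powr q * x^d / d * (x * ?h x)"
        using vpow[OF x(1), of "q+1"] N[OF x(1)] by (simp add: d field_simps)
      moreover have "\<dots> \<le> 0"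
        by (rule mult_nonneg_nonpos[OF _ rh[OF x(1)]]) (use x q_pos in auto)
      ultimately show "\<exists>y. ((\<lambda>r. r^d * ?h r + r^d * (?v r powr (q+1)) / d) has_real_derivative y) (at x) \<and> y \<le> 0"
        unfolding eq by blast
    qed (use r in auto)
    then have "r^d * (?h r + ?v r powr (q+1) / d) \<le> 0" by (simp add: d algebra_simps)
    from nonpos_of_pos_mult_nonpos[OF zero_less_power[OF r] this]
    have "?h r + ?v r powr (q+1) / d \<le> 0" .
    moreover have "?v r powr (q+1) = ?v r powr q * ?v r"
      using vpow[of r "q+1"] r by simp
    ultimately show ?thesis by simp
  qed
  \<comment> \<open>Dividing \<open>hv\<close> by \<open>v^(q+1)\<close> bounds the derivative of
    \<open>v^(-q)\<close> below by \<open>q r / d = 4 r / d^2\<close>; integration gives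
    \<open>v^(-q) \<ge> 2 r^2 / d^2\<close>.\<close>
  have decay: "r^2 * ?v r powr q \<le> d^2 / 2" if r: "r > 0" for r
  proof -
    have "?v 0 powr (-q) - (2 / d^2) * 0^2 \<le> ?v r powr (-q) - (2 / d^2) * r^2"
    proof (rule DERIV_nonneg_imp_nondecreasing[of 0 r])
      fix x assume x: "0 \<le> x" "x \<le> r"
      have "((\<lambda>r. ?v r powr (-q) - (2 / d^2) * r^2) has_real_derivative
         (-q) * ?v x powr (-q - 1) * (x * ?h x) - (2 / d^2) * (2 * x)) (at x)"
        using x by (intro DERIV_diff vq DERIV_cmult) (auto intro!: derivative_eq_intros)
      moreover have "(-q) * ?v x powr (-q - 1) * (x * ?h x) - (2 / d^2) * (2 * x) \<ge> 0"
      proof (cases "x = 0")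
        case False
        then have x0: "x > 0" using x by simp
        have "?v x powr (-q-1) * (?v x powr q * ?v x) = 1"
          using vpos[of x] x by (simp add: powr_diff powr_minus field_simps)
        moreover have "?v x powr (-q-1) * (?v x powr q * ?v x / d) \<le> ?v x powr (-q-1) * (- ?h x)"
          using hv[OF x0] by (intro mult_left_mono) auto
        ultimately have "1 / d \<le> ?v x powr (-q-1) * (- ?h x)" by simp
        then have "q * x * (1 / d) \<le> q * x * (?v x powr (-q-1) * (- ?h x))"
          using q_pos x0 by (intro mult_left_mono) auto
        moreover have "q * x * (1 / d) = (2 / d^2) * (2 * x)" by (simp add: q power2_eq_square)
        ultimately show ?thesis by (simp add: algebra_simps)
      qed simp
      ultimately show "\<exists>y. ((\<lambda>r. ?v r powr (-q) - (2 / d^2) * r^2) has_real_derivative y) (at x) \<and> 0 \<le> y"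
        by blast
    qed (use r in auto)
    then have "2 * r^2 / d^2 \<le> ?v r powr (-q)" by (simp add: v_0)
    then have "2 * r^2 / d^2 * ?v r powr q \<le> ?v r powr (-q) * ?v r powr q"
      by (intro mult_right_mono) auto
    also have "\<dots> = 1" using vpos[of r] r by (simp add: powr_minus)
    finally show ?thesis using d by (simp add: field_simps)
  qed
  \<comment> \<open>The factor of \<open>r^k v^(q+2)\<close> in \<open>P'\<close> is
    \<open>d / (q + 2) - (d - 2) / 2\<close>. It equals \<open>2 / (d + 2)\<close> for
    \<open>q = 4/d\<close>; it is positive because the mass-critical power is below the
    energy-critical one.\<close>
  define P where "P r = r^(d+2) * (?h r)^2 / 2 + r^d * (?v r powr (q+2)) / (q+2)
     + (real d - 2) / 2 * (r^d * (?v r * ?h r))" for r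
  have P_deriv: "(P has_real_derivative 2 / (d+2) * (r^k * ?v r powr (q+2))) (at r)" if r: "r > 0" for r
  proof -
    let ?p = "r^k" and ?W = "?v r powr (q+1)"
    let ?h' = "(- ?W - d * ?h r) / r"
    have hd: "(?h has_real_derivative ?h') (at r)"
      using h_deriv[of 0 r] N[of r] vpow[of r "q+1"] r by simp
    have vd: "(?v has_real_derivative r * ?h r) (at r)" by (rule v_deriv)
    have h2: "((\<lambda>r. (?h r)^2) has_real_derivative 2 * ?h r * ?h') (at r)"
      by (auto intro!: derivative_eq_intros hd)
    have pd2: "((\<lambda>r. r^(d+2)) has_real_derivative real (d+2) * r^(d+1)) (at r)"
      using DERIV_pow[of "d+2" r] by simp
    have V: "?v r powr (q+2) = ?W * ?v r" using vpow[of r "q+2"] r by (simp add: add.commute)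
    let ?X = "((real (d+2) * r^(d+1)) * (?h r)^2 + (2 * ?h r * ?h') * r^(d+2)) / 2
      + ((d * r^k) * (?v r powr (q+2)) + ((q+2) * ?v r powr (q+2-1) * (r * ?h r)) * r^d) / (q+2)
      + (real d - 2) / 2 * ((d * r^k) * (?v r * ?h r) + ((r * ?h r) * ?h r + ?h' * ?v r) * r^d)"
    have D: "(P has_real_derivative ?X) (at r)"
      unfolding P_def
      using r by (intro DERIV_add DERIV_cdivide DERIV_mult DERIV_cmult vq power_d_deriv vd hd h2 pd2) simp
    have c: "real d / (q+2) - (real d - 2) / 2 = 2 / (real d + 2)"
      by (simp add: q d field_simps)
    have rd: "r^d = r * ?p" "r^(d+1) = r^2 * ?p" "r^(d+2) = r^3 * ?p"
      by (simp_all add: d power_add power2_eq_square power3_eq_cube)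
    have W': "?v r powr (q+2-1) = ?W" by (simp add: add.commute)
    have eq: "?X = 2 / (d+2) * (?p * (?W * ?v r))"
      using pohozaev_algebra[of r ?h' ?W "real d" "?h r" "q+2" ?p "?v r"] c r q_pos
      unfolding rd V W' by (simp add: add.commute)
    show ?thesis using D[unfolded eq] unfolding V .
  qed
  have P_cont: "continuous_on {a..b} P" if "a \<ge> 0" for a b
  proof -
    have pw: "continuous_on {a..b} (\<lambda>r. ?v r powr (q+2))"
      by (rule DERIV_continuous_on[OF has_field_derivative_at_within[OF vq]]) (use that in auto)
    show ?thesis
      unfolding P_def by (rule pw hc vc continuous_intros | use q_pos in simp)+
  qed
  have P1: "P 1 > 0"
  proof -
    have "P 0 < P 1"
    proof (rule DERIV_pos_imp_increasing_open[of 0 1 P])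
      fix x :: real assume "0 < x"
      then show "\<exists>y. (P has_real_derivative y) (at x) \<and> 0 < y"
        using P_deriv[of x] vpos[of x] by (auto intro!: exI conjI)
    qed (auto intro: P_cont)
    moreover have "P 0 = 0" by (simp add: P_def d)
    ultimately show ?thesis by simp
  qed
  have P_ge: "P 1 \<le> P r" if r: "r \<ge> 1" for r
  proof (rule DERIV_nonneg_imp_nondecreasing[OF r])
    fix x :: real assume "1 \<le> x"
    then show "\<exists>y. (P has_real_derivative y) (at x) \<and> 0 \<le> y"
      using P_deriv[of x] vpos[of x] by (auto intro!: exI conjI)
  qed
  show False
  proof (cases "k = 0")
    case True
    have h1: "?h 1 < 0" using hv[of 1] vpos[of 1] d
      by (smt (verit) divide_pos_pos mult_pos_pos of_nat_0_less_iff powr_gt_zero zero_less_Suc divide_minus_left)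
    \<comment> \<open>For \<open>d = 1\<close> the flux \<open>r^d h\<close> is the slope itself,
      and it is nonincreasing.\<close>
    have "r * ?h r \<le> ?h 1" if r: "r \<ge> 1" for r
    proof -
      have "r^d * ?h r \<le> 1^d * ?h 1"
      proof (rule DERIV_nonpos_imp_nonincreasing[OF r])
        fix x :: real assume "1 \<le> x"
        then show "\<exists>y. ((\<lambda>r. r^d * ?h r) has_real_derivative y) (at x) \<and> y \<le> 0"
          using fl[of x] nn[of x] truncated_power_nonneg[of "?v x" q] by (intro exI conjI) auto
      qed
      then show ?thesis using True d by simp
    qed
    then have *: "r * (r * ?h r) \<le> - (- ?h 1)" if "r \<ge> 1" for r
      using that h1 mult_mono[of 1 r "- ?h 1" "- (r * ?h r)"] by auto
    have "\<exists>r\<ge>1. ?v r < 0"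
      by (rule eventually_negative_of_log_decay[OF _ _ v_deriv *]) (use h1 in auto)
    then show False using nn by (meson not_le order_trans zero_le_one)
  next
    case False
    then have d2: "real d \<ge> 2" using d by simp
    \<comment> \<open>This is \<open>(d - 2) v + r v'\<close>, and
      \<open>P = (r^d h) z / 2 + r^d v^(q+2) / (q + 2)\<close>. So \<open>z \<ge> 0\<close> together
      with \<open>h \<le> 0\<close> leaves only the last term as an upper bound. Since
      \<open>z\<close> is nonincreasing, a negative value would keep \<open>r v'\<close> below a
      negative constant, and \<open>v\<close> would become negative logarithmically.\<close>
    define z where "z r = (real d - 2) * ?v r + r^2 * ?h r" for r
    have z_deriv: "(z has_real_derivative - (r * (?v r powr q * ?v r))) (at r)" if r: "r > 0" for r
    proof -
      have "(z has_real_derivative (real d - 2) * (r * ?h r) + (2 * r * ?h r + (0 * ?v r - truncated_power q (?v r) - d * ?h r) / r * r^2)) (at r)"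
        unfolding z_def using r
        by (intro DERIV_add DERIV_cmult DERIV_mult v_deriv h_deriv) (auto intro!: derivative_eq_intros)
      moreover have "(real d - 2) * (r * ?h r) + (2 * r * ?h r + (0 * ?v r - truncated_power q (?v r) - d * ?h r) / r * r^2)
        = - (r * (?v r powr q * ?v r))"
        using r N[of r] by (simp add: power2_eq_square field_simps)
      ultimately show ?thesis by simp
    qed
    have z_nn: "z r \<ge> 0" if r: "r > 0" for r
    proof (rule ccontr)
      assume neg: "\<not> z r \<ge> 0"
      have "x * (x * ?h x) \<le> - (- z r)" if x: "x \<ge> r" for x
      proof -
        have "z x \<le> z r"
        proof (rule DERIV_nonpos_imp_nonincreasing[OF x])
          fix y assume y: "r \<le> y"
          then show "\<exists>b. (z has_real_derivative b) (at y) \<and> b \<le> 0"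
            using z_deriv[of y] nn[of y] r by (intro exI conjI) auto
        qed
        moreover have "z x \<ge> x * (x * ?h x)"
          using nn[of x] d2 r x by (simp add: z_def power2_eq_square)
        ultimately show ?thesis by simp
      qed
      then have "\<exists>x\<ge>r. ?v x < 0"
        using r neg
        by (intro eventually_negative_of_log_decay[where f'="\<lambda>x. x * ?h x" and \<delta>="- z r"] v_deriv) auto
      then show False using nn r by (meson not_le order_trans less_imp_le)
    qed
    \<comment> \<open>By this relation the power \<open>d/2\<close> of \<open>decay\<close> bounds
      \<open>r^d v^2\<close> by a constant; the factor \<open>v^q\<close> left over in
      \<open>r^d v^(q+2)\<close> supplies the \<open>1 / r^2\<close>.\<close>
    have qd: "q * (real d / 2) = 2" by (simp add: q d field_simps)
    define M where "M = (d^2/2) powr (d/2) * (d^2/2) / (q+2)"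
    have "P 1 \<le> M / r^2" if r: "r \<ge> 1" for r
    proof -
      have r0: "r > 0" using r by simp
      have vv: "?v r > 0" using vpos r by simp
      have V: "?v r powr (q+2) = ?v r powr q * ?v r ^ 2"
        using vv by (simp add: powr_add powr_numeral)
      have "P r = 1/2 * (r^d * ?h r) * z r + r^d * (?v r powr (q+2)) / (q+2)"
        by (simp add: P_def z_def power_add field_simps power2_eq_square)
      moreover have "1/2 * (r^d * ?h r) * z r \<le> 0"
        using z_nn[OF r0] hle[OF r0] r0 by (simp add: mult_le_0_iff)
      ultimately have "P r \<le> (r^d * ?v r ^ 2) * (?v r powr q) / (q+2)"
        by (simp add: V mult_ac)
      also have "\<dots> \<le> (d^2/2) powr (d/2) * ((d^2/2) / r^2) / (q+2)"
      proof (intro divide_right_mono mult_mono)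
        have "r^d * ?v r ^ 2 = (r^2 * ?v r powr q) powr (d/2)"
        proof -
          have "(r^2 * ?v r powr q) powr (d/2) = (r powr 2) powr (d/2) * (?v r powr q) powr (d/2)"
            using r0 by (simp add: powr_mult powr_numeral)
          also have "\<dots> = r powr (real d) * ?v r powr 2"
            using qd by (simp only: powr_powr) simp
          finally show ?thesis using r0 vv by (simp add: powr_realpow powr_numeral)
        qed
        also have "\<dots> \<le> (d^2/2) powr (d/2)"
          using decay[OF r0] by (intro powr_mono2) auto
        finally show "r^d * ?v r ^ 2 \<le> (d^2/2) powr (d/2)" .
        show "?v r powr q \<le> (d^2/2) / r^2"
          using decay[OF r0] r0 by (simp add: field_simps)
      qed (use q_pos in auto)
      also have "\<dots> = M / r^2"
      proof -
        have "a * (b / c) / f = a * b / f / c" for a b c f :: real by simp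
        then show ?thesis unfolding M_def .
      qed
      finally show ?thesis using P_ge[OF r] by simp
    qed
    moreover have "((\<lambda>r. M / r^2) \<longlongrightarrow> 0) at_top"
      by (intro tendsto_divide_0[OF tendsto_const] filterlim_at_top_imp_at_infinity filterlim_pow_at_top filterlim_ident) simp
    ultimately have "P 1 \<le> 0"
      by (intro tendsto_lowerbound[of "\<lambda>r. M / r^2" 0 at_top]) (auto simp: eventually_at_top_linorder)
    then show False using P1 by simp
  qed
qed

text \<open>The quantity is the mechanical energy \<open>(v')^2 / 2 + B(v) - e v^2 / 2\<close>; the
  damping \<open>(k / r) v'\<close> gives it the derivative \<open>- k r h^2\<close>.\<close>

lemma energy_antimono:
  assumes e: "0 \<le> e" "e \<le> 1" and B: "\<And>y. (B has_real_derivative truncated_power q y) (at y)"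
    and rs: "0 \<le> r" "r \<le> s"
  shows "(s * h e s)^2 / 2 + B (v e s) - e * (v e s)^2 / 2 \<le> (r * h e r)^2 / 2 + B (v e r) - e * (v e r)^2 / 2"
proof -
  let ?E = "\<lambda>r. (r * h e r)^2 / 2 + B (v e r) - e * (v e r)^2 / 2"
  have "?E s \<le> ?E r"
  proof (rule DERIV_nonpos_imp_decreasing_open[OF rs(2), of ?E])
    have "continuous_on UNIV B"
      using B by (auto intro: DERIV_continuous_on has_field_derivative_at_within)
    then have "continuous_on {r..s} (\<lambda>r. B (v e r))"
      by (rule continuous_on_compose2) (auto intro!: vc continuous_intros)
    then show "continuous_on {r..s} ?E"
      by (intro continuous_intros hc vc) auto
    fix x assume x: "r < x" "x < s"
    then have x0: "x > 0" using rs by simp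
    let ?G = "e * v e x - truncated_power q (v e x)"
    have dw: "((\<lambda>r. (r * h e r)^2) has_real_derivative 2 * (x * h e x) * (h e x + (?G - d * h e x))) (at x)"
      using x0 by (auto intro!: derivative_eq_intros h_deriv e)
    have dv: "((\<lambda>r. e * (v e r)^2) has_real_derivative e * (2 * v e x * (x * h e x))) (at x)"
      by (auto intro!: derivative_eq_intros v_deriv)
    have D: "(?E has_real_derivative
       2 * (x * h e x) * (h e x + (?G - d * h e x)) / 2 + truncated_power q (v e x) * (x * h e x)
         - e * (2 * v e x * (x * h e x)) / 2) (at x)"
      by (intro DERIV_add DERIV_diff DERIV_cdivide dw dv DERIV_chain2[OF B] v_deriv)
    have eq: "2 * (x * h e x) * (h e x + (?G - d * h e x)) / 2 + truncated_power q (v e x) * (x * h e x)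
         - e * (2 * v e x * (x * h e x)) / 2 = - (k * x * (h e x)^2)"
      by (simp add: d field_simps power2_eq_square)
    show "\<exists>y. (?E has_real_derivative y) (at x) \<and> y \<le> 0"
      using D[unfolded eq] x0 by (intro exI conjI) auto
  qed
  then show ?thesis .
qed

text \<open>
  At the supremum of the frequencies whose profile crosses zero, the profile neither crosses zero nor
  reaches negative energy, since both alternatives are open conditions on the frequency.
\<close>

lemma critical_frequency:
  assumes B: "\<And>y. (B has_real_derivative truncated_power q y) (at y)" "B 0 = 0"
    and B1: "B 1 = 1 / (q + 2)"
  shows "\<exists>e. 0 < e \<and> e < 1 \<and> (\<forall>r\<ge>0. v e r > 0) \<and>
      (\<forall>r\<ge>0. 0 \<le> (r * h e r)^2 / 2 + B (v e r) - e * (v e r)^2 / 2)"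
proof -
  define P where "P = {e. 0 \<le> e \<and> e \<le> 1 \<and> (\<exists>r>0. v e r < 0)}"
  have zero: "\<exists>s\<ge>0. s \<le> r \<and> v e s = 0" if "v e r < 0" "r \<ge> 0" for e r
    using IVT2'[of "v e" r 0 0] that v_0[of e] vc[OF continuous_on_const continuous_on_id, of "{0..r}" e]
    by auto
  \<comment> \<open>At a zero of \<open>v\<close> the energy reduces to its kinetic part, which is
    nonnegative; a profile of negative energy can therefore not vanish later.\<close>
  have no_zero: "v e s \<noteq> 0"
    if e: "0 \<le> e" "e \<le> 1"
      and "0 \<le> r" "r \<le> s" and neg: "(r * h e r)^2 / 2 + B (v e r) - e * (v e r)^2 / 2 < 0"
    for e r s
  proof
    assume "v e s = 0"
    then show False
      using energy_antimono[OF e B(1) \<open>0 \<le> r\<close> \<open>r \<le> s\<close>] neg B(2) zero_le_power2[of "s * h e s"] by simp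
  qed
  have P0: "0 \<in> P" using lane_emden_crosses by (auto simp: P_def)
  \<comment> \<open>The energy at \<open>r = 0\<close> is \<open>1 / (q + 2) - e / 2\<close>,
    negative for \<open>e > 2 / (q + 2)\<close>. This keeps the supremum strictly below 1, the upper
    end of the frequencies for which the equation is known to hold.\<close>
  have P_le: "e \<le> 2 / (q + 2)" if eP: "e \<in> P" for e
  proof (rule ccontr)
    assume gt: "\<not> e \<le> 2 / (q + 2)"
    obtain r where e: "0 \<le> e" "e \<le> 1" and r: "r > 0" "v e r < 0" using eP by (auto simp: P_def)
    obtain s where s: "s \<ge> 0" "v e s = 0" using zero[of e r] r by auto
    have "(0 * h e 0)^2 / 2 + B (v e 0) - e * (v e 0)^2 / 2 < 0"
      using gt q_pos by (simp add: v_0 B1 field_simps)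
    then show False using no_zero[OF e, of 0 s] s by simp
  qed
  define es where "es = Sup P"
  have bdd: "bdd_above P" using P_le by (auto intro!: bdd_aboveI)
  have es_ge: "e \<le> es" if "e \<in> P" for e
    unfolding es_def by (rule cSup_upper[OF that bdd])
  have es_le: "es \<le> 2 / (q + 2)"
    unfolding es_def by (rule cSup_least) (use P0 P_le in auto)
  have es1: "es < 1" using es_le q_pos by (smt (verit) divide_less_eq_1_pos)
  have es0: "0 \<le> es" using es_ge[OF P0] .
  \<comment> \<open>A strictly negative value at a fixed \<open>r\<close> survives a small increase
    of \<open>e\<close>, and \<open>es < 1\<close> leaves room for one. In particular
    \<open>es\<close> differs from 0, which belongs to \<open>P\<close>.\<close>
  have nP: "es \<notin> P"
  proof
    assume "es \<in> P"
    then obtain r where r: "r > 0" "v es r < 0" by (auto simp: P_def)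
    have "continuous_on UNIV (\<lambda>e. v e r)" by (intro vc continuous_intros)
    then have "isCont (\<lambda>e. v e r) es" by (simp add: continuous_on_eq_continuous_at)
    then have "eventually (\<lambda>e. v e r < 0) (at es)"
      using order_tendstoD(2)[of "\<lambda>e. v e r" "v es r" "at es" 0] r by (simp add: isCont_def)
    then have "eventually (\<lambda>e. v e r < 0) (at_right es)"
      by (simp add: eventually_at_split)
    moreover have "eventually (\<lambda>e. e < 1) (at_right es)"
      using es1 by (auto simp: eventually_at_right_field)
    moreover have "eventually (\<lambda>e. e > es) (at_right es)"
      by (simp add: eventually_at_filter)
    ultimately have "eventually (\<lambda>e. False) (at_right es)"
    proof eventually_elim
      case (elim e)
      then have "e \<in> P" using r es0 by (auto simp: P_def)
      then show ?case using es_ge elim by force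
    qed
    then show False by simp
  qed
  have es_pos: "es > 0" using nP P0 es0 by (metis less_eq_real_def)
  have nn: "v es r \<ge> 0" if "r \<ge> 0" for r
    using nP es0 es1 that v_0[of es] by (cases "r = 0") (force simp: P_def not_less not_le)+
  have pos: "v es r > 0" if "r \<ge> 0" for r
    using pos_of_nonneg[OF es0 less_imp_le[OF es1] nn that] by simp
  have "0 \<le> (r * h es r)^2 / 2 + B (v es r) - es * (v es r)^2 / 2"
    if r: "r \<ge> 0" for r
  proof (rule ccontr)
    let ?E = "\<lambda>e. (r * h e r)^2 / 2 + B (v e r) - e * (v e r)^2 / 2"
    assume "\<not> 0 \<le> ?E es"
    then have neg: "?E es < 0" by simp
    have "continuous_on UNIV B"
      using B(1) by (auto intro: DERIV_continuous_on has_field_derivative_at_within)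
    then have "continuous_on UNIV (\<lambda>e. B (v e r))"
      by (rule continuous_on_compose2) (auto intro!: vc continuous_intros)
    then have "continuous_on UNIV ?E"
      by (intro continuous_intros hc vc) auto
    then have "isCont ?E es" by (simp add: continuous_on_eq_continuous_at)
    then have "eventually (\<lambda>e. ?E e < 0) (at es)"
      using order_tendstoD(2)[of ?E "?E es" "at es" 0] neg by (simp add: isCont_def)
    then have "eventually (\<lambda>e. ?E e < 0) (nhds es)"
      using neg by (simp add: eventually_nhds_conv_at)
    then obtain U where U: "open U" "es \<in> U" "\<And>e. e \<in> U \<Longrightarrow> ?E e < 0"
      by (auto simp: eventually_nhds)
    \<comment> \<open>The tube lemma extends positivity on the compact segment [0, r] from
      \<open>es\<close> to nearby \<open>e\<close>. Some such \<open>e\<close> lies in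
      \<open>P\<close>, yet its zero can be neither in [0, r] nor, the energy at \<open>r\<close>
      being negative, beyond \<open>r\<close>.\<close>
    define W where "W = {x. 0 < v (fst x) (snd x)}"
    have "open W"
      unfolding W_def by (intro open_Collect_less continuous_on_const vc continuous_intros)
    moreover have "{es} \<times> {0..r} \<subseteq> W" using pos by (auto simp: W_def)
    ultimately obtain X where X: "es \<in> X" "open X" "X \<times> {0..r} \<subseteq> W"
      using Elementary_Topology.tube_lemma[of "{0..r}" W es] by auto
    obtain \<delta> where \<delta>: "\<delta> > 0" "ball es \<delta> \<subseteq> U \<inter> X"
      using open_contains_ball[of "U \<inter> X"] U X by (metis IntI open_Int)
    obtain e where eP: "e \<in> P" and e: "es - \<delta> < e"
      using less_cSupD[of P "es - \<delta>"] P0 \<delta>(1) unfolding es_def by auto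
    have "e \<in> U \<inter> X"
      using \<delta> e es_ge[OF eP] by (intro subsetD[OF \<delta>(2)]) (auto simp: dist_real_def)
    then have eU: "e \<in> U" and eX: "e \<in> X" by auto
    obtain r1 where e01: "0 \<le> e" "e \<le> 1" and r1: "r1 > 0" "v e r1 < 0" using eP by (auto simp: P_def)
    obtain s where s: "s \<ge> 0" "v e s = 0" using zero[of e r1] r1 by auto
    show False
    proof (cases "s \<le> r")
      case True
      then have "(e, s) \<in> W" using eX s by (intro subsetD[OF X(3)]) auto
      then show False using s by (simp add: W_def)
    next
      case False
      then show False using no_zero[OF e01 r _ U(3)[OF eU], of s] s by auto
    qed
  qed
  then show ?thesis
    using es_pos es1 pos by (intro exI[of _ es]) auto
qed

text \<open>Nonnegative energy acts twice. Where the slope vanishes it forces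
  \<open>v powr q > e\<close>, which excludes a first turning point; where \<open>v\<close> is small
  it bounds the slope below by a multiple of \<open>v\<close>, which yields the exponential
  rate.\<close>

lemma ground_state:
  "\<exists>e c C. 0 < e \<and> e < 1 \<and> c > 0 \<and>
    (\<forall>r\<ge>0. 0 < v e r \<and> v e r \<le> 1 \<and> v e r \<le> C * exp (- c * r) \<and> \<bar>r * h e r\<bar> \<le> C * exp (- c * r))"
proof -
  obtain B where B: "B 0 = 0" "\<And>y. (B has_real_derivative truncated_power q y) (at y)"
    "\<And>y. 0 \<le> y \<Longrightarrow> y \<le> 1 \<Longrightarrow> B y = y powr q * y^2 / (q + 2)"
    using truncated_power_primitive[OF q_pos] by blast
  obtain e where e: "0 < e" "e < 1" and pos: "\<And>r. r \<ge> 0 \<Longrightarrow> v e r > 0"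
    and E: "\<And>r. r \<ge> 0 \<Longrightarrow> 0 \<le> (r * h e r)^2 / 2 + B (v e r) - e * (v e r)^2 / 2"
  proof -
    have "B 1 = 1 / (q + 2)" using B(3)[of 1] by simp
    from critical_frequency[OF B(2,1) this] that show ?thesis by blast
  qed
  have e01: "0 \<le> e" "e \<le> 1" using e by auto
  let ?v = "v e" and ?h = "h e"
  have hcont: "continuous_on S ?h" for S by (intro hc continuous_intros)
  have vcont: "continuous_on S ?v" for S by (intro vc continuous_intros)
  have v_le_of: "?v r \<le> 1" if r: "r \<ge> 0" and neg: "\<And>s. 0 < s \<Longrightarrow> s < r \<Longrightarrow> ?h s < 0" for r
  proof -
    have "?v r \<le> ?v 0"
    proof (rule DERIV_nonpos_imp_decreasing_open[OF r _ vcont])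
      fix s assume "0 < s" "s < r"
      then show "\<exists>y. (?v has_real_derivative y) (at s) \<and> y \<le> 0"
        using v_deriv[of e s] neg[of s] by (intro exI conjI) (auto simp: mult_le_0_iff)
    qed
    then show ?thesis by (simp add: v_0)
  qed
  \<comment> \<open>At the first zero \<open>r1\<close> of \<open>h\<close> only the potential part
    of the energy is left, so \<open>v powr q \<ge> e (q + 2) / 2 > e\<close> and
    \<open>h' < 0\<close>. Then \<open>h\<close> would exceed 0 just before
    \<open>r1\<close>.\<close>
  have hneg: "?h r < 0" if r: "r \<ge> 0" for r
  proof (rule ccontr)
    assume nneg: "\<not> ?h r < 0"
    define A where "A = {s. 0 \<le> s \<and> s \<le> r \<and> 0 \<le> ?h s}"
    have A: "A = {0..r} \<inter> {s. 0 \<le> ?h s}" by (auto simp: A_def)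
    have "compact A"
      unfolding A by (intro compact_Int_closed closed_Collect_le hcont continuous_on_const compact_Icc)
    moreover have "A \<noteq> {}" using r nneg by (auto simp: A_def not_less)
    ultimately obtain r1 where r1: "r1 \<in> A" "\<And>s. s \<in> A \<Longrightarrow> r1 \<le> s"
      using compact_attains_inf[of A] by blast
    have h0: "?h 0 < 0" using h_0[OF e01] e d by (simp add: divide_neg_pos)
    have r1p: "r1 > 0" using r1(1) h0 by (auto simp: A_def less_le)
    have less: "?h s < 0" if "0 < s" "s < r1" for s
      using r1(2)[of s] r1(1) that by (force simp: A_def)
    have "?h r1 = 0"
    proof (rule antisym)
      show "0 \<le> ?h r1" using r1 by (simp add: A_def)
      have "(?h \<longlongrightarrow> ?h r1) (at_left r1)"
        using hcont[of UNIV] by (simp add: continuous_on_eq_continuous_at isCont_def filterlim_at_split)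
      moreover have "eventually (\<lambda>s. ?h s \<le> 0) (at_left r1)"
        using r1p less by (auto simp: eventually_at_left_field intro!: exI[of _ 0] less_imp_le)
      ultimately show "?h r1 \<le> 0"
        by (rule tendsto_upperbound) simp
    qed
    moreover have v1: "?v r1 \<le> 1" using v_le_of[OF less_imp_le[OF r1p] less] .
    moreover have vp: "?v r1 > 0" using pos r1p by simp
    ultimately have "0 \<le> (?v r1 powr q / (q + 2) - e / 2) * (?v r1)^2"
      using E[of r1] r1p B(3)[of "?v r1"] by (simp add: algebra_simps)
    then have "e / 2 \<le> ?v r1 powr q / (q + 2)"
      using vp by (simp add: zero_le_mult_iff)
    then have "e * (q + 2) / 2 \<le> ?v r1 powr q"
      using q_pos by (simp add: field_simps)
    moreover have "e < e * (q + 2) / 2" using e q_pos by (simp add: field_simps)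
    ultimately have "?v r1 * e < ?v r1 * (?v r1 powr q)"
      using vp by (intro mult_strict_left_mono) auto
    then have "(e * ?v r1 - truncated_power q (?v r1) - d * ?h r1) / r1 < 0"
      using v1 vp \<open>?h r1 = 0\<close> r1p by (simp add: truncated_power_unit divide_neg_pos mult.commute)
    from DERIV_neg_dec_left[OF h_deriv[OF e01 r1p] this]
    obtain \<delta> where \<delta>: "\<delta> > 0" "\<And>t. 0 < t \<Longrightarrow> t < \<delta> \<Longrightarrow> ?h r1 < ?h (r1 - t)" by auto
    have "?h r1 < ?h (r1 - min \<delta> r1 / 2)" using \<delta> r1p by (intro \<delta>(2)) auto
    moreover have "?h (r1 - min \<delta> r1 / 2) < 0" using \<delta> r1p by (intro less) auto
    ultimately show False using \<open>?h r1 = 0\<close> by simp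
  qed
  have vle: "?v r \<le> 1" if "r \<ge> 0" for r using v_le_of[OF that] hneg by simp
  have anti: "?v s \<le> ?v r" if "0 \<le> r" "r \<le> s" for r s
  proof (rule DERIV_nonpos_imp_nonincreasing[OF that(2)])
    fix x assume "r \<le> x"
    then show "\<exists>y. (?v has_real_derivative y) (at x) \<and> y \<le> 0"
      using v_deriv[of e x] hneg[of x] that by (intro exI conjI) (auto simp: mult_le_0_iff)
  qed
  have N: "truncated_power q (?v r) = ?v r powr q * ?v r" if "r \<ge> 0" for r
    using that pos vle by (simp add: truncated_power_unit less_imp_le)
  \<comment> \<open>The midpoint between \<open>e\<close>, where \<open>e v - v^(q+1)\<close>
    changes sign, and \<open>e (q + 2) / 2\<close>, where the potential part of the energy does. If
    \<open>v powr q\<close> stayed above it, the source term would stay below a negative constant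
    and the profile would become negative; below it the energy bound on the slope has a definite
    margin.\<close>
  define \<theta> where "\<theta> = e + e * q / 4"
  have "\<exists>r\<ge>0. ?v r powr q \<le> \<theta>"
  proof (rule ccontr)
    assume "\<not> ?thesis"
    then have big: "?v r powr q > \<theta>" if "r \<ge> 0" for r
      using that by (meson not_le)
    define m where "m = \<theta> powr (1/q)"
    have th: "\<theta> > 0" using e q_pos by (simp add: \<theta>_def add_pos_pos)
    have m: "m > 0" using th by (simp add: m_def)
    have vm: "?v r \<ge> m" if "r \<ge> 0" for r
    proof -
      have "m \<le> (?v r powr q) powr (1/q)"
        unfolding m_def using big[OF that] th q_pos by (intro powr_mono2) auto
      then show ?thesis using pos[OF that] q_pos by (simp add: powr_powr)
    qed
    define \<delta> where "\<delta> = m * (e * q / 4)"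
    have \<delta>: "\<delta> > 0" using m e q_pos by (simp add: \<delta>_def)
    have G: "e * ?v r - truncated_power q (?v r) \<le> - \<delta>" if "r \<ge> 0" for r
    proof -
      have "m * (e * q / 4) \<le> ?v r * (?v r powr q - e)"
        using vm[OF that] big[OF that] m e q_pos by (intro mult_mono) (auto simp: \<theta>_def)
      then show ?thesis by (simp add: N[OF that] \<delta>_def algebra_simps)
    qed
    have "r * (r * ?h r) \<le> - (\<delta> / d)" if r: "r \<ge> 1" for r
    proof -
      have "r^d * ?h r + (\<delta> / d) * r^d \<le> 0^d * ?h 0 + (\<delta> / d) * 0^d"
      proof (rule DERIV_nonpos_imp_nonincreasing[of 0 r "\<lambda>r. r^d * ?h r + (\<delta> / d) * r^d"])
        fix x assume x: "0 \<le> x" "x \<le> r"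
        have D: "((\<lambda>r. r^d * ?h r + (\<delta> / d) * r^d) has_real_derivative
          x^k * (e * ?v x - truncated_power q (?v x)) + (\<delta> / d) * (d * x^k)) (at x)"
          by (intro DERIV_add flux_deriv e01 DERIV_cmult power_d_deriv)
        have "x^k * (e * ?v x - truncated_power q (?v x)) \<le> x^k * (- \<delta>)"
          using G[OF x(1)] x by (intro mult_left_mono) auto
        then show "\<exists>y. ((\<lambda>r. r^d * ?h r + (\<delta> / d) * r^d) has_real_derivative y) (at x) \<and> y \<le> 0"
        proof (intro exI conjI)
          have "(\<delta> / d) * (d * x^k) = x^k * \<delta>" using d by simp
          then show "x^k * (e * ?v x - truncated_power q (?v x)) + (\<delta> / d) * (d * x^k) \<le> 0"
            using \<open>x^k * (e * ?v x - truncated_power q (?v x)) \<le> x^k * (- \<delta>)\<close> by simp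
        qed (rule D)
      qed (use r in auto)
      then have "r^d * (?h r + \<delta> / d) \<le> 0" by (simp add: d algebra_simps)
      then have "?h r + \<delta> / d \<le> 0"
        using nonpos_of_pos_mult_nonpos[of "r^d"] r by (metis less_le_trans zero_less_one zero_less_power)
      then have 1: "\<delta> / d \<le> - ?h r" by simp
      have "\<delta> / d * 1 \<le> - ?h r * (r * r)"
        using 1 \<delta> r hneg[of r] mult_mono[of 1 r 1 r] by (intro mult_mono) auto
      then show ?thesis by (simp add: algebra_simps)
    qed
    then have "\<exists>r\<ge>1. ?v r < 0"
      using \<delta> d
      by (intro eventually_negative_of_log_decay[where f'="\<lambda>x. x * ?h x" and \<delta>="\<delta> / d"] v_deriv) auto
    then show False using pos by (meson less_imp_le not_le order_trans zero_le_one)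
  qed
  then obtain r3 where r3: "r3 \<ge> 0" "?v r3 powr q \<le> \<theta>" by blast
  \<comment> \<open>Nonnegative energy reads \<open>(v')^2 \<ge> (e - 2 v^q / (q + 2)) v^2\<close>,
    and \<open>c^2\<close> is the bracket with \<open>v^q\<close> replaced by its bound
    \<open>\<theta>\<close>.\<close>
  define c where "c = sqrt (e * q / (2 * (q + 2)))"
  have c: "c > 0" using e q_pos by (simp add: c_def)
  have c2: "c^2 = e - 2 * \<theta> / (q + 2)"
  proof -
    have "c^2 = e * q / (2 * (q + 2))" using e q_pos by (simp add: c_def)
    also have "\<dots> = e - 2 * \<theta> / (q + 2)" using q_pos by (simp add: \<theta>_def field_simps)
    finally show ?thesis .
  qed
  have slope: "r * ?h r \<le> - c * ?v r" if r: "r \<ge> r3" for r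
  proof -
    have r0: "r \<ge> 0" using r r3 by simp
    have "?v r powr q \<le> \<theta>"
      using powr_mono2[of q "?v r" "?v r3"] anti[OF r3(1) r] pos[OF r0] q_pos r3(2) by simp
    then have "2 * (?v r powr q) / (q + 2) \<le> 2 * \<theta> / (q + 2)"
      using q_pos by (intro divide_right_mono) auto
    then have "c^2 * (?v r)^2 \<le> (e - 2 * (?v r powr q) / (q + 2)) * (?v r)^2"
      unfolding c2 by (intro mult_right_mono) auto
    also have "\<dots> \<le> (r * ?h r)^2"
      using E[OF r0] B(3)[of "?v r"] pos[OF r0] vle[OF r0] by (simp add: algebra_simps)
    finally have "(c * ?v r)^2 \<le> (- (r * ?h r))^2" by (simp add: power_mult_distrib)
    then have "c * ?v r \<le> - (r * ?h r)"
      by (rule power2_le_imp_le) (use hneg[OF r0] r0 in \<open>auto simp: mult_le_0_iff\<close>)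
    then show ?thesis by simp
  qed
  define C0 where "C0 = exp (c * r3)"
  have C0: "C0 \<ge> 1" using c r3 by (simp add: C0_def)
  have dec: "?v r \<le> C0 * exp (- c * r)" if r: "r \<ge> 0" for r
  proof (cases "r \<le> r3")
    case True
    have "?v r \<le> 1" using vle r by simp
    also have "1 \<le> exp (c * r3 + - c * r)" using True c by (simp add: algebra_simps)
    finally show ?thesis by (simp only: C0_def exp_add)
  next
    case False
    then have r': "r3 \<le> r" by simp
    have "?v r * exp (c * r) \<le> ?v r3 * exp (c * r3)"
    proof (rule DERIV_nonpos_imp_nonincreasing[OF r', of "\<lambda>r. ?v r * exp (c * r)"])
      fix x assume x: "r3 \<le> x"
      have "((\<lambda>r. ?v r * exp (c * r)) has_real_derivative (x * ?h x + c * ?v x) * exp (c * x)) (at x)"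
        by (auto intro!: derivative_eq_intros v_deriv simp: algebra_simps)
      moreover have "(x * ?h x + c * ?v x) * exp (c * x) \<le> 0"
        using slope[OF x] by (intro mult_nonpos_nonneg) auto
      ultimately show "\<exists>y. ((\<lambda>r. ?v r * exp (c * r)) has_real_derivative y) (at x) \<and> y \<le> 0" by blast
    qed
    also have "\<dots> \<le> C0" using vle[OF r3(1)] by (simp add: C0_def)
    finally show ?thesis by (simp add: exp_minus field_simps)
  qed
  have "((\<lambda>r. C0 * exp (- c * r)) \<longlongrightarrow> C0 * 0) at_top"
    using c by (intro tendsto_intros filterlim_compose[OF exp_at_bot] filterlim_tendsto_neg_mult_at_bot[OF tendsto_const])
      (auto intro: filterlim_ident)
  then have "eventually (\<lambda>r. C0 * exp (- c * r) < e powr (1/q)) at_top"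
    using e by (intro order_tendstoD(2)) auto
  then obtain r4 where r4: "r4 \<ge> 0" "\<And>r. r \<ge> r4 \<Longrightarrow> C0 * exp (- c * r) < e powr (1/q)"
    unfolding eventually_at_top_linorder by (metis linear order_trans)
  \<comment> \<open>The derivative of the slope is \<open>e v - v^(q+1) - k h\<close>; beyond
    \<open>r4\<close> one has \<open>v powr q \<le> e\<close>, so both contributions are nonnegative
    and the profile is convex.\<close>
  have slope_mono: "r * ?h r \<le> s * ?h s" if "r4 < r" "r \<le> s" for r s
  proof (rule DERIV_nonneg_imp_nondecreasing[OF that(2), of "\<lambda>r. r * ?h r"])
    fix x assume x: "r \<le> x"
    then have x0: "x > 0" using that r4 by simp
    let ?G = "e * ?v x - truncated_power q (?v x)"
    have D: "((\<lambda>r. r * ?h r) has_real_derivative ?G - k * ?h x) (at x)"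
      using x0 by (auto intro!: derivative_eq_intros h_deriv e01 simp: d field_simps)
    have "?v x \<le> e powr (1/q)" using dec[of x] r4(2)[of x] x that x0 by simp
    then have "?v x powr q \<le> (e powr (1/q)) powr q"
      using pos[of x] x0 q_pos by (intro powr_mono2) auto
    then have "?v x powr q \<le> e" using e q_pos by (simp add: powr_powr)
    then have "?v x powr q * ?v x \<le> e * ?v x"
      using pos[of x] x0 by (intro mult_right_mono) auto
    then have "?G - k * ?h x \<ge> 0"
      using N[of x] x0 hneg[of x] mult_nonneg_nonpos[of "real k" "?h x"] by simp
    then show "\<exists>y. ((\<lambda>r. r * ?h r) has_real_derivative y) (at x) \<and> 0 \<le> y"
      using D by blast
  qed
  \<comment> \<open>By convexity the steepness at \<open>r\<close> is at most the mean steepness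
    over [r - 1, r], hence at most \<open>v (r - 1)\<close>. The shift by 1 costs the factor
    \<open>exp c\<close>.\<close>
  have tail: "\<bar>r * ?h r\<bar> \<le> C0 * exp c * exp (- c * r)" if r: "r > r4 + 1" for r
  proof -
    have r1: "r - 1 < r" by simp
    obtain z where z: "z > r - 1" "z < r" "?v r - ?v (r - 1) = (r - (r - 1)) * (z * ?h z)"
      using MVT2[OF r1, of ?v "\<lambda>x. x * ?h x"] v_deriv by auto
    have "z * ?h z \<le> r * ?h r" using z r by (intro slope_mono) auto
    then have "- (r * ?h r) \<le> ?v (r - 1)"
      using z pos[of r] r r4 by simp
    also have "\<dots> \<le> C0 * exp (- c * (r - 1))" using r r4 by (intro dec) auto
    also have "\<dots> = C0 * exp c * exp (- c * r)"
      by (simp add: exp_add[symmetric] algebra_simps)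
    finally show ?thesis using hneg[of r] r r4 by (simp add: abs_if mult_less_0_iff)
  qed
  have "continuous_on {0..r4+1} (\<lambda>r. r * ?h r)" by (intro continuous_intros hcont)
  then have "bounded ((\<lambda>r. r * ?h r) ` {0..r4+1})"
    by (intro compact_imp_bounded compact_continuous_image) auto
  then obtain M where "\<forall>r\<in>{0..r4+1}. \<bar>r * ?h r\<bar> \<le> M"
    by (auto simp: bounded_iff)
  then have M: "\<bar>r * ?h r\<bar> \<le> M" if "0 \<le> r" "r \<le> r4 + 1" for r
    using that by simp
  have M0: "M \<ge> 0" using M[of 0] r4 by simp
  define C where "C = C0 * exp c + M * exp (c * (r4 + 1))"
  have CC: "C \<ge> C0" "C \<ge> C0 * exp c"
  proof -
    have "C0 * 1 \<le> C0 * exp c" using C0 c by (intro mult_left_mono) auto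
    moreover have "0 \<le> M * exp (c * (r4 + 1))" using M0 by simp
    ultimately show "C \<ge> C0" "C \<ge> C0 * exp c" unfolding C_def by linarith+
  qed
  have "?v r \<le> C * exp (- c * r)" if "r \<ge> 0" for r
    using dec[OF that] mult_right_mono[OF CC(1), of "exp (- c * r)"] by (meson order_trans exp_ge_zero)
  moreover have "\<bar>r * ?h r\<bar> \<le> C * exp (- c * r)" if r: "r \<ge> 0" for r
  proof (cases "r \<le> r4 + 1")
    case True
    have "\<bar>r * ?h r\<bar> \<le> M * 1" using M[OF r True] by simp
    also have "\<dots> \<le> M * exp (c * (r4 + 1) + - c * r)"
      using M0 c mult_left_mono[OF True, of c] by (intro mult_left_mono) auto
    also have "\<dots> = M * exp (c * (r4 + 1)) * exp (- c * r)" by (simp only: exp_add mult.assoc)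
    also have "\<dots> \<le> C * exp (- c * r)"
      using C0 by (intro mult_right_mono) (auto simp: C_def)
    finally show ?thesis .
  next
    case False
    then have "\<bar>r * ?h r\<bar> \<le> C0 * exp c * exp (- c * r)" by (intro tail) simp
    also have "\<dots> \<le> C * exp (- c * r)" using CC by (intro mult_right_mono) auto
    finally show ?thesis .
  qed
  ultimately show ?thesis
    using e c pos vle by blast
qed

end

text \<open>What the lens transform needs, with the truncation gone. \<open>compat\<close> is the
  regularity condition at the origin that makes the Laplacian continuous there; \<open>h_0\<close>
  says that the profile has nonzero curvature at its centre, the source of the lower bound on the
  gradient.\<close>

locale radial_profile =
  fixes d :: nat and q e \<gamma> C :: real and v h :: "real \<Rightarrow> real"
  assumes d: "d \<ge> 1" and q: "q = 4 / real d"
    and \<gamma>: "\<gamma> > 0" and h_cont: "continuous_on UNIV h" and h_0: "h 0 \<noteq> 0"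
    and v_deriv: "\<And>r. (v has_real_derivative r * h r) (at r)"
    and h_deriv: "\<And>r. r > 0 \<Longrightarrow> (h has_real_derivative (e * v r - \<bar>v r\<bar> powr q * v r - d * h r) / r) (at r)"
    and compat: "d * h 0 = e * v 0 - \<bar>v 0\<bar> powr q * v 0"
    and v_bound: "\<And>r. r \<ge> 0 \<Longrightarrow> \<bar>v r\<bar> \<le> C * exp (- \<gamma> * r)"
    and h_bound: "\<And>r. r \<ge> 0 \<Longrightarrow> \<bar>r * h r\<bar> \<le> C * exp (- \<gamma> * r)"

theorem radial_profile_exists:
  assumes "d \<ge> 1"
  obtains e \<gamma> C v h where "radial_profile d (4 / real d) e \<gamma> C v h"
proof -
  define q where "q = 4 / real d"
  obtain k where k: "d = Suc k" using assms by (cases d) auto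
  have q: "q > 0" using assms by (simp add: q_def)
  \<comment> \<open>Clamping \<open>e\<close> to [0,1] makes the Lipschitz constant
    \<open>(q + 1) + 1\<close> uniform in the frequency, so one application of
    \<open>radial_ode\<close> covers the whole family.\<close>
  define H where "H e s y = max 0 (min 1 e) * y - truncated_power q y" for e s y :: real
  have "\<bar>H e s y - H e s z\<bar> \<le> (q + 2) * \<bar>y - z\<bar>" for e s y z
  proof -
    have "\<bar>max 0 (min 1 e) * y - max 0 (min 1 e) * z\<bar> \<le> \<bar>y - z\<bar>"
      by (simp add: right_diff_distrib[symmetric] abs_mult mult_left_le_one_le)
    then show ?thesis
      using truncated_power_lipschitz[OF q, of y z] unfolding H_def
      by (simp only: distrib_right mult_1_left mult_2) linarith
  qed
  moreover have "continuous_on UNIV (\<lambda>(e,s,y). H e s y)"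
    unfolding H_def split_beta
    by (intro continuous_intros continuous_on_compose2[OF continuous_on_truncated_power[OF q]]) auto
  moreover have "\<bar>H e s 0\<bar> \<le> 0" for e s by (simp add: H_def)
  ultimately obtain v h where vh:
    "continuous_on UNIV (\<lambda>(e,r). v e r)" "continuous_on UNIV (\<lambda>(e,r). h e r)"
    "\<And>e. v e 0 = 1"
    "\<And>e r. (v e has_real_derivative 0 + r * h e r) (at r)"
    "\<And>e r. ((\<lambda>r. r^(k+1) * h e r) has_real_derivative r^k * H e r (v e r)) (at r)"
    "\<And>e. h e 0 = H e 0 1 / (k+1)"
    using radial_ode[of H "q+2" 0 1 0 k] by blast
  interpret radial_shooting d k q v h
  proof unfold_locales
    fix e r :: real assume e: "0 \<le> e" "e \<le> 1"
    have eq: "H e r (v e r) = e * v e r - truncated_power q (v e r)"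
      using e by (simp add: H_def)
    show "((\<lambda>r. r^d * h e r) has_real_derivative r^k * (e * v e r - truncated_power q (v e r))) (at r)"
      using vh(5)[of e r] unfolding eq by (simp add: k)
    show "h e 0 = (e - 1) / d"
      using vh(6)[of e] e by (simp add: H_def k truncated_power_unit)
  qed (use vh(1-4) in \<open>simp_all add: k q_def\<close>)
  obtain e c C where e: "0 < e" "e < 1" "c > 0"
    and g: "\<And>r. r \<ge> 0 \<Longrightarrow> 0 < v e r \<and> v e r \<le> 1 \<and> v e r \<le> C * exp (- c * r) \<and> \<bar>r * h e r\<bar> \<le> C * exp (- c * r)"
    using ground_state by blast
  have N: "truncated_power q (v e r) = \<bar>v e r\<bar> powr q * v e r" if "r \<ge> 0" for r
    using g[OF that] by (simp add: truncated_power_unit)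
  show ?thesis
  proof (rule that[of e c C "v e" "h e"], unfold_locales)
    show "continuous_on UNIV (h e)" by (intro hc continuous_intros)
    show "h e 0 \<noteq> 0" using h_0[of e] e k by simp
    show "(h e has_real_derivative (e * v e r - \<bar>v e r\<bar> powr (4 / d) * v e r - d * h e r) / r) (at r)" if "r > 0" for r
      using h_deriv[of e r] N[of r] e that by (simp add: q_def)
    show "d * h e 0 = e * v e 0 - \<bar>v e 0\<bar> powr (4 / d) * v e 0"
      using h_0[of e] e k by (simp add: v_0)
    show "\<bar>v e r\<bar> \<le> C * exp (- c * r)" if "r \<ge> 0" for r
      using g[OF that] by simp
  qed (use assms e g v_deriv in auto)
qed

section \<open>Integration by parts against test functions\<close>

lemma lebesgue_integral_translation:
  fixes F :: "'a::euclidean_space \<Rightarrow> complex"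
  assumes "continuous_on UNIV F"
  shows "(\<integral>x. F (c + x) \<partial>lebesgue) = (\<integral>x. F x \<partial>lebesgue)"
proof -
  have m: "F \<in> borel_measurable borel" using assms by (rule borel_measurable_continuous_onI)
  have "(\<integral>x. F x \<partial>lborel) = (\<integral>x. F x \<partial>distr lborel borel ((+) c))"
    by (simp add: lborel_distr_plus)
  also have "\<dots> = (\<integral>x. F (c + x) \<partial>lborel)"
    using m by (intro integral_distr) auto
  finally have "(\<integral>x. F (c + x) \<partial>lborel) = (\<integral>x. F x \<partial>lborel)" by simp
  moreover have "(\<lambda>x. F (c + x)) \<in> borel_measurable borel"
    using m by (intro measurable_compose[OF _ m]) auto
  ultimately show ?thesis
    using m by (simp add: integral_completion)
qed

text \<open>A bridge between the Lebesgue integral of the pairings and the gauge integral over a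
  box, in which parameter integrals are differentiated.\<close>

lemma continuous_bounded_support_integral:
  fixes F :: "'a::euclidean_space \<Rightarrow> complex"
  assumes F: "continuous_on UNIV F" and 0: "\<And>x. x \<notin> cbox a b \<Longrightarrow> F x = 0"
  shows "integrable lebesgue F" "(\<integral>x. F x \<partial>lebesgue) = integral (cbox a b) F"
proof -
  have ind: "(\<lambda>x. indicator (cbox a b) x *\<^sub>R F x) = F"
    using 0 by (auto simp: fun_eq_iff indicator_def)
  have "F absolutely_integrable_on cbox a b"
    by (intro absolutely_integrable_continuous continuous_on_subset[OF F]) auto
  then show "integrable lebesgue F" "(\<integral>x. F x \<partial>lebesgue) = integral (cbox a b) F"
    using set_lebesgue_integral_eq_integral(2)[of "cbox a b" F]
    by (auto simp: set_integrable_def set_lebesgue_integral_def ind)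
qed

text \<open>By translation invariance the integral of \<open>F (t w + x)\<close> does not depend on
  \<open>t\<close>; differentiating under the integral sign at \<open>t = 0\<close> gives the claim,
  without Fubini.\<close>

lemma integral_derivative_bounded_support:
  fixes F :: "'a::euclidean_space \<Rightarrow> complex"
  assumes F: "\<And>x. (F has_derivative F' x) (at x)" and cont: "continuous_on UNIV (\<lambda>x. F' x w)"
    and supp: "\<And>x. x \<notin> cbox a b \<Longrightarrow> F x = 0"
  shows "(\<integral>x. F' x w \<partial>lebesgue) = 0"
proof -
  have Fc: "continuous_on UNIV F"
    using F by (meson continuous_on_eq_continuous_at has_derivative_continuous open_UNIV)
  \<comment> \<open>All translates of the support with \<open>t\<close> in [-1,1] fit into one box,
    so a single domain of integration serves for every \<open>t\<close> near 0.\<close>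
  have "bounded {x + t *\<^sub>R w | x t. x \<in> cbox a b \<and> t \<in> {-1..1::real}}"
  proof -
    have "{x + t *\<^sub>R w | x t. x \<in> cbox a b \<and> t \<in> {-1..1::real}} = {x + y | x y. x \<in> cbox a b \<and> y \<in> (\<lambda>t. t *\<^sub>R w) ` {-1..1}}"
      by blast
    moreover have cp: "compact ((\<lambda>t. t *\<^sub>R w) ` {-1..1})"
      by (intro compact_continuous_image continuous_intros) auto
    ultimately show ?thesis
      using compact_imp_bounded[OF compact_sums[OF compact_cbox[of a b] cp]] by simp
  qed
  then obtain c where c: "{x + t *\<^sub>R w | x t. x \<in> cbox a b \<and> t \<in> {-1..1::real}} \<subseteq> cbox (- c) c"
    using bounded_subset_cbox_symmetric by blast
  have out: "F (t *\<^sub>R w + x) = 0" if "t \<in> {-1<..<1}" "x \<notin> cbox (-c) c" for t x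
  proof (rule supp, rule notI)
    assume "t *\<^sub>R w + x \<in> cbox a b"
    then have "(t *\<^sub>R w + x) + (- t) *\<^sub>R w \<in> cbox (-c) c"
      using that(1) by (intro subsetD[OF c]) (auto intro!: exI[of _ "t *\<^sub>R w + x"] exI[of _ "- t"])
    then show False using that(2) by simp
  qed
  have tc: "continuous_on S (\<lambda>x. F (t *\<^sub>R w + x))" for t S
    by (intro continuous_on_compose2[OF Fc] continuous_intros) auto
  have const: "integral (cbox (-c) c) (\<lambda>x. F (t *\<^sub>R w + x)) = (\<integral>x. F x \<partial>lebesgue)" if "t \<in> {-1<..<1}" for t
    using continuous_bounded_support_integral(2)[of "\<lambda>x. F (t *\<^sub>R w + x)" "-c" c] tc out[OF that]
      lebesgue_integral_translation[OF Fc, of "t *\<^sub>R w"] by simp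
  have "((\<lambda>t. integral (cbox (-c) c) (\<lambda>x. F (t *\<^sub>R w + x))) has_vector_derivative
      integral (cbox (-c) c) (\<lambda>x. F' (0 *\<^sub>R w + x) w)) (at 0 within {-1<..<1})"
  proof (rule leibniz_rule_vector_derivative)
    fix t x assume t: "t \<in> {-1<..<1::real}"
    have "((\<lambda>t. F (t *\<^sub>R w + x)) has_derivative (\<lambda>h. F' (t *\<^sub>R w + x) (h *\<^sub>R w))) (at t within {-1<..<1})"
      by (rule has_derivative_compose[OF _ F]) (auto intro!: derivative_eq_intros)
    then show "((\<lambda>t. F (t *\<^sub>R w + x)) has_vector_derivative F' (t *\<^sub>R w + x) w) (at t within {-1<..<1})"
      using linear_scale[OF has_derivative_linear[OF F]] by (simp add: has_vector_derivative_def)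
  next
    fix t show "(\<lambda>x. F (t *\<^sub>R w + x)) integrable_on cbox (-c) c"
      by (intro integrable_continuous tc)
  next
    show "continuous_on ({-1<..<1::real} \<times> cbox (-c) c) (\<lambda>(t, x). F' (t *\<^sub>R w + x) w)"
      unfolding split_beta by (intro continuous_on_compose2[OF cont] continuous_intros) auto
  qed auto
  then have "((\<lambda>t. (\<integral>x. F x \<partial>lebesgue)) has_vector_derivative integral (cbox (-c) c) (\<lambda>x. F' (0 *\<^sub>R w + x) w)) (at 0 within {-1<..<1})"
    by (rule has_vector_derivative_transform[rotated 2]) (use const in auto)
  then have "integral (cbox (-c) c) (\<lambda>x. F' x w) = 0"
    by (simp add: at_within_open[of _ "{-1<..<1::real}"])
       (metis has_vector_derivative_const vector_derivative_unique_at)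
  moreover have "F' x w = 0" if "x \<notin> cbox (-c) c" for x
  proof -
    have "(F has_derivative (\<lambda>_. 0)) (at x)"
    proof (rule has_derivative_transform_within_open[where f="\<lambda>_. 0" and s="- cbox (-c) c"])
      show "0 = F y" if "y \<in> - cbox (-c) c" for y
        using out[of 0 y] that by simp
    qed (use that closed_cbox[of "-c" c] in \<open>auto simp: open_Compl simp del: cbox_interval\<close>)
    then show ?thesis using has_derivative_unique[OF F] by metis
  qed
  ultimately show ?thesis
    using continuous_bounded_support_integral(2)[OF cont] by metis
qed

section \<open>Test functions and weak derivatives of radial functions\<close>

lemma test_function_support:
  assumes "test_function \<phi>"
  obtains a where "\<And>x. x \<notin> cbox (-a) a \<Longrightarrow> \<phi> x = 0"
proof -
  have "bounded (closure {x. \<phi> x \<noteq> 0})"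
    using assms compact_imp_bounded by (auto simp: test_function_def)
  then obtain a where "closure {x. \<phi> x \<noteq> 0} \<subseteq> cbox (-a) a"
    using bounded_subset_cbox_symmetric by blast
  then show ?thesis using that closure_subset by (metis (mono_tags, lifting) mem_Collect_eq subset_iff)
qed

lemma test_function_has_derivative:
  "test_function \<phi> \<Longrightarrow> (\<phi> has_derivative frechet_derivative \<phi> (at x)) (at x)"
  unfolding test_function_def using C_k.simps(2)[of 0 \<phi>] frechet_derivative_works by blast

lemma test_function_continuous: "test_function \<phi> \<Longrightarrow> continuous_on UNIV \<phi>"
  unfolding test_function_def using C_k.simps(1) by blast

lemma test_function_partial:
  fixes \<phi> :: "'a::euclidean_space \<Rightarrow> complex"
  assumes \<phi>: "test_function \<phi>" and i: "i \<in> Basis"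
  shows "test_function (partial i \<phi>)"
  unfolding test_function_def
proof
  show "\<forall>k. C_k k (partial i \<phi>)"
    using \<phi> i C_k.simps(2)[of _ \<phi>] unfolding test_function_def by blast
  let ?S = "closure {x. \<phi> x \<noteq> 0}"
  have "partial i \<phi> x = 0" if "x \<notin> ?S" for x
  proof -
    have "(\<phi> has_derivative (\<lambda>_. 0)) (at x)"
    proof (rule has_derivative_transform_within_open[where f="\<lambda>_. 0" and s="- ?S"])
      show "0 = \<phi> y" if "y \<in> - ?S" for y
        using that closure_subset[of "{x. \<phi> x \<noteq> 0}"] by auto
    qed (use that in auto)
    then show ?thesis
      using has_derivative_unique[OF test_function_has_derivative[OF \<phi>]] by (metis partial_def)
  qed
  then have "{x. partial i \<phi> x \<noteq> 0} \<subseteq> ?S" by auto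
  then have "closure {x. partial i \<phi> x \<noteq> 0} \<subseteq> ?S" by (metis closed_closure closure_minimal)
  moreover have "compact ?S" using \<phi> by (simp add: test_function_def)
  ultimately show "compact (closure {x. partial i \<phi> x \<noteq> 0})"
    by (metis closed_closure compact_Int_closed inf.absorb_iff2)
qed

lemma integrable_mult_test_function:
  assumes "continuous_on UNIV f" "test_function \<phi>"
  shows "integrable lebesgue (\<lambda>x. f x * \<phi> x)"
proof -
  obtain a where a: "\<And>x. x \<notin> cbox (-a) a \<Longrightarrow> \<phi> x = 0"
    using test_function_support[OF assms(2)] by blast
  show ?thesis
    by (rule continuous_bounded_support_integral(1)[of _ "-a" a],
        intro continuous_intros assms test_function_continuous) (simp add: a)
qed

lemma pairing_by_parts:
  fixes f :: "'a::euclidean_space \<Rightarrow> complex"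
  assumes f: "\<And>x. (f has_derivative f' x) (at x)" and cont: "continuous_on UNIV (\<lambda>x. f' x i)"
    and \<phi>: "test_function \<phi>" and i: "i \<in> Basis"
  shows "pairing (\<lambda>x. f' x i) \<phi> = - pairing f (partial i \<phi>)"
proof -
  obtain a where a: "\<And>x. x \<notin> cbox (-a) a \<Longrightarrow> \<phi> x = 0"
    using test_function_support[OF \<phi>] by blast
  have fc: "continuous_on UNIV f"
    using f by (meson continuous_on_eq_continuous_at has_derivative_continuous open_UNIV)
  note c = test_function_continuous[OF \<phi>] test_function_continuous[OF test_function_partial[OF \<phi> i]]
  have "(\<integral>x. f x * partial i \<phi> x + f' x i * \<phi> x \<partial>lebesgue) = 0"
    unfolding partial_def
  proof (rule integral_derivative_bounded_support[where F="\<lambda>x. f x * \<phi> x" and a="-a" and b=a and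
          F'="\<lambda>x k. f x * frechet_derivative \<phi> (at x) k + f' x k * \<phi> x"])
    show "((\<lambda>x. f x * \<phi> x) has_derivative (\<lambda>k. f x * frechet_derivative \<phi> (at x) k + f' x k * \<phi> x)) (at x)" for x
      by (intro has_derivative_mult f test_function_has_derivative \<phi>)
    show "continuous_on UNIV (\<lambda>x. f x * frechet_derivative \<phi> (at x) i + f' x i * \<phi> x)"
      using c by (intro continuous_intros fc cont) (auto simp: partial_def[abs_def])
  qed (simp add: a)
  then show ?thesis
    unfolding pairing_def
    by (subst (asm) Bochner_Integration.integral_add)
       (auto intro!: integrable_mult_test_function fc cont \<phi> test_function_partial i simp: add_eq_0_iff)
qed

text \<open>The norm is not differentiable at 0, but \<open>V' = r H\<close> vanishes there, so the
  formula \<open>x H(|x|)\<close> for the gradient also holds at the origin.\<close>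

lemma radial_has_derivative:
  fixes V H :: "real \<Rightarrow> complex" and x :: "'a::euclidean_space"
  assumes V: "\<And>r. (V has_vector_derivative r *\<^sub>R H r) (at r)"
  shows "((\<lambda>x. V (norm x)) has_derivative (\<lambda>k. (x \<bullet> k) *\<^sub>R H (norm x))) (at x)"
proof (cases "x = 0")
  case False
  have "((\<lambda>x. V (norm x)) has_derivative (\<lambda>k. (sgn x \<bullet> k) *\<^sub>R (norm x *\<^sub>R H (norm x)))) (at x)"
    using has_derivative_compose[where g=V, OF has_derivative_norm[OF False] V[unfolded has_vector_derivative_def]]
    by (simp add: inner_commute)
  moreover have "(sgn x \<bullet> k) *\<^sub>R (norm x *\<^sub>R H (norm x)) = (x \<bullet> k) *\<^sub>R H (norm x)" for k
    using False by (simp add: sgn_div_norm)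
  ultimately show ?thesis by (simp only:)
next
  case True
  have "((\<lambda>h. norm (V h - V 0) / norm h) \<longlongrightarrow> 0) (at 0)"
    using V[of 0] by (simp add: has_vector_derivative_def has_derivative_at)
  moreover have "filterlim norm (at 0) (at (0::'a))"
    by (auto simp: filterlim_at eventually_at_filter intro: tendsto_norm_zero)
  ultimately have "((\<lambda>k::'a. norm (V (norm k) - V 0) / norm (norm k)) \<longlongrightarrow> 0) (at 0)"
    by (rule filterlim_compose)
  then show ?thesis
    using True by (simp add: has_derivative_at)
qed

text \<open>\<open>G\<close> stands for \<open>r H'\<close>. At the origin the second summand is
  zero, and the function is the linear map \<open>x \<bullet> i\<close> times a factor converging to
  \<open>H 0\<close>.\<close>

lemma radial_gradient_has_derivative:
  fixes H G :: "real \<Rightarrow> complex" and x i :: "'a::euclidean_space"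
  assumes H: "\<And>r. r > 0 \<Longrightarrow> (H has_vector_derivative G r /\<^sub>R r) (at r)" and Hc: "continuous_on UNIV H"
  shows "((\<lambda>x. (x \<bullet> i) *\<^sub>R H (norm x)) has_derivative
     (\<lambda>k. (k \<bullet> i) *\<^sub>R H (norm x) + ((x \<bullet> i) * (x \<bullet> k) / (norm x)^2) *\<^sub>R G (norm x))) (at x)"
proof (cases "x = 0")
  case False
  have "((\<lambda>x. H (norm x)) has_derivative (\<lambda>k. (sgn x \<bullet> k) *\<^sub>R (G (norm x) /\<^sub>R norm x))) (at x)"
    using has_derivative_compose[where g=H, OF has_derivative_norm[OF False] H[unfolded has_vector_derivative_def]] False
    by (simp add: inner_commute)
  then have "((\<lambda>x. (x \<bullet> i) *\<^sub>R H (norm x)) has_derivative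
     (\<lambda>k. (x \<bullet> i) *\<^sub>R ((sgn x \<bullet> k) *\<^sub>R (G (norm x) /\<^sub>R norm x)) + (k \<bullet> i) *\<^sub>R H (norm x))) (at x)"
    by (intro has_derivative_scaleR) (auto intro!: derivative_eq_intros)
  then show ?thesis
    by (rule has_derivative_eq_rhs) (simp add: fun_eq_iff sgn_div_norm power2_eq_square divide_inverse mult_ac)
next
  case True
  have "((\<lambda>k. H (norm k) - H 0) \<longlongrightarrow> H (norm (0::'a)) - H 0) (at (0::'a))"
    by (intro tendsto_intros continuous_on_tendsto_compose[OF Hc]) auto
  then have lim: "((\<lambda>k. norm (H (norm k) - H 0)) \<longlongrightarrow> 0) (at (0::'a))"
    using tendsto_norm_zero by fastforce
  have "((\<lambda>k::'a. norm ((k \<bullet> i) *\<^sub>R H (norm k) - (k \<bullet> i) *\<^sub>R H 0) / norm k) \<longlongrightarrow> 0) (at 0)"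
  proof (rule Lim_null_comparison)
    show "eventually (\<lambda>k. norm (norm ((k \<bullet> i) *\<^sub>R H (norm k) - (k \<bullet> i) *\<^sub>R H 0) / norm k) \<le> norm i * norm (H (norm k) - H 0)) (at (0::'a))"
      unfolding eventually_at_filter
    proof (rule always_eventually, intro allI impI)
      fix k :: 'a assume "k \<noteq> 0"
      have "norm ((k \<bullet> i) *\<^sub>R H (norm k) - (k \<bullet> i) *\<^sub>R H 0) = \<bar>k \<bullet> i\<bar> * norm (H (norm k) - H 0)"
        by (metis norm_scaleR scaleR_right_diff_distrib)
      also have "\<dots> \<le> (norm k * norm i) * norm (H (norm k) - H 0)"
        by (intro mult_right_mono Cauchy_Schwarz_ineq2) auto
      finally show "norm (norm ((k \<bullet> i) *\<^sub>R H (norm k) - (k \<bullet> i) *\<^sub>R H 0) / norm k) \<le> norm i * norm (H (norm k) - H 0)"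
        using \<open>k \<noteq> 0\<close> by (simp add: field_simps)
    qed
    show "((\<lambda>k. norm i * norm (H (norm k) - H 0)) \<longlongrightarrow> 0) (at (0::'a))"
      using tendsto_mult_left[OF lim, of "norm i"] by simp
  qed
  moreover have "bounded_linear (\<lambda>k. (k \<bullet> i) *\<^sub>R H 0)"
    by (intro bounded_linear_scaleR_const bounded_linear_inner_left)
  ultimately show ?thesis
    using True by (simp add: has_derivative_at)
qed

lemma pairing_radial_gradient:
  fixes V H :: "real \<Rightarrow> complex"
  assumes V: "\<And>r. (V has_vector_derivative r *\<^sub>R H r) (at r)" and Hc: "continuous_on UNIV H"
    and \<phi>: "test_function (\<phi> :: 'a::euclidean_space \<Rightarrow> complex)" and i: "i \<in> Basis"
  shows "pairing (\<lambda>x. (x \<bullet> i) *\<^sub>R H (norm x)) \<phi> = - pairing (\<lambda>x. V (norm x)) (partial i \<phi>)"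
  by (rule pairing_by_parts[where f'="\<lambda>x k. (x \<bullet> k) *\<^sub>R H (norm x)", OF radial_has_derivative[OF V] _ \<phi> i])
     (intro continuous_intros continuous_on_compose2[OF Hc], auto)

text \<open>Two integrations by parts move the derivatives onto the radial function. In the sum over
  directions the coefficients \<open>(x \<bullet> i)^2 / |x|^2\<close> add up to 1 away from the
  origin, which leaves the radial Laplacian \<open>r H' + d H\<close>.\<close>

lemma pairing_radial_laplacian:
  fixes V H G :: "real \<Rightarrow> complex"
  assumes V: "\<And>r. (V has_vector_derivative r *\<^sub>R H r) (at r)" and Hc: "continuous_on UNIV H"
    and H: "\<And>r. r > 0 \<Longrightarrow> (H has_vector_derivative G r /\<^sub>R r) (at r)"
    and G: "continuous_on UNIV G" "G 0 = 0"
    and \<phi>: "test_function (\<phi> :: 'a::euclidean_space \<Rightarrow> complex)"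
  shows "pairing (\<lambda>x. V (norm x)) (laplacian \<phi>)
    = pairing (\<lambda>x. G (norm x) + of_nat DIM('a) * H (norm x)) \<phi>"
proof -
  let ?D = "\<lambda>i (x::'a). (i \<bullet> i) *\<^sub>R H (norm x) + ((x \<bullet> i) * (x \<bullet> i) / (norm x)^2) *\<^sub>R G (norm x)"
  have Hc': "continuous_on S (\<lambda>x. H (norm x))" and Gc': "continuous_on S (\<lambda>x. G (norm x))" for S :: "'a set"
    by (auto intro!: continuous_on_compose2[OF Hc] continuous_on_compose2[OF G(1)] continuous_intros)
  have Vc: "continuous_on UNIV (\<lambda>x::'a. V (norm x))"
    by (intro continuous_at_imp_continuous_on ballI has_derivative_continuous[OF radial_has_derivative[OF V]])
  \<comment> \<open>The quotient \<open>(x \<bullet> i)^2 / |x|^2\<close> need not have a limit at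
    the origin, but it is bounded by \<open>|i|^2\<close> and multiplies \<open>G\<close>, which
    tends to 0.\<close>
  have Dc: "continuous_on UNIV (?D i)" for i :: 'a
  proof -
    have "isCont (\<lambda>x. ((x \<bullet> i) * (x \<bullet> i) / (norm x)^2) *\<^sub>R G (norm x)) x" for x :: 'a
    proof (cases "x = 0")
      case False
      have "((\<lambda>x. G (norm x)) \<longlongrightarrow> G (norm x)) (at x)"
        using Gc'[of UNIV] by (simp add: continuous_on_eq_continuous_at isCont_def)
      moreover have "((\<lambda>x. x \<bullet> i) \<longlongrightarrow> x \<bullet> i) (at x)"
        by (rule tendsto_inner[OF tendsto_ident_at tendsto_const])
      ultimately show ?thesis
        unfolding isCont_def using False
        by (intro tendsto_scaleR tendsto_divide tendsto_mult tendsto_power tendsto_norm tendsto_ident_at) auto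
    next
      case True
      have lim: "((\<lambda>k. norm (G (norm k))) \<longlongrightarrow> 0) (at (0::'a))"
        using Gc'[of UNIV] G(2) by (auto simp: continuous_on_eq_continuous_at isCont_def dest!: spec[of _ 0] intro: tendsto_norm_zero)
      have "((\<lambda>x. ((x \<bullet> i) * (x \<bullet> i) / (norm x)^2) *\<^sub>R G (norm x)) \<longlongrightarrow> 0) (at (0::'a))"
      proof (rule Lim_null_comparison)
        show "eventually (\<lambda>x. norm (((x \<bullet> i) * (x \<bullet> i) / (norm x)^2) *\<^sub>R G (norm x)) \<le> (norm i)^2 * norm (G (norm x))) (at (0::'a))"
          unfolding eventually_at_filter
        proof (rule always_eventually, intro allI impI)
          fix x :: 'a assume "x \<noteq> 0"
          have "\<bar>x \<bullet> i\<bar> * \<bar>x \<bullet> i\<bar> \<le> (norm x * norm i) * (norm x * norm i)"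
            by (intro mult_mono Cauchy_Schwarz_ineq2) auto
          then have "\<bar>(x \<bullet> i) * (x \<bullet> i) / (norm x)^2\<bar> \<le> (norm i)^2"
            using \<open>x \<noteq> 0\<close> by (simp add: field_simps power2_eq_square abs_mult)
          then show "norm (((x \<bullet> i) * (x \<bullet> i) / (norm x)^2) *\<^sub>R G (norm x)) \<le> (norm i)^2 * norm (G (norm x))"
            unfolding norm_scaleR real_norm_def by (intro mult_right_mono) auto
        qed
        show "((\<lambda>x. (norm i)^2 * norm (G (norm x))) \<longlongrightarrow> 0) (at (0::'a))"
          using tendsto_mult_left[OF lim, of "(norm i)^2"] by simp
      qed
      then show ?thesis using True by (simp add: isCont_def)
    qed
    then have "continuous_on UNIV (\<lambda>x. ((x \<bullet> i) * (x \<bullet> i) / (norm x)^2) *\<^sub>R G (norm x))"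
      by (simp add: continuous_on_eq_continuous_at)
    from continuous_on_add[OF continuous_on_scaleR[OF continuous_on_const Hc'] this]
    show ?thesis .
  qed
  have "pairing (\<lambda>x. V (norm x)) (partial i (partial i \<phi>)) = pairing (?D i) \<phi>" if i: "i \<in> Basis" for i
  proof -
    have "pairing (\<lambda>x. V (norm x)) (partial i (partial i \<phi>)) = - pairing (\<lambda>x. (x \<bullet> i) *\<^sub>R H (norm x)) (partial i \<phi>)"
      using pairing_radial_gradient[OF V Hc test_function_partial[OF \<phi> i] i] by simp
    also have "\<dots> = pairing (?D i) \<phi>"
      by (rule pairing_by_parts[symmetric, OF radial_gradient_has_derivative[OF H Hc] Dc \<phi> i])
    finally show ?thesis .
  qed
  moreover have "pairing (\<lambda>x. V (norm x)) (laplacian \<phi>) = (\<Sum>i\<in>Basis. pairing (\<lambda>x. V (norm x)) (partial i (partial i \<phi>)))"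
    unfolding pairing_def laplacian_def sum_distrib_left
    by (intro Bochner_Integration.integral_sum integrable_mult_test_function Vc test_function_partial \<phi>)
  moreover have "(\<Sum>i\<in>Basis. pairing (?D i) \<phi>) = pairing (\<lambda>x. \<Sum>i\<in>Basis. ?D i x) \<phi>"
    unfolding pairing_def sum_distrib_right
    by (intro Bochner_Integration.integral_sum[symmetric] integrable_mult_test_function Dc \<phi>)
  moreover have "(\<Sum>i\<in>Basis. ?D i x) = G (norm x) + of_nat DIM('a) * H (norm x)" for x
  proof (cases "x = 0")
    case False
    have "(\<Sum>i\<in>Basis. (x \<bullet> i) * (x \<bullet> i) / (norm x)^2) = 1"
      using False unfolding sum_divide_distrib[symmetric] power2_norm_eq_inner euclidean_inner[of x x, symmetric]
      by simp
    then have "(\<Sum>i\<in>Basis. ((x \<bullet> i) * (x \<bullet> i) / (norm x)^2) *\<^sub>R G (norm x)) = G (norm x)"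
      by (metis scaleR_left.sum scaleR_one)
    then show ?thesis by (simp add: sum.distrib inner_Basis)
  qed (simp add: G(2) sum.distrib inner_Basis)
  ultimately show ?thesis by simp
qed

text \<open>The test function confines the integral to a box, where one may differentiate under the
  integral sign. Derivatives within a convex \<open>I\<close> include the closed end of a half-open
  time interval.\<close>

lemma pairing_has_vector_derivative:
  fixes u ut :: "real \<Rightarrow> 'a::euclidean_space \<Rightarrow> complex"
  assumes u: "\<And>t x. t \<in> I \<Longrightarrow> ((\<lambda>s. u s x) has_vector_derivative ut t x) (at t within I)"
    and uc: "\<And>t. t \<in> I \<Longrightarrow> continuous_on UNIV (u t)"
    and ut: "continuous_on (I \<times> UNIV) (\<lambda>(t,x). ut t x)"
    and I: "convex I" "t \<in> I" and \<phi>: "test_function \<phi>"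
  shows "((\<lambda>s. pairing (u s) \<phi>) has_vector_derivative pairing (ut t) \<phi>) (at t within I)"
proof -
  obtain a where a: "\<And>x. x \<notin> cbox (-a) a \<Longrightarrow> \<phi> x = 0"
    using test_function_support[OF \<phi>] by blast
  note \<phi>c = continuous_on_subset[OF test_function_continuous[OF \<phi>] subset_UNIV]
  have utc: "continuous_on UNIV (ut t)" if "t \<in> I" for t
  proof -
    have "continuous_on UNIV (\<lambda>x. case (t, x) of (t, x) \<Rightarrow> ut t x)"
      by (rule continuous_on_compose2[OF ut]) (use that in \<open>auto intro!: continuous_on_Pair\<close>)
    then show ?thesis by simp
  qed
  have p: "pairing f \<phi> = integral (cbox (-a) a) (\<lambda>x. f x * \<phi> x)" if "continuous_on UNIV f" for f
    unfolding pairing_def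
    by (rule continuous_bounded_support_integral(2), intro continuous_intros that \<phi>c) (simp add: a)
  have "((\<lambda>s. integral (cbox (-a) a) (\<lambda>x. u s x * \<phi> x)) has_vector_derivative
     integral (cbox (-a) a) (\<lambda>x. ut t x * \<phi> x)) (at t within I)"
  proof (rule leibniz_rule_vector_derivative)
    show "((\<lambda>s. u s x * \<phi> x) has_vector_derivative ut s x * \<phi> x) (at s within I)" if "s \<in> I" for s x
      using u[OF that] by (rule has_vector_derivative_mult_left)
    show "(\<lambda>x. u s x * \<phi> x) integrable_on cbox (-a) a" if "s \<in> I" for s
      by (intro integrable_continuous continuous_intros \<phi>c continuous_on_subset[OF uc[OF that] subset_UNIV])
    show "continuous_on (I \<times> cbox (-a) a) (\<lambda>(s, x). ut s x * \<phi> x)"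
      unfolding split_beta
      by (intro continuous_intros continuous_on_compose2[OF \<phi>c[of UNIV]] continuous_on_subset[OF ut[unfolded split_beta]]) auto
  qed (use I in auto)
  then show ?thesis
    unfolding p[OF utc[OF I(2)]]
    by (rule has_vector_derivative_transform[rotated 2]) (use I p uc in auto)
qed

section \<open>Uniqueness of weak derivatives\<close>

lemma partial_eq: "(f has_derivative f') (at x) \<Longrightarrow> partial i f x = f' i"
  unfolding partial_def using frechet_derivative_at by metis

lemma C_k_Suc_imp: "C_k (Suc k) f \<Longrightarrow> C_k k f"
  by (induction k arbitrary: f)
     (auto simp: continuous_on_eq_continuous_at intro: differentiable_imp_continuous_within)

lemma C_k_const: "C_k k (\<lambda>_. c)"
proof (induction k arbitrary: c)
  case (Suc k)
  have "partial i (\<lambda>_. c) = (\<lambda>_. 0)" for i :: 'a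
    using partial_eq[OF has_derivative_const] by blast
  then show ?case using Suc by simp
qed simp

lemma C_k_add:
  "C_k k f \<Longrightarrow> C_k k g \<Longrightarrow> C_k k (\<lambda>x. f x + g x)"
proof (induction k arbitrary: f g)
  case (Suc k)
  have d: "(f has_derivative frechet_derivative f (at x)) (at x)" "(g has_derivative frechet_derivative g (at x)) (at x)" for x
    using Suc.prems by (simp_all add: frechet_derivative_works[symmetric])
  have "partial i (\<lambda>x. f x + g x) = (\<lambda>x. partial i f x + partial i g x)" for i
    using partial_eq[OF has_derivative_add[OF d]] by (auto simp: partial_def)
  then show ?case using Suc by (auto intro: differentiable_add)
qed (auto intro: continuous_on_add)

lemma C_k_mult:
  "C_k k f \<Longrightarrow> C_k k g \<Longrightarrow> C_k k (\<lambda>x. f x * g x)"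
proof (induction k arbitrary: f g)
  case (Suc k)
  have d: "(f has_derivative frechet_derivative f (at x)) (at x)" "(g has_derivative frechet_derivative g (at x)) (at x)" for x
    using Suc.prems by (simp_all add: frechet_derivative_works[symmetric])
  have "partial i (\<lambda>x. f x * g x) = (\<lambda>x. f x * partial i g x + partial i f x * g x)" for i
    using partial_eq[OF has_derivative_mult[OF d]] by (auto simp: partial_def)
  then show ?case
    using Suc.prems C_k_Suc_imp[OF Suc.prems(1)] C_k_Suc_imp[OF Suc.prems(2)]
    by (auto intro!: differentiable_mult C_k_add Suc.IH)
qed (auto intro: continuous_on_mult)

lemma C_k_prod: "finite J \<Longrightarrow> (\<And>j. j \<in> J \<Longrightarrow> C_k k (f j)) \<Longrightarrow> C_k k (\<lambda>x. \<Prod>j\<in>J. f j x)"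
  by (induction J rule: finite_induct) (auto intro!: C_k_const C_k_mult)

text \<open>The index \<open>m\<close> makes the family closed under differentiation up to linear
  combinations: the derivative of \<open>bump m\<close> involves only \<open>bump (m+1)\<close> and
  \<open>bump (m+2)\<close>. Smoothness is then one induction over the order, with \<open>m\<close>
  arbitrary.\<close>

definition bump :: "nat \<Rightarrow> real \<Rightarrow> real" where
  "bump m s = (if s \<le> 0 then 0 else inverse s ^ m * exp (- inverse s))"

lemma bump_tendsto_0: "(bump m \<longlongrightarrow> 0) (at 0)"
proof (rule filterlim_split_at)
  show "(bump m \<longlongrightarrow> 0) (at_left 0)"
    by (rule tendsto_eventually) (auto simp: bump_def eventually_at_filter)
  have "((\<lambda>s. inverse s ^ m / exp (inverse s)) \<longlongrightarrow> (0::real)) (at_right 0)"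
    by (rule filterlim_compose[OF tendsto_power_div_exp_0 filterlim_inverse_at_top_right])
  moreover have "eventually (\<lambda>s. inverse s ^ m / exp (inverse s) = bump m s) (at_right 0)"
    by (auto simp: bump_def eventually_at_filter exp_minus field_simps)
  ultimately show "(bump m \<longlongrightarrow> 0) (at_right 0)"
    by (rule Lim_transform_eventually)
qed

text \<open>At 0 the difference quotient of \<open>bump m\<close> is \<open>bump (m+1)\<close>
  itself, so \<open>bump_tendsto_0\<close> settles the only critical point.\<close>

lemma bump_has_derivative:
  "(bump m has_real_derivative - real m * bump (m+1) s + bump (m+2) s) (at s)"
proof (cases s "0::real" rule: linorder_cases)
  case less
  have "((\<lambda>_. 0) has_real_derivative 0) (at s)" by simp
  then have "(bump m has_real_derivative 0) (at s)"
    by (rule has_field_derivative_transform_within_open[where S="{..<0}"]) (use less in \<open>auto simp: bump_def\<close>)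
  then show ?thesis using less by (simp add: bump_def)
next
  case equal
  have "eventually (\<lambda>h. bump (m+1) h = (bump m (0 + h) - bump m 0) / h) (at 0)"
    by (auto simp: bump_def eventually_at_filter field_simps)
  then have "((\<lambda>h. (bump m (0 + h) - bump m 0) / h) \<longlongrightarrow> 0) (at 0)"
    by (rule Lim_transform_eventually[OF bump_tendsto_0])
  then show ?thesis using equal by (simp add: DERIV_def bump_def)
next
  case greater
  have "((\<lambda>s. inverse s ^ m * exp (- inverse s)) has_real_derivative
      - real m * bump (m+1) s + bump (m+2) s) (at s)"
  proof -
    have "inverse s * (real m * inverse s ^ (m - 1)) = real m * inverse s ^ m"
      by (cases m) auto
    then show ?thesis
      using greater by (auto intro!: derivative_eq_intros simp: bump_def power2_eq_square algebra_simps)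
  qed
  then show ?thesis
    by (rule has_field_derivative_transform_within_open[where S="{0<..}"]) (use greater in \<open>auto simp: bump_def\<close>)
qed

lemma bump_0_bounds: "0 \<le> bump 0 s" "bump 0 s \<le> 1"
  by (auto simp: bump_def)

lemma bump_scaled_tendsto:
  "(\<lambda>n. bump 0 (real n * s)) \<longlonglongrightarrow> (if s > 0 then 1 else 0)"
proof (cases "s > 0")
  case True
  have "(\<lambda>n. exp (- inverse (real n * s))) \<longlonglongrightarrow> exp (- 0)"
    using True
    by (intro tendsto_exp tendsto_minus tendsto_inverse_0_at_top
        filterlim_at_top_mult_tendsto_pos[OF tendsto_const] filterlim_real_sequentially)
  moreover have "eventually (\<lambda>n. exp (- inverse (real n * s)) = bump 0 (real n * s)) sequentially"
    using True by (auto simp: bump_def eventually_at_top_linorder mult_le_0_iff intro!: exI[of _ 1])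
  ultimately show ?thesis
    using True by (auto intro: Lim_transform_eventually)
next
  case False
  then have "bump 0 (real n * s) = 0" for n
    by (simp add: bump_def mult_le_0_iff)
  then show ?thesis using False by simp
qed

lemma C_k_bump:
  "C_k k (\<lambda>x::'a::euclidean_space. complex_of_real (bump m (x \<bullet> w + \<beta>)))"
proof (induction k arbitrary: m)
  have d: "((\<lambda>x. complex_of_real (bump m (x \<bullet> w + \<beta>))) has_derivative
     (\<lambda>h. of_real ((h \<bullet> w) * (- real m * bump (m+1) (x \<bullet> w + \<beta>) + bump (m+2) (x \<bullet> w + \<beta>))))) (at x)" for m x
  proof -
    have "((\<lambda>x. bump m (x \<bullet> w + \<beta>)) has_derivative
     (\<lambda>h. (h \<bullet> w) * (- real m * bump (m+1) (x \<bullet> w + \<beta>) + bump (m+2) (x \<bullet> w + \<beta>)))) (at x)"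
    proof -
      have "((\<lambda>x. x \<bullet> w + \<beta>) has_derivative (\<lambda>h. h \<bullet> w)) (at x)"
        by (auto intro!: derivative_eq_intros)
      from has_derivative_compose[OF this bump_has_derivative[unfolded has_field_derivative_def]]
      show ?thesis by (simp add: mult.commute)
    qed
    then show ?thesis by (rule has_derivative_of_real)
  qed
  case 0
  show ?case
    unfolding C_k.simps by (intro continuous_at_imp_continuous_on ballI has_derivative_continuous[OF d])
  case (Suc k)
  have "partial i (\<lambda>x. complex_of_real (bump m (x \<bullet> w + \<beta>))) =
     (\<lambda>x. of_real (- (i \<bullet> w) * m) * of_real (bump (m+1) (x \<bullet> w + \<beta>)) + of_real (i \<bullet> w) * of_real (bump (m+2) (x \<bullet> w + \<beta>)))" for i
    using partial_eq[OF d] by (auto simp: fun_eq_iff algebra_simps)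
  then show ?case
    using d by (auto simp: differentiable_def simp del: of_real_mult of_real_minus intro!: C_k_add C_k_mult C_k_const Suc.IH)
qed

text \<open>A product of cutoffs, two for each pair of opposite faces. The factor \<open>n\<close>
  sharpens them, so the functions converge to the indicator of the open box while being supported in
  it.\<close>

definition box_bump :: "'a::euclidean_space \<Rightarrow> 'a \<Rightarrow> nat \<Rightarrow> 'a \<Rightarrow> real" where
  "box_bump a b n x = (\<Prod>j\<in>Basis. bump 0 (real n * ((x - a) \<bullet> j)) * bump 0 (real n * ((b - x) \<bullet> j)))"

lemma box_bump_bounds: "0 \<le> box_bump a b n x" "box_bump a b n x \<le> 1"
  unfolding box_bump_def by (auto intro!: prod_nonneg prod_le_1 mult_nonneg_nonneg mult_le_one bump_0_bounds)

lemma box_bump_outside: "x \<notin> box a b \<Longrightarrow> box_bump a b n x = 0"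
  by (auto simp: box_bump_def mem_box bump_def inner_diff_left not_less mult_le_0_iff)

lemma box_bump_tendsto: "(\<lambda>n. box_bump a b n x) \<longlonglongrightarrow> indicator (box a b) x"
proof -
  have "(\<Prod>j\<in>Basis. (if (x - a) \<bullet> j > 0 then 1 else 0) * (if (b - x) \<bullet> j > 0 then 1 else 0)) = (indicator (box a b) x :: real)"
    by (auto simp: indicator_def mem_box inner_diff_left intro!: prod.neutral)
  moreover have "(\<lambda>n. box_bump a b n x) \<longlonglongrightarrow>
      (\<Prod>j\<in>Basis. (if (x - a) \<bullet> j > 0 then 1 else 0) * (if (b - x) \<bullet> j > 0 then 1 else 0))"
    unfolding box_bump_def by (intro tendsto_prod tendsto_mult bump_scaled_tendsto)
  ultimately show ?thesis by simp
qed

lemma test_function_box_bump: "test_function (\<lambda>x. complex_of_real (box_bump a b n x))"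
  unfolding test_function_def
proof
  have "(\<lambda>x. complex_of_real (box_bump a b n x)) =
     (\<lambda>x. \<Prod>j\<in>Basis. complex_of_real (bump 0 (x \<bullet> (real n *\<^sub>R j) + (- real n * (a \<bullet> j)))) *
        complex_of_real (bump 0 (x \<bullet> (- real n *\<^sub>R j) + real n * (b \<bullet> j))))"
    by (simp add: box_bump_def fun_eq_iff inner_diff_left algebra_simps)
  then show "\<forall>k. C_k k (\<lambda>x. complex_of_real (box_bump a b n x))"
    by (simp only:) (intro allI C_k_prod C_k_mult C_k_bump finite_Basis)
  have "{x. complex_of_real (box_bump a b n x) \<noteq> 0} \<subseteq> cbox a b"
    using box_bump_outside box_subset_cbox by fastforce
  then have "closure {x. complex_of_real (box_bump a b n x) \<noteq> 0} \<subseteq> cbox a b"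
    by (rule closure_minimal) (rule closed_cbox)
  then show "compact (closure {x. complex_of_real (box_bump a b n x) \<noteq> 0})"
    by (meson bounded_cbox bounded_subset closed_closure compact_eq_bounded_closed)
qed

section \<open>Functions with vanishing pairings\<close>

lemma sigma_finite_lebesgue: "sigma_finite_measure (lebesgue :: 'a::euclidean_space measure)"
proof
  show "\<exists>A::'a set set. countable A \<and> A \<subseteq> sets lebesgue \<and> \<Union> A = space lebesgue \<and> (\<forall>a\<in>A. emeasure lebesgue a \<noteq> \<infinity>)"
    by (intro exI[of _ "range (\<lambda>n::nat. box (- (real n *\<^sub>R One)) (real n *\<^sub>R One))"])
       (auto simp: UN_box_eq_UNIV emeasure_lborel_box_eq)
qed

text \<open>Boxes form an intersection-stable generator of the Borel sets. The step to complements
  needs a vanishing total integral, which is available because \<open>f\<close> lives in one box.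
  Lebesgue sets differ from Borel sets by null sets only.\<close>

lemma AE_zero_of_box_integrals:
  fixes f :: "'a::euclidean_space \<Rightarrow> complex"
  assumes f: "integrable lebesgue f" and U: "\<And>x. x \<notin> box c d \<Longrightarrow> f x = 0"
    and box: "\<And>a b. (LINT x:box a b|lebesgue. f x) = 0"
  shows "AE x in lebesgue. f x = 0"
proof (rule sigma_finite_measure.density_zero[OF sigma_finite_lebesgue f])
  have fA: "set_integrable lebesgue A f" if "A \<in> sets lebesgue" for A
    unfolding set_integrable_def using f that by (rule integrable_mult_indicator[rotated])
  let ?E = "range (\<lambda>(a, b). box a b::'a set)"
  have all: "(LINT x:UNIV|lebesgue. f x) = 0"
  proof -
    have "(LINT x:UNIV|lebesgue. f x) = (LINT x:box c d|lebesgue. f x)"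
      unfolding set_lebesgue_integral_def using U
      by (intro Bochner_Integration.integral_cong) (auto simp: indicator_def)
    then show ?thesis using box by simp
  qed
  have borel: "(LINT x:A|lebesgue. f x) = 0" if "A \<in> sets borel" for A
  proof -
    have A: "A \<in> sigma_sets UNIV ?E" using that by (simp add: borel_eq_box)
    have stable: "Int_stable ?E" by (auto simp: Int_stable_def box_Int_box)
    have sub: "?E \<subseteq> Pow UNIV" by simp
    from A show ?thesis
    proof (induct A rule: sigma_sets_induct_disjoint[OF stable sub, consumes 1, case_names basic empty compl union])
      case (basic A)
      then show ?case using box by auto
    next
      case empty
      then show ?case by (simp add: set_lebesgue_integral_def)
    next
      case (compl A)
      then have A: "A \<in> sets lebesgue" by (metis borel_eq_box sets_completionI_sets sets_lborel sets_measure_of subset_UNIV Pow_UNIV)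
      then have "(LINT x:A \<union> (UNIV - A)|lebesgue. f x) = (LINT x:A|lebesgue. f x) + (LINT x:UNIV - A|lebesgue. f x)"
        by (intro set_integral_Un fA) auto
      then show ?case using all compl by simp
    next
      case (union A)
      then have A: "A i \<in> sets lebesgue" for i
        by (metis borel_eq_box sets_completionI_sets sets_lborel sets_measure_of subset_UNIV Pow_UNIV range_subsetD)
      have "(LINT x:(\<Union>i. A i)|lebesgue. f x) = (\<Sum>i. (LINT x:(A i)|lebesgue. f x))"
        using A union by (intro lebesgue_integral_countable_add fA) (auto simp: disjoint_family_on_def)
      then show ?case using union by simp
    qed
  qed
  fix A assume "A \<in> sets (lebesgue :: 'a measure)"
  then obtain S N N' where A: "A = S \<union> N" "N \<subseteq> N'" "N' \<in> null_sets lborel" "S \<in> sets lborel"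
    by (rule sets_completionE)
  have "AE x in lebesgue. x \<notin> N'"
    using A(3) by (intro AE_not_in null_sets_completionI)
  then have "(LINT x:A|lebesgue. f x) = (LINT x:S|lebesgue. f x)"
    unfolding set_lebesgue_integral_def using f \<open>A \<in> sets lebesgue\<close> A
    by (intro integral_cong_AE borel_measurable_scaleR borel_measurable_indicator) (auto elim!: eventually_mono simp: indicator_def)
  then show "(LINT x:A|lebesgue. f x) = 0" using borel A(4) by simp
qed

lemma L2_box_integrable:
  fixes f :: "'a::euclidean_space \<Rightarrow> complex"
  assumes "f \<in> L2"
  shows "set_integrable lebesgue (box a b) f"
proof -
  have f: "f \<in> borel_measurable lebesgue" "integrable lebesgue (\<lambda>x. (cmod (f x))\<^sup>2)"
    using assms by (auto simp: L2_def)
  have "integrable lebesgue (\<lambda>x. indicat_real (box a b) x + (cmod (f x))\<^sup>2)"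
    by (intro Bochner_Integration.integrable_add f(2) integrable_real_indicator)
       (auto simp: emeasure_lborel_box_eq)
  then show ?thesis
    unfolding set_integrable_def
  proof (rule Bochner_Integration.integrable_bound)
    show "(\<lambda>x. indicat_real (box a b) x *\<^sub>R f x) \<in> borel_measurable lebesgue"
      by (intro borel_measurable_scaleR borel_measurable_indicator f(1)) auto
    have "cmod z \<le> 1 + (cmod z)\<^sup>2" for z
      using sum_squares_bound[of "cmod z" 1] norm_ge_zero[of z]
      unfolding power_one mult_1_right by linarith
    then show "AE x in lebesgue. norm (indicat_real (box a b) x *\<^sub>R f x) \<le> norm (indicat_real (box a b) x + (cmod (f x))\<^sup>2)"
      by (auto simp: indicator_def)
  qed
qed

lemma L2_mult_integrable:
  fixes f g :: "'a::euclidean_space \<Rightarrow> complex"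
  assumes "f \<in> L2" "g \<in> L2"
  shows "integrable lebesgue (\<lambda>x. f x * g x)"
proof (rule Bochner_Integration.integrable_bound)
  show "integrable lebesgue (\<lambda>x. (cmod (f x))\<^sup>2 + (cmod (g x))\<^sup>2)"
    using assms by (auto simp: L2_def)
  show "(\<lambda>x. f x * g x) \<in> borel_measurable lebesgue"
    using assms by (auto simp: L2_def)
  have "cmod (f x * g x) \<le> (cmod (f x))\<^sup>2 + (cmod (g x))\<^sup>2" for x
  proof -
    have "0 \<le> cmod (f x) * cmod (g x)" by simp
    then show ?thesis
      using sum_squares_bound[of "cmod (f x)" "cmod (g x)"] unfolding norm_mult by linarith
  qed
  then show "AE x in lebesgue. norm (f x * g x) \<le> norm ((cmod (f x))\<^sup>2 + (cmod (g x))\<^sup>2)"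
    by simp
qed

lemma L2_diff:
  fixes f g :: "'a::euclidean_space \<Rightarrow> complex"
  assumes "f \<in> L2" "g \<in> L2"
  shows "(\<lambda>x. f x - g x) \<in> L2"
proof -
  have m: "(\<lambda>x. f x - g x) \<in> borel_measurable lebesgue"
    using assms by (auto simp: L2_def)
  have "integrable lebesgue (\<lambda>x. (cmod (f x - g x))\<^sup>2)"
  proof (rule Bochner_Integration.integrable_bound)
    show "integrable lebesgue (\<lambda>x. 2 * (cmod (f x))\<^sup>2 + 2 * (cmod (g x))\<^sup>2)"
      using assms by (auto simp: L2_def)
    show "(\<lambda>x. (cmod (f x - g x))\<^sup>2) \<in> borel_measurable lebesgue"
      using m by measurable
    have "(cmod (f x - g x))\<^sup>2 \<le> 2 * (cmod (f x))\<^sup>2 + 2 * (cmod (g x))\<^sup>2" for x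
    proof -
      have "(cmod (f x - g x))\<^sup>2 \<le> (cmod (f x) + cmod (g x))\<^sup>2"
        by (intro power_mono norm_triangle_ineq4) auto
      also have "\<dots> \<le> 2 * (cmod (f x))\<^sup>2 + 2 * (cmod (g x))\<^sup>2"
        using sum_squares_bound[of "cmod (f x)" "cmod (g x)"] by (simp add: power2_sum)
      finally show ?thesis .
    qed
    then show "AE x in lebesgue. norm ((cmod (f x - g x))\<^sup>2) \<le> norm (2 * (cmod (f x))\<^sup>2 + 2 * (cmod (g x))\<^sup>2)"
      by simp
  qed
  with m show ?thesis by (simp add: L2_def)
qed

lemma test_function_L2: "test_function \<phi> \<Longrightarrow> \<phi> \<in> L2"
proof -
  assume \<phi>: "test_function \<phi>"
  obtain a where a: "\<And>x. x \<notin> cbox (-a) a \<Longrightarrow> \<phi> x = 0"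
    using test_function_support[OF \<phi>] by blast
  note c = test_function_continuous[OF \<phi>]
  have "integrable lebesgue (\<lambda>x. complex_of_real ((cmod (\<phi> x))\<^sup>2))"
    by (rule continuous_bounded_support_integral(1)[of _ "-a" a], intro continuous_intros c) (simp add: a)
  then have "integrable lebesgue (\<lambda>x. (cmod (\<phi> x))\<^sup>2)"
    by (simp only: complex_of_real_integrable_eq)
  moreover have "\<phi> \<in> borel_measurable lebesgue"
  proof (rule measurable_completion)
    show "\<phi> \<in> borel_measurable lborel" using borel_measurable_continuous_onI[OF c] by simp
  qed
  ultimately show ?thesis by (simp add: L2_def)
qed

text \<open>Testing with \<open>box_bump\<close> and dominated convergence give a zero integral over
  every box. As \<open>f\<close> is integrable on boxes but perhaps not globally, the conclusion is
  drawn on an exhausting sequence of boxes.\<close>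

lemma L2_weakly_zero:
  fixes f :: "'a::euclidean_space \<Rightarrow> complex"
  assumes f: "f \<in> L2" and 0: "\<And>\<phi>. test_function \<phi> \<Longrightarrow> pairing f \<phi> = 0"
  shows "AE x in lebesgue. f x = 0"
proof -
  have box: "(LINT x:box a b|lebesgue. f x) = 0" for a b
  proof -
    have fb: "integrable lebesgue (\<lambda>x. indicat_real (box a b) x *\<^sub>R f x)"
      using L2_box_integrable[OF f, of a b] by (simp add: set_integrable_def)
    have m: "f \<in> borel_measurable lebesgue" using f by (simp add: L2_def)
    have "(\<lambda>n. \<integral>x. f x * of_real (box_bump a b n x) \<partial>lebesgue) \<longlonglongrightarrow> (\<integral>x. indicat_real (box a b) x *\<^sub>R f x \<partial>lebesgue)"
    proof (rule integral_dominated_convergence)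
      show "integrable lebesgue (\<lambda>x. norm (indicat_real (box a b) x *\<^sub>R f x))"
        using fb by (rule integrable_norm)
      show "(\<lambda>x. indicat_real (box a b) x *\<^sub>R f x) \<in> borel_measurable lebesgue"
        using fb by (rule borel_measurable_integrable)
      show "(\<lambda>x. f x * of_real (box_bump a b n x)) \<in> borel_measurable lebesgue" for n
        using L2_mult_integrable[OF f test_function_L2[OF test_function_box_bump]] by (rule borel_measurable_integrable)
      have "(\<lambda>n. f x * of_real (box_bump a b n x)) \<longlonglongrightarrow> f x * of_real (indicator (box a b) x)" for x
        by (intro tendsto_mult tendsto_const tendsto_of_real box_bump_tendsto)
      then show "AE x in lebesgue. (\<lambda>n. f x * of_real (box_bump a b n x)) \<longlonglongrightarrow> indicat_real (box a b) x *\<^sub>R f x"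
        by (simp add: scaleR_conv_of_real mult.commute)
      show "AE x in lebesgue. norm (f x * of_real (box_bump a b n x)) \<le> norm (indicat_real (box a b) x *\<^sub>R f x)" for n
        using box_bump_bounds[of a b n] box_bump_outside[of _ a b n]
        by (auto simp: indicator_def norm_mult mult_left_le)
    qed
    moreover have "(\<integral>x. f x * of_real (box_bump a b n x) \<partial>lebesgue) = 0" for n
      using 0[OF test_function_box_bump[of a b n]] by (simp add: pairing_def)
    ultimately show ?thesis
      by (simp add: set_lebesgue_integral_def LIMSEQ_const_iff)
  qed
  have "AE x in lebesgue. indicat_real (box c d) x *\<^sub>R f x = 0" for c d
  proof (rule AE_zero_of_box_integrals[where c=c and d=d])
    show "integrable lebesgue (\<lambda>x. indicat_real (box c d) x *\<^sub>R f x)"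
      using L2_box_integrable[OF f, of c d] by (simp add: set_integrable_def)
    show "(LINT x:box a b|lebesgue. indicat_real (box c d) x *\<^sub>R f x) = 0" for a b
      \<comment> \<open>The intersection of two boxes is the box with the larger lower and the
        smaller upper coordinates.\<close>
      using box[of "\<Sum>i\<in>Basis. max (a \<bullet> i) (c \<bullet> i) *\<^sub>R i" "\<Sum>i\<in>Basis. min (b \<bullet> i) (d \<bullet> i) *\<^sub>R i"]
      unfolding box_Int_box[symmetric] set_lebesgue_integral_def by (simp add: indicator_inter_arith)
  qed auto
  then have "AE x in lebesgue. \<forall>n::nat. indicat_real (box (- (real n *\<^sub>R One)) (real n *\<^sub>R One)) x *\<^sub>R f x = 0"
    by (subst AE_all_countable) auto
  then show ?thesis
  proof eventually_elim
    case (elim x)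
    obtain n where "x \<in> box (- (real n *\<^sub>R One)) (real n *\<^sub>R One)"
      using UN_box_eq_UNIV by blast
    then show ?case using elim[rule_format, of n] by simp
  qed
qed

text \<open>This makes the choice operator in \<open>weak_partial\<close> computable: any explicit
  weak derivative in \<open>L2\<close> agrees with the chosen one almost everywhere.\<close>

lemma L2_norm_weak_partial:
  assumes g: "g \<in> L2" "is_weak_partial i f g"
  shows "L2_norm (weak_partial i f) = L2_norm g"
proof -
  let ?g = "weak_partial i f"
  have g': "?g \<in> L2" "is_weak_partial i f ?g"
    unfolding weak_partial_def using someI[of "\<lambda>g. g \<in> L2 \<and> is_weak_partial i f g" g] g by auto
  have "AE x in lebesgue. ?g x - g x = 0"
  proof (rule L2_weakly_zero[OF L2_diff[OF g'(1) g(1)]])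
    fix \<phi> :: "'a \<Rightarrow> complex" assume \<phi>: "test_function \<phi>"
    have "pairing (\<lambda>x. ?g x - g x) \<phi> = pairing ?g \<phi> - pairing g \<phi>"
      unfolding pairing_def left_diff_distrib
      by (intro Bochner_Integration.integral_diff L2_mult_integrable g g' test_function_L2 \<phi>)
    also have "\<dots> = 0" using g(2) g'(2) \<phi> by (simp add: is_weak_partial_def)
    finally show "pairing (\<lambda>x. ?g x - g x) \<phi> = 0" .
  qed
  then have "(\<integral>x. (cmod (?g x))\<^sup>2 \<partial>lebesgue) = (\<integral>x. (cmod (g x))\<^sup>2 \<partial>lebesgue)"
    using g(1) g'(1) by (intro integral_cong_AE) (auto simp: L2_def)
  then show ?thesis by (simp add: L2_norm_def)
qed

section \<open>Continuity with values in \<open>\<Sigma>\<close>\<close>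

text \<open>On the shell between radii \<open>n\<close> and \<open>n + 1\<close>, which lies in the
  cube \<open>B n\<close>, the weight is at most \<open>exp (- \<gamma> n)\<close>; the weights
  times the volumes of the cubes are summable.\<close>

lemma integrable_exp_neg_norm:
  assumes \<gamma>: "\<gamma> > 0"
  shows "integrable lebesgue (\<lambda>x::'a::euclidean_space. exp (- \<gamma> * norm x))"
proof -
  let ?D = "DIM('a)"
  let ?c = "\<lambda>n::nat. exp (- \<gamma> * real n) * (2 * (real n + 1)) ^ ?D"
  define B :: "nat \<Rightarrow> 'a set" where "B n = cbox (- ((real n + 1) *\<^sub>R One)) ((real n + 1) *\<^sub>R One)" for n
  \<comment> \<open>Half of the rate is spent on the volume, through \<open>x^D < exp x\<close> at
    \<open>x = \<gamma> (n + 1) / 2\<close> for large \<open>n\<close>; the other half leaves a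
    geometric series.\<close>
  have "((\<lambda>x::real. x ^ ?D / exp x) \<longlongrightarrow> 0) at_top" by (rule tendsto_power_div_exp_0)
  moreover have "filterlim (\<lambda>n::nat. \<gamma> / 2 * (real n + 1)) at_top sequentially"
  proof (rule filterlim_tendsto_pos_mult_at_top[OF tendsto_const])
    show "filterlim (\<lambda>n::nat. real n + 1) at_top sequentially"
      using filterlim_tendsto_add_at_top[OF tendsto_const filterlim_real_sequentially, of 1]
      by (simp add: add.commute)
  qed (use \<gamma> in simp)
  ultimately have "((\<lambda>n. (\<gamma> / 2 * (real n + 1)) ^ ?D / exp (\<gamma> / 2 * (real n + 1))) \<longlongrightarrow> 0) sequentially"
    by (rule filterlim_compose)
  then have "eventually (\<lambda>n. (\<gamma> / 2 * (real n + 1)) ^ ?D / exp (\<gamma> / 2 * (real n + 1)) < 1) sequentially"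
    by (rule order_tendstoD(2)) simp
  then have ev: "eventually (\<lambda>n. norm (?c n) \<le> ((4 / \<gamma>) ^ ?D * exp (\<gamma> / 2)) * (exp (- \<gamma> / 2)) ^ n) sequentially"
  proof eventually_elim
    case (elim n)
    have "(2 * (real n + 1)) ^ ?D = (4 / \<gamma>) ^ ?D * (\<gamma> / 2 * (real n + 1)) ^ ?D"
    proof -
      have "2 * (real n + 1) = (4 / \<gamma>) * (\<gamma> / 2 * (real n + 1))" using \<gamma> by simp
      then show ?thesis by (simp only: power_mult_distrib[of "4 / \<gamma>"])
    qed
    also have "\<dots> \<le> (4 / \<gamma>) ^ ?D * exp (\<gamma> / 2 * (real n + 1))"
      using elim \<gamma> by (intro mult_left_mono) (auto simp: field_simps)
    finally have "?c n \<le> exp (- \<gamma> * real n) * ((4 / \<gamma>) ^ ?D * exp (\<gamma> / 2 * (real n + 1)))"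
      by (intro mult_left_mono) auto
    also have "\<dots> = (4 / \<gamma>) ^ ?D * exp (- \<gamma> * real n + \<gamma> / 2 * (real n + 1))"
      by (simp only: exp_add mult_ac)
    also have "- \<gamma> * real n + \<gamma> / 2 * (real n + 1) = \<gamma> / 2 + real n * (- \<gamma> / 2)"
      by (simp add: field_simps)
    also have "(4 / \<gamma>) ^ ?D * exp (\<gamma> / 2 + real n * (- \<gamma> / 2)) = ((4 / \<gamma>) ^ ?D * exp (\<gamma> / 2)) * (exp (- \<gamma> / 2)) ^ n"
      by (simp only: exp_add exp_of_nat_mult mult_ac)
    finally show ?case by simp
  qed
  have sm: "summable ?c"
    by (rule summable_comparison_test_ev[OF ev]) (use \<gamma> in \<open>auto intro!: summable_mult summable_geometric\<close>)
  have meas: "(\<lambda>x::'a. exp (- \<gamma> * norm x)) \<in> borel_measurable lborel"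
    by measurable
  have em: "emeasure lborel (B n) = ennreal ((2 * (real n + 1)) ^ ?D)" for n
  proof -
    have "emeasure lborel (B n) = ennreal (\<Prod>b\<in>(Basis :: 'a set). 2 * (real n + 1))"
      by (auto simp: B_def emeasure_lborel_cbox_eq inner_diff_left algebra_simps intro!: arg_cong[where f=ennreal] prod.cong)
    then show ?thesis by simp
  qed
  have "(\<integral>\<^sup>+x. ennreal (exp (- \<gamma> * norm x)) \<partial>(lborel :: 'a measure))
     \<le> (\<integral>\<^sup>+x. (\<Sum>n. ennreal (exp (- \<gamma> * real n)) * indicator (B n) x) \<partial>lborel)"
  proof (rule nn_integral_mono)
    fix x :: 'a
    define n where "n = nat \<lfloor>norm x\<rfloor>"
    have "real n = of_int \<lfloor>norm x\<rfloor>" by (simp add: n_def)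
    then have n: "real n \<le> norm x" "norm x \<le> real n + 1"
      by linarith+
    define f where "f m = ennreal (exp (- \<gamma> * real m)) * indicator (B m) x" for m
    have "x \<in> B n"
      using n(2) Basis_le_norm[of _ x] by (force simp: B_def mem_box)
    then have "ennreal (exp (- \<gamma> * norm x)) \<le> f n"
      using n(1) \<gamma> by (simp add: f_def ennreal_leI)
    also have "\<dots> = sum f {n}" by simp
    also have "\<dots> \<le> suminf f"
      by (intro sum_le_suminf) auto
    finally show "ennreal (exp (- \<gamma> * norm x)) \<le> (\<Sum>n. ennreal (exp (- \<gamma> * real n)) * indicator (B n) x)"
      unfolding f_def .
  qed
  also have "\<dots> = (\<Sum>n. \<integral>\<^sup>+x. ennreal (exp (- \<gamma> * real n)) * indicator (B n) x \<partial>lborel)"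
    by (rule nn_integral_suminf) (auto simp: B_def)
  also have "\<dots> = (\<Sum>n. ennreal (?c n))"
    by (subst nn_integral_cmult_indicator) (auto simp: em ennreal_mult[symmetric], simp add: B_def)
  also have "\<dots> = ennreal (\<Sum>n. ?c n)"
    by (rule suminf_ennreal2[OF _ sm]) simp
  also have "\<dots> < \<infinity>" by simp
  finally have "integrable lborel (\<lambda>x::'a. exp (- \<gamma> * norm x))"
    by (intro integrableI_nonneg meas) auto
  then show ?thesis using meas by (simp add: integrable_completion)
qed

lemma one_plus_mult_exp_le:
  fixes \<gamma> r :: real
  assumes "\<gamma> > 0" "r \<ge> 0"
  shows "(1 + r) * exp (- \<gamma> * r) \<le> (1 + 2 / \<gamma>) * exp (- (\<gamma> / 2) * r)"
proof -
  have "r * exp (- (\<gamma> / 2) * r) \<le> 2 / \<gamma>"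
  proof -
    have "\<gamma> / 2 * r \<le> exp (\<gamma> / 2 * r)"
      using exp_ge_add_one_self[of "\<gamma> / 2 * r"] by linarith
    then have "r \<le> 2 / \<gamma> * exp (\<gamma> / 2 * r)" using assms by (simp add: field_simps)
    then have "r * exp (- (\<gamma> / 2) * r) \<le> (2 / \<gamma> * exp (\<gamma> / 2 * r)) * exp (- (\<gamma> / 2) * r)"
      by (intro mult_right_mono) auto
    also have "\<dots> = 2 / \<gamma>" by (simp add: exp_minus)
    finally show ?thesis .
  qed
  moreover have "exp (- (\<gamma> / 2) * r) \<le> 1" using assms by simp
  ultimately have "(1 + r) * exp (- (\<gamma> / 2) * r) \<le> 1 + 2 / \<gamma>"
    unfolding distrib_right mult_1_left by linarith
  then have "((1 + r) * exp (- (\<gamma> / 2) * r)) * exp (- (\<gamma> / 2) * r) \<le> (1 + 2 / \<gamma>) * exp (- (\<gamma> / 2) * r)"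
    by (intro mult_right_mono) auto
  moreover have "exp (- \<gamma> * r) = exp (- (\<gamma> / 2) * r) * exp (- (\<gamma> / 2) * r)"
    by (simp add: exp_add[symmetric])
  ultimately show ?thesis by (simp add: mult.assoc)
qed

lemma continuous_imp_lebesgue_measurable:
  fixes f :: "'a::euclidean_space \<Rightarrow> complex"
  assumes "continuous_on UNIV f"
  shows "f \<in> borel_measurable lebesgue"
proof (rule measurable_completion)
  show "f \<in> borel_measurable lborel" using borel_measurable_continuous_onI[OF assms] by simp
qed

lemma L2_of_exp_bound:
  fixes f :: "'a::euclidean_space \<Rightarrow> complex"
  assumes f: "continuous_on UNIV f" and \<gamma>: "\<gamma> > 0" and b: "\<And>x. cmod (f x) \<le> M * exp (- \<gamma> * norm x)"
  shows "f \<in> L2"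
proof -
  have m: "f \<in> borel_measurable lebesgue" by (rule continuous_imp_lebesgue_measurable[OF f])
  have "integrable lebesgue (\<lambda>x. (cmod (f x))\<^sup>2)"
  proof (rule Bochner_Integration.integrable_bound)
    show "integrable lebesgue (\<lambda>x::'a. M^2 * exp (- (2 * \<gamma>) * norm x))"
      using \<gamma> by (intro integrable_mult_right integrable_exp_neg_norm) auto
    show "(\<lambda>x. (cmod (f x))\<^sup>2) \<in> borel_measurable lebesgue" using m by measurable
    have "(cmod (f x))\<^sup>2 \<le> M^2 * exp (- (2 * \<gamma>) * norm x)" for x
    proof -
      have "(cmod (f x))\<^sup>2 \<le> (M * exp (- \<gamma> * norm x))\<^sup>2" using b by (intro power_mono) auto
      also have "\<dots> = M^2 * exp (- (2 * \<gamma>) * norm x)"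
        by (simp add: power_mult_distrib exp_double[symmetric] mult.assoc)
      finally show ?thesis .
    qed
    then show "AE x in lebesgue. norm ((cmod (f x))\<^sup>2) \<le> norm (M^2 * exp (- (2 * \<gamma>) * norm x))"
      by (simp add: abs_mult)
  qed
  with m show ?thesis by (simp add: L2_def)
qed

text \<open>Dominated convergence along sequences in \<open>J\<close>; the exponential bound,
  uniform over \<open>J\<close>, supplies the majorant.\<close>

lemma L2_norm_diff_tendsto:
  fixes f :: "real \<Rightarrow> 'a::euclidean_space \<Rightarrow> complex"
  assumes f: "\<And>s. s \<in> J \<Longrightarrow> continuous_on UNIV (f s)" and \<gamma>: "\<gamma> > 0"
    and b: "\<And>s x. s \<in> J \<Longrightarrow> cmod (f s x) \<le> M * exp (- \<gamma> * norm x)"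
    and t: "t \<in> J" and lim: "\<And>x. ((\<lambda>s. f s x) \<longlongrightarrow> f t x) (at t within J)"
  shows "((\<lambda>s. L2_norm (\<lambda>x. f s x - f t x)) \<longlongrightarrow> 0) (at t within J)"
  unfolding tendsto_at_iff_sequentially
proof (intro allI impI)
  fix X assume X: "\<forall>i. X i \<in> J - {t}" "X \<longlonglongrightarrow> t"
  have "(\<lambda>n. \<integral>x. (cmod (f (X n) x - f t x))\<^sup>2 \<partial>lebesgue) \<longlonglongrightarrow> (\<integral>x. 0 \<partial>(lebesgue :: 'a measure))"
  proof (rule integral_dominated_convergence)
    show "integrable lebesgue (\<lambda>x::'a. (2 * M)^2 * exp (- (2 * \<gamma>) * norm x))"
      using \<gamma> by (intro integrable_mult_right integrable_exp_neg_norm) auto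
    show "(\<lambda>x. (cmod (f (X n) x - f t x))\<^sup>2) \<in> borel_measurable lebesgue" for n
    proof -
      have "X n \<in> J" using X by auto
      note [measurable] = continuous_imp_lebesgue_measurable[OF f[OF t]] continuous_imp_lebesgue_measurable[OF f[OF this]]
      show ?thesis by measurable
    qed
    show "AE x in lebesgue. (\<lambda>n. (cmod (f (X n) x - f t x))\<^sup>2) \<longlonglongrightarrow> 0"
    proof (rule AE_I2)
      fix x
      have "(\<lambda>n. f (X n) x) \<longlonglongrightarrow> f t x"
        using lim[of x] X unfolding tendsto_at_iff_sequentially by (auto simp: comp_def)
      then have "(\<lambda>n. (cmod (f (X n) x - f t x))\<^sup>2) \<longlonglongrightarrow> (cmod (f t x - f t x))\<^sup>2"
        by (intro tendsto_intros)
      then show "(\<lambda>n. (cmod (f (X n) x - f t x))\<^sup>2) \<longlonglongrightarrow> 0" by simp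
    qed
    show "AE x in lebesgue. norm ((cmod (f (X n) x - f t x))\<^sup>2) \<le> (2 * M)^2 * exp (- (2 * \<gamma>) * norm x)" for n
    proof (rule AE_I2)
      fix x
      have "cmod (f (X n) x - f t x) \<le> cmod (f (X n) x) + cmod (f t x)" by (rule norm_triangle_ineq4)
      also have "\<dots> \<le> 2 * M * exp (- \<gamma> * norm x)"
        using b[of "X n" x] b[OF t, of x] X by simp
      finally have "(cmod (f (X n) x - f t x))\<^sup>2 \<le> (2 * M * exp (- \<gamma> * norm x))\<^sup>2"
        by (intro power_mono) auto
      also have "\<dots> = (2 * M)^2 * exp (- (2 * \<gamma>) * norm x)"
        by (simp add: power_mult_distrib exp_double[symmetric] mult.assoc)
      finally show "norm ((cmod (f (X n) x - f t x))\<^sup>2) \<le> (2 * M)^2 * exp (- (2 * \<gamma>) * norm x)" by simp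
    qed
  qed simp_all
  then have "(\<lambda>n. sqrt (\<integral>x. (cmod (f (X n) x - f t x))\<^sup>2 \<partial>lebesgue)) \<longlonglongrightarrow> sqrt 0"
    by (intro tendsto_real_sqrt) simp
  then show "((\<lambda>s. L2_norm (\<lambda>x. f s x - f t x)) \<circ> X) \<longlonglongrightarrow> 0"
    by (simp add: L2_norm_def comp_def)
qed

text \<open>Pointwise continuity in time suffices if the exponential bounds are uniform near each
  time; a bound uniform over \<open>I\<close> would fail for a solution concentrating at an end
  point. The factor \<open>1 + norm x\<close> in the gradient bound accommodates a quadratic
  phase.\<close>

lemma continuous_into_SigmaI:
  fixes u :: "real \<Rightarrow> 'a::euclidean_space \<Rightarrow> complex" and g :: "'a \<Rightarrow> real \<Rightarrow> 'a \<Rightarrow> complex"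
  assumes weak: "\<And>i s. i \<in> Basis \<Longrightarrow> s \<in> I \<Longrightarrow> is_weak_partial i (u s) (g i s)"
    and uc: "\<And>s. s \<in> I \<Longrightarrow> continuous_on UNIV (u s)"
    and gc: "\<And>i s. i \<in> Basis \<Longrightarrow> s \<in> I \<Longrightarrow> continuous_on UNIV (g i s)"
    and bound: "\<And>t. t \<in> I \<Longrightarrow> \<exists>S M \<gamma>. open S \<and> t \<in> S \<and> \<gamma> > 0 \<and>
        (\<forall>s\<in>I \<inter> S. \<forall>x. cmod (u s x) \<le> M * exp (- \<gamma> * norm x) \<and>
          (\<forall>i\<in>Basis. cmod (g i s x) \<le> M * ((1 + norm x) * exp (- \<gamma> * norm x))))"
    and ulim: "\<And>t x. t \<in> I \<Longrightarrow> ((\<lambda>s. u s x) \<longlongrightarrow> u t x) (at t within I)"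
    and glim: "\<And>i t x. i \<in> Basis \<Longrightarrow> t \<in> I \<Longrightarrow> ((\<lambda>s. g i s x) \<longlongrightarrow> g i t x) (at t within I)"
  shows "continuous_into_Sigma I u"
    "\<And>t. t \<in> I \<Longrightarrow> grad_L2_norm (u t) = sqrt (\<Sum>i\<in>Basis. (L2_norm (g i t))\<^sup>2)"
    "\<And>i t. i \<in> Basis \<Longrightarrow> t \<in> I \<Longrightarrow> g i t \<in> L2"
proof -
  let ?m = "\<lambda>s x. of_real (norm x) * u s x"
  let ?L = "\<lambda>S M \<gamma>. \<forall>s\<in>I \<inter> S. \<forall>x. cmod (u s x) \<le> M * exp (- \<gamma> * norm x) \<and> cmod (?m s x) \<le> M * exp (- \<gamma> * norm x) \<and>
          (\<forall>i\<in>Basis. cmod (g i s x) \<le> M * exp (- \<gamma> * norm x))"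
  \<comment> \<open>Halving the rate absorbs the linear factors, so that \<open>u\<close>, its
    product with the norm, and the gradient share one bound.\<close>
  have local: "\<exists>S M \<gamma>. open S \<and> t \<in> S \<and> \<gamma> > 0 \<and>
        ?L S M \<gamma>" if t: "t \<in> I" for t
  proof -
    obtain S M \<gamma> where S: "open S" "t \<in> S" and \<gamma>: "\<gamma> > 0"
      and b: "\<And>s x. s \<in> I \<inter> S \<Longrightarrow> cmod (u s x) \<le> M * exp (- \<gamma> * norm x)"
        "\<And>s x i. s \<in> I \<inter> S \<Longrightarrow> i \<in> Basis \<Longrightarrow> cmod (g i s x) \<le> M * ((1 + norm x) * exp (- \<gamma> * norm x))"
      using bound[OF t] by blast
    have "0 \<le> M * exp (- \<gamma> * norm (0::'a))"
      using order_trans[OF norm_ge_zero b(1)[of t 0]] t S by simp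
    then have M: "M \<ge> 0" by simp
    have e: "M * ((1 + norm x) * exp (- \<gamma> * norm x)) \<le> M * (1 + 2 / \<gamma>) * exp (- (\<gamma> / 2) * norm x)" for x :: 'a
      using mult_left_mono[OF one_plus_mult_exp_le[OF \<gamma> norm_ge_zero[of x]] M] by (simp add: mult.assoc)
    have n: "M * exp (- \<gamma> * norm x) \<le> M * ((1 + norm x) * exp (- \<gamma> * norm x))" for x :: 'a
      using M by (intro mult_left_mono) auto
    have m: "norm x * (M * exp (- \<gamma> * norm x)) \<le> M * ((1 + norm x) * exp (- \<gamma> * norm x))" for x :: 'a
      using M by (simp add: algebra_simps)
    show ?thesis
    proof (intro exI conjI ballI allI)
      show "open S" "t \<in> S" "\<gamma> / 2 > 0" using S \<gamma> by auto
      fix s x assume s: "s \<in> I \<inter> S"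
      show "cmod (u s x) \<le> M * (1 + 2 / \<gamma>) * exp (- (\<gamma> / 2) * norm x)"
        using b(1)[OF s, of x] n[of x] e[of x] by linarith
      have "cmod (?m s x) \<le> norm x * (M * exp (- \<gamma> * norm x))"
        using mult_left_mono[OF b(1)[OF s, of x] norm_ge_zero[of x]] by (simp add: norm_mult)
      then show "cmod (?m s x) \<le> M * (1 + 2 / \<gamma>) * exp (- (\<gamma> / 2) * norm x)"
        using m[of x] e[of x] by linarith
      show "cmod (g i s x) \<le> M * (1 + 2 / \<gamma>) * exp (- (\<gamma> / 2) * norm x)" if "i \<in> Basis" for i
        using b(2)[OF s that, of x] e[of x] by linarith
    qed
  qed
  have mc: "continuous_on UNIV (?m s)" if "s \<in> I" for s
    by (intro continuous_intros uc[OF that])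
  have L2: "u t \<in> L2" "?m t \<in> L2" "i \<in> Basis \<Longrightarrow> g i t \<in> L2" if t: "t \<in> I" for t i
  proof -
    obtain S M \<gamma> where S: "t \<in> S" and \<gamma>: "\<gamma> > 0" and b: "?L S M \<gamma>"
      using local[OF t] by blast
    show "u t \<in> L2" "?m t \<in> L2" "i \<in> Basis \<Longrightarrow> g i t \<in> L2"
      using t S b by (auto intro!: L2_of_exp_bound[OF _ \<gamma>, where M=M] uc mc gc)
  qed
  show "g i t \<in> L2" if "i \<in> Basis" "t \<in> I" for i t
    using L2(3) that by blast
  have H1: "u t \<in> H1" if "t \<in> I" for t
    using L2[OF that] weak that by (auto simp: H1_def)
  have Sig: "u t \<in> Sigma_space" if "t \<in> I" for t
    using H1[OF that] L2[OF that] by (auto simp: Sigma_space_def)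
  show "grad_L2_norm (u t) = sqrt (\<Sum>i\<in>Basis. (L2_norm (g i t))\<^sup>2)" if "t \<in> I" for t
  proof -
    have "L2_norm (weak_partial i (u t)) = L2_norm (g i t)" if i: "i \<in> Basis" for i
      by (rule L2_norm_weak_partial[OF L2(3)[OF \<open>t \<in> I\<close> i] weak[OF i \<open>t \<in> I\<close>]])
    then show ?thesis by (simp add: grad_L2_norm_def)
  qed
  \<comment> \<open>\<open>Sigma_norm\<close> of a difference refers to the weak derivative chosen
    for that difference; linearity and uniqueness identify its norm.\<close>
  have weak_diff: "is_weak_partial i (\<lambda>x. u s x - u t x) (\<lambda>x. g i s x - g i t x)"
    if i: "i \<in> Basis" and s: "s \<in> I" and t: "t \<in> I" for i s t
    unfolding is_weak_partial_def
  proof (intro allI impI)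
    fix \<phi> :: "'a \<Rightarrow> complex" assume \<phi>: "test_function \<phi>"
    have "pairing (\<lambda>x. g i s x - g i t x) \<phi> = pairing (g i s) \<phi> - pairing (g i t) \<phi>"
      unfolding pairing_def left_diff_distrib
      by (intro Bochner_Integration.integral_diff integrable_mult_test_function gc i s t \<phi>)
    moreover have "pairing (\<lambda>x. u s x - u t x) (partial i \<phi>) = pairing (u s) (partial i \<phi>) - pairing (u t) (partial i \<phi>)"
      unfolding pairing_def left_diff_distrib
      by (intro Bochner_Integration.integral_diff integrable_mult_test_function uc i s t \<phi> test_function_partial)
    ultimately show "pairing (\<lambda>x. g i s x - g i t x) \<phi> = - pairing (\<lambda>x. u s x - u t x) (partial i \<phi>)"
      using weak[OF i s] weak[OF i t] \<phi> by (simp add: is_weak_partial_def)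
  qed
  have "((\<lambda>s. Sigma_norm (\<lambda>x. u s x - u t x)) \<longlongrightarrow> 0) (at t within I)" if t: "t \<in> I" for t
  proof -
    obtain S M \<gamma> where S: "open S" "t \<in> S" and \<gamma>: "\<gamma> > 0" and b: "?L S M \<gamma>"
      using local[OF t] by blast
    have at: "at t within I = at t within (I \<inter> S)"
      by (rule at_within_nhd[of t S]) (use S in auto)
    have tS: "t \<in> I \<inter> S" using t S by simp
    have 1: "((\<lambda>s. L2_norm (\<lambda>x. u s x - u t x)) \<longlongrightarrow> 0) (at t within I)"
      unfolding at using ulim[OF t] b uc
      by (intro L2_norm_diff_tendsto[OF _ \<gamma> _ tS]) (auto simp: at[symmetric])
    have 2: "((\<lambda>s. L2_norm (\<lambda>x. ?m s x - ?m t x)) \<longlongrightarrow> 0) (at t within I)"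
      unfolding at using ulim[OF t] b mc
      by (intro L2_norm_diff_tendsto[OF _ \<gamma> _ tS]) (auto simp: at[symmetric] intro!: tendsto_intros)
    have 3: "((\<lambda>s. L2_norm (\<lambda>x. g i s x - g i t x)) \<longlongrightarrow> 0) (at t within I)" if i: "i \<in> Basis" for i
      unfolding at using glim[OF i t] b gc[OF i] i
      by (intro L2_norm_diff_tendsto[OF _ \<gamma> _ tS]) (auto simp: at[symmetric])
    let ?N = "\<lambda>s. sqrt ((L2_norm (\<lambda>x. u s x - u t x))\<^sup>2
          + (sqrt (\<Sum>i\<in>Basis. (L2_norm (\<lambda>x. g i s x - g i t x))\<^sup>2))\<^sup>2
          + (L2_norm (\<lambda>x. ?m s x - ?m t x))\<^sup>2)"
    have "(?N \<longlongrightarrow> sqrt (0\<^sup>2 + (sqrt (\<Sum>i\<in>(Basis::'a set). 0\<^sup>2))\<^sup>2 + 0\<^sup>2)) (at t within I)"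
      by (intro tendsto_intros 1 2 3)
    moreover have "eventually (\<lambda>s. ?N s = Sigma_norm (\<lambda>x. u s x - u t x)) (at t within I)"
      unfolding eventually_at_filter
    proof (rule always_eventually, intro allI impI)
      fix s assume s: "s \<in> I"
      have "grad_L2_norm (\<lambda>x. u s x - u t x) = sqrt (\<Sum>i\<in>Basis. (L2_norm (\<lambda>x. g i s x - g i t x))\<^sup>2)"
      proof -
        have "L2_norm (weak_partial i (\<lambda>x. u s x - u t x)) = L2_norm (\<lambda>x. g i s x - g i t x)" if i: "i \<in> Basis" for i
          by (rule L2_norm_weak_partial[OF L2_diff[OF L2(3)[OF s i] L2(3)[OF t i]] weak_diff[OF i s t]])
        then show ?thesis by (simp add: grad_L2_norm_def)
      qed
      then show "?N s = Sigma_norm (\<lambda>x. u s x - u t x)"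
        by (simp add: Sigma_norm_def right_diff_distrib)
    qed
    ultimately show ?thesis by (simp add: Lim_transform_eventually)
  qed
  then show "continuous_into_Sigma I u"
    using Sig by (auto simp: continuous_into_Sigma_def)
qed

section \<open>The phase factor and the time-dependent oscillator\<close>

lemma modulated_has_vector_derivative:
  assumes "(p has_real_derivative p') (at x within S)" "(s has_real_derivative s') (at x within S)"
    "(\<theta> has_real_derivative \<theta>') (at x within S)"
  shows "((\<lambda>x. Complex (p x) (s x) * cis (\<theta> x)) has_vector_derivative
     Complex (p' - \<theta>' * s x) (s' + \<theta>' * p x) * cis (\<theta> x)) (at x within S)"
  unfolding has_vector_derivative_complex_iff
  by (auto intro!: derivative_eq_intros assms simp: algebra_simps)

text \<open>Here \<open>c\<close> is \<open>b'\<close>. The phase is required on the half-open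
  interval only, \<open>1 / b^2\<close> being singular at 0, whereas \<open>b\<close> is continuous
  through 0, where its zero causes the concentration.\<close>

locale oscillator =
  fixes w T :: real and b c \<zeta> \<Omega> :: "real \<Rightarrow> real"
  assumes T: "T > 0" and b_0: "b 0 = 0" and b_cont: "continuous_on UNIV b" and c_cont: "continuous_on UNIV c"
    and b_deriv: "\<And>t. (b has_real_derivative c t) (at t)"
    and c_deriv: "\<And>t. 0 < t \<Longrightarrow> t \<le> T \<Longrightarrow> (c has_real_derivative - \<Omega> t * b t) (at t)"
    and b_pos: "\<And>t. 0 < t \<Longrightarrow> t \<le> T \<Longrightarrow> b t > 0"
    and \<zeta>_deriv: "\<And>t. 0 < t \<Longrightarrow> t \<le> T \<Longrightarrow> (\<zeta> has_real_derivative w / (b t)\<^sup>2) (at t)"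

lemma oscillator_exists:
  fixes w :: real
  assumes \<Omega>: "continuous_on UNIV \<Omega>"
  obtains T b c \<zeta> where "oscillator w T b c \<zeta> \<Omega>"
proof -
  \<comment> \<open>Freezing \<open>\<Omega>\<close> outside [0,1] makes the coefficient bounded and
    the equation globally Lipschitz; \<open>T \<le> 1\<close> ensures that the true coefficient acts
    on the time interval.\<close>
  define P where "P t = \<Omega> (max 0 (min 1 t))" for t
  have Pc: "continuous_on S (\<lambda>x. P (f x))" if "continuous_on S f" for f and S :: "'x::topological_space set"
    unfolding P_def by (intro continuous_on_compose2[OF \<Omega>] continuous_intros that) auto
  have "compact (\<Omega> ` {0..1})"
    by (intro compact_continuous_image continuous_on_subset[OF \<Omega>]) auto
  then obtain L where L: "\<And>t. t \<in> {0..1} \<Longrightarrow> \<bar>\<Omega> t\<bar> \<le> L"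
    using compact_imp_bounded bounded_iff by (metis image_eqI real_norm_def)
  have PL: "\<bar>P t\<bar> \<le> L" for t unfolding P_def by (rule L) auto
  have "\<bar>- P s * y - - P s * z\<bar> \<le> L * \<bar>y - z\<bar>" for s y z
  proof -
    have "\<bar>- P s * y - - P s * z\<bar> = \<bar>P s\<bar> * \<bar>y - z\<bar>"
      by (simp add: abs_mult[symmetric] right_diff_distrib abs_minus_commute)
    then show ?thesis using PL[of s] by (simp add: mult_right_mono)
  qed
  note lip = this
  have cont: "continuous_on UNIV (\<lambda>(e::real, s, y). - P s * y)"
    unfolding split_beta by (intro continuous_intros Pc)
  \<comment> \<open>For \<open>k = 0\<close> the flux equation is \<open>(r h)' = H\<close>, so with
    slope \<open>a1 = 1\<close> the derivative \<open>1 + r h\<close> of \<open>v\<close> satisfies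
    the second-order equation. The parameter \<open>e\<close> is a dummy and is set to 0.\<close>
  obtain v h where vh:
    "continuous_on UNIV (\<lambda>(e,r). v e r)" "continuous_on UNIV (\<lambda>(e,r). h e r)"
    "\<And>e::real. v e 0 = 0"
    "\<And>e r. (v e has_real_derivative 1 + r * h e r) (at r)"
    "\<And>e r. ((\<lambda>r. r^(0+1) * h e r) has_real_derivative r^0 * (- P r * v e r)) (at r)"
    by (rule radial_ode[of "\<lambda>e s y. - P s * y" L 0 0 1 0, OF cont lip]) (simp, blast)
  define b where "b = v 0"
  define c where "c t = 1 + t * h 0 t" for t
  have hc: "continuous_on UNIV (h 0)"
    using continuous_on_compose2[OF vh(2) continuous_on_Pair[OF continuous_on_const[of UNIV "0::real"] continuous_on_id]]
    by simp
  have cc: "continuous_on UNIV c" unfolding c_def by (intro continuous_intros hc)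
  have b': "(b has_real_derivative c t) (at t)" for t
    using vh(4) by (simp add: b_def c_def)
  have bc: "continuous_on UNIV b"
    using b' by (auto intro: DERIV_continuous_on has_field_derivative_at_within)
  have c': "(c has_real_derivative - P t * b t) (at t)" for t
  proof -
    have "((\<lambda>r. r * h 0 r) has_real_derivative - P t * v 0 t) (at t)"
      using vh(5)[of 0 t] by simp
    from DERIV_add[OF DERIV_const[of 1] this] show ?thesis
      by (simp add: c_def[abs_def] b_def)
  qed
  have "(c \<longlongrightarrow> c 0) (at 0)" using cc by (simp add: continuous_on_eq_continuous_at isCont_def)
  then have "eventually (\<lambda>t. c t > 0) (at 0)"
    by (rule order_tendstoD(1)) (simp add: c_def)
  then obtain \<delta> where \<delta>: "\<delta> > 0" "\<And>t. t \<noteq> 0 \<Longrightarrow> \<bar>t\<bar> < \<delta> \<Longrightarrow> c t > 0"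
    by (auto simp: eventually_at dist_real_def)
  \<comment> \<open>The antiderivative \<open>\<zeta>\<close> lives on the open interval up to
    \<open>\<delta>\<close>; taking half of it gives a two-sided derivative at \<open>T\<close>
    too.\<close>
  define T where "T = min 1 (\<delta> / 2)"
  have T: "T > 0" "T \<le> 1" "T < \<delta>" using \<delta>(1) by (auto simp: T_def)
  have bpos: "b t > 0" if "0 < t" "t < \<delta>" for t
  proof -
    have "b 0 < b t"
    proof (rule DERIV_pos_imp_increasing_open[OF that(1)])
      fix x assume "0 < x" "x < t"
      then show "\<exists>y. (b has_real_derivative y) (at x) \<and> 0 < y"
        using b'[of x] \<delta>(2)[of x] that by (intro exI[of _ "c x"] conjI) auto
    qed (rule continuous_on_subset[OF bc], simp)
    then show ?thesis using vh(3) by (simp add: b_def)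
  qed
  have "\<exists>\<zeta>. \<forall>t::real. ereal 0 < t \<longrightarrow> t < ereal \<delta> \<longrightarrow> (\<zeta> has_vector_derivative w / (b t)\<^sup>2) (at t)"
  proof (rule einterval_antiderivative)
    fix t :: real assume "ereal 0 < t" "t < ereal \<delta>"
    then have "b t \<noteq> 0" using bpos[of t] by simp
    then show "isCont (\<lambda>t. w / (b t)\<^sup>2) t"
      using bc by (intro continuous_intros) (auto simp: continuous_on_eq_continuous_at)
  qed (use \<delta> in simp)
  then obtain \<zeta> where \<zeta>: "\<And>t. 0 < t \<Longrightarrow> t < \<delta> \<Longrightarrow> (\<zeta> has_real_derivative w / (b t)\<^sup>2) (at t)"
    by (auto simp: has_real_derivative_iff_has_vector_derivative)
  show ?thesis
  proof (rule that[of T b c \<zeta>], unfold_locales)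
    show "(c has_real_derivative - \<Omega> t * b t) (at t)" if "0 < t" "t \<le> T" for t
      using c'[of t] that T by (simp add: P_def)
  qed (use T b' bc cc bpos \<zeta> vh(3) in \<open>auto simp: b_def\<close>)
qed

section \<open>The blow-up solution\<close>

lemma cmod_Complex_cis_le: "cmod (Complex p s * cis \<theta>) \<le> \<bar>p\<bar> + \<bar>s\<bar>"
  by (simp add: norm_mult complex_norm sqrt_sum_squares_le_sum_abs)

text \<open>The equation with the common phase removed; \<open>r2\<close> is \<open>r^2\<close>,
  \<open>ib\<close> is \<open>1 / b^2\<close> and \<open>P\<close> is the power of the profile. In
  the imaginary part the time derivative of amplitude and profile cancels the cross terms of phase
  and profile. In the real part \<open>\<beta>^2\<close> and \<open>e\<close> cancel, leaving the
  potential and the nonlinearity.\<close>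

lemma lens_identity:
  fixes A d \<beta> V r2 h ib \<Omega> e P :: real
  shows "\<i> * Complex (A * (- (d / 2) * \<beta> * V - \<beta> * r2 * h * ib)) (((- \<Omega> - \<beta>\<^sup>2) * r2 / 2 + e / 2 * ib) * (A * V))
    + 1 / 2 * (Complex (A * (e * V - P * V - d * h) * ib - A * \<beta>\<^sup>2 * r2 * V) (2 * A * \<beta> * r2 * h * ib)
      + of_real d * Complex (A * h * ib) (A * \<beta> * V))
    = of_real (1 / 2 * \<Omega> * r2) * Complex (A * V) 0 + of_real (- (1 / 2) * (P * ib)) * Complex (A * V) 0"
  by (simp add: complex_eq_iff field_simps)

text \<open>
  The lens transform \<open>v \<mapsto> a b\<^bsup>-d/2\<^esup> v(x/b) exp(i b' |x|\<^sup>2 / (2b) + i \<zeta>)\<close> with \<open>b'' = -\<Omega> b\<close>,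
  \<open>b(0) = 0\<close> turns the standing wave of the ground state into a solution concentrating at time \<open>0\<close>;
  here \<open>c = b'\<close> and the profile \<open>v\<close> satisfies \<open>v' = r h\<close>.
\<close>

locale lens_transform =
  radial_profile d q e \<gamma> C v h + oscillator "e / 2" T b c \<zeta> \<Omega>
  for d q e \<gamma> C v h T b c \<zeta> \<Omega> +
  fixes a \<kappa> :: real
  assumes a: "a > 0" "\<kappa> * a powr q = - 1 / 2"
    and \<Omega>_cont: "continuous_on UNIV \<Omega>"
begin

text \<open>Twice the coefficient of \<open>r^2\<close> in the phase; it solves the Riccati equation
  \<open>\<beta>' = - \<Omega> - \<beta>^2\<close>, through which the potential enters.\<close>

definition \<beta> where "\<beta> t = c t / b t"
definition amp where "amp t = a * b t powr (- (d / 2))"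
definition \<theta> where "\<theta> t r = \<beta> t * r\<^sup>2 / 2 + \<zeta> t"
definition g where "g s = e * v s - \<bar>v s\<bar> powr q * v s"
definition U where "U t r = Complex (amp t * v (r / b t)) 0 * cis (\<theta> t r)"
text \<open>The radial derivative of \<open>U\<close> divided by \<open>r\<close>, so that
  \<open>x H(|x|)\<close> is the spatial gradient.\<close>

definition H where "H t r = Complex (amp t * h (r / b t) / (b t)\<^sup>2) (amp t * \<beta> t * v (r / b t)) * cis (\<theta> t r)"
text \<open>\<open>r\<close> times the radial derivative of \<open>H\<close>; the Laplacian is
  \<open>G + d H\<close>.\<close>

definition G where "G t r = Complex (amp t * (g (r / b t) - d * h (r / b t)) / (b t)\<^sup>2 - amp t * (\<beta> t)\<^sup>2 * r\<^sup>2 * v (r / b t))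
  (2 * amp t * \<beta> t * r\<^sup>2 * h (r / b t) / (b t)\<^sup>2) * cis (\<theta> t r)"
definition \<theta>t where "\<theta>t t r = (- \<Omega> t - (\<beta> t)\<^sup>2) * r\<^sup>2 / 2 + (e / 2) / (b t)\<^sup>2"
definition Ut where "Ut t r = Complex (amp t * (- (d / 2) * \<beta> t * v (r / b t) - \<beta> t * r\<^sup>2 * h (r / b t) / (b t)\<^sup>2))
  (\<theta>t t r * (amp t * v (r / b t))) * cis (\<theta> t r)"

section \<open>Derivatives of the transformed standing wave\<close>

lemma q_pos: "q > 0" using q d by simp

lemma amp_pos: "0 < t \<Longrightarrow> t \<le> T \<Longrightarrow> amp t > 0"
  using b_pos[of t] a by (simp add: amp_def)

lemma v_cont: "continuous_on UNIV v"
  by (rule DERIV_continuous_on[OF has_field_derivative_at_within[OF v_deriv]])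

lemma \<theta>_deriv_r: "(\<theta> t has_real_derivative \<beta> t * r) (at r)"
  unfolding \<theta>_def[abs_def] by (auto intro!: derivative_eq_intros)

lemma v_scaled_deriv_r: "b t \<noteq> 0 \<Longrightarrow> ((\<lambda>r. v (r / b t)) has_real_derivative r * h (r / b t) / (b t)\<^sup>2) (at r)"
proof -
  assume "b t \<noteq> 0"
  have "((\<lambda>r. v (r / b t)) has_real_derivative (r / b t * h (r / b t)) * (1 / b t)) (at r)"
    by (rule DERIV_chain2[OF v_deriv DERIV_cdivide[OF DERIV_ident]])
  then show ?thesis by (simp add: power2_eq_square)
qed

lemma U_deriv_r:
  assumes t: "0 < t" "t \<le> T"
  shows "(U t has_vector_derivative r *\<^sub>R H t r) (at r)"
proof -
  have b: "b t \<noteq> 0" using b_pos[OF t] by simp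
  have "((\<lambda>r. Complex (amp t * v (r / b t)) 0 * cis (\<theta> t r)) has_vector_derivative
     Complex (amp t * (r * h (r / b t) / (b t)\<^sup>2) - \<beta> t * r * 0) (0 + \<beta> t * r * (amp t * v (r / b t))) * cis (\<theta> t r)) (at r)"
    by (intro modulated_has_vector_derivative DERIV_cmult v_scaled_deriv_r b \<theta>_deriv_r DERIV_const)
  then show ?thesis
    unfolding U_def[abs_def]
    by (rule has_vector_derivative_eq_rhs)
       (simp add: H_def scaleR_conv_of_real complex_eq_iff algebra_simps)
qed

lemma H_deriv_r:
  assumes t: "0 < t" "t \<le> T" and r: "r > 0"
  shows "(H t has_vector_derivative G t r /\<^sub>R r) (at r)"
proof -
  have b: "b t > 0" using b_pos[OF t] .
  let ?s = "r / b t"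
  have s: "?s > 0" using b r by simp
  have hd: "((\<lambda>r. h (r / b t)) has_real_derivative (g ?s - d * h ?s) / ?s * (1 / b t)) (at r)"
    unfolding g_def by (rule DERIV_chain2[OF h_deriv[OF s] DERIV_cdivide[OF DERIV_ident]])
  have D: "((\<lambda>r. Complex (amp t * h (r / b t) / (b t)\<^sup>2) (amp t * \<beta> t * v (r / b t)) * cis (\<theta> t r)) has_vector_derivative
     Complex (amp t * ((g ?s - d * h ?s) / ?s * (1 / b t)) / (b t)\<^sup>2 - \<beta> t * r * (amp t * \<beta> t * v ?s))
       (amp t * \<beta> t * (r * h ?s / (b t)\<^sup>2) + \<beta> t * r * (amp t * h ?s / (b t)\<^sup>2)) * cis (\<theta> t r)) (at r)"
    using b by (intro modulated_has_vector_derivative DERIV_cmult DERIV_cdivide v_scaled_deriv_r hd \<theta>_deriv_r) simp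
  have 1: "amp t * ((g ?s - d * h ?s) / ?s * (1 / b t)) / (b t)\<^sup>2 - \<beta> t * r * (amp t * \<beta> t * v ?s)
    = (amp t * (g ?s - d * h ?s) / (b t)\<^sup>2 - amp t * (\<beta> t)\<^sup>2 * r\<^sup>2 * v ?s) / r"
    using b r by (simp add: field_simps power2_eq_square)
  have 2: "amp t * \<beta> t * (r * h ?s / (b t)\<^sup>2) + \<beta> t * r * (amp t * h ?s / (b t)\<^sup>2)
    = (2 * amp t * \<beta> t * r\<^sup>2 * h ?s / (b t)\<^sup>2) / r"
    using b r by (simp add: field_simps power2_eq_square)
  have 3: "Complex (x / r) (y / r) * z = (Complex x y * z) /\<^sub>R r" for x y z
    by (simp add: complex_eq_iff divide_inverse algebra_simps)
  show ?thesis
    using D unfolding 1 2 3 by (simp only: H_def[abs_def] G_def)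
qed

lemma G_0: "G t 0 = 0"
  using compat by (simp add: G_def g_def complex_eq_iff)

lemma U_deriv_t:
  assumes t: "0 < t" "t \<le> T"
  shows "((\<lambda>t. U t r) has_vector_derivative Ut t r) (at t)"
proof -
  have b: "b t > 0" using b_pos[OF t] .
  have ad: "(amp has_real_derivative amp t * (- (d / 2) * \<beta> t)) (at t)"
  proof -
    have "(amp has_real_derivative a * (- (d / 2) * b t powr (- (d / 2) - 1) * c t)) (at t)"
      unfolding amp_def[abs_def] using b by (auto intro!: derivative_eq_intros b_deriv)
    moreover have "b t powr (- (d / 2) - 1) = b t powr (- (d / 2)) / b t"
      using b by (simp add: powr_diff)
    ultimately show ?thesis by (simp add: amp_def \<beta>_def mult_ac)
  qed
  have bd: "(\<beta> has_real_derivative - \<Omega> t - (\<beta> t)\<^sup>2) (at t)"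
  proof -
    have "(\<beta> has_real_derivative (- \<Omega> t * b t * b t - c t * c t) / (b t * b t)) (at t)"
      unfolding \<beta>_def[abs_def] using b by (intro DERIV_divide c_deriv t b_deriv) simp
    then show ?thesis using b by (simp add: \<beta>_def field_simps power2_eq_square)
  qed
  have vd: "((\<lambda>t. v (r / b t)) has_real_derivative - (\<beta> t * r\<^sup>2 * h (r / b t) / (b t)\<^sup>2)) (at t)"
  proof -
    have "((\<lambda>t. r / b t) has_real_derivative (0 * b t - r * c t) / (b t * b t)) (at t)"
      using b by (intro DERIV_divide DERIV_const b_deriv) simp
    from DERIV_chain2[OF v_deriv this]
    have "((\<lambda>t. v (r / b t)) has_real_derivative (r / b t * h (r / b t)) * ((0 * b t - r * c t) / (b t * b t))) (at t)" .
    then show ?thesis by (simp add: \<beta>_def power2_eq_square mult_ac)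
  qed
  have td: "((\<lambda>t. \<theta> t r) has_real_derivative \<theta>t t r) (at t)"
    unfolding \<theta>_def[abs_def] \<theta>t_def
    by (intro DERIV_add DERIV_cdivide DERIV_cmult_right bd \<zeta>_deriv t)
  have "((\<lambda>t. Complex (amp t * v (r / b t)) 0 * cis (\<theta> t r)) has_vector_derivative
     Complex (amp t * (- (d / 2) * \<beta> t) * v (r / b t) + - (\<beta> t * r\<^sup>2 * h (r / b t) / (b t)\<^sup>2) * amp t - \<theta>t t r * 0)
       (0 + \<theta>t t r * (amp t * v (r / b t))) * cis (\<theta> t r)) (at t)"
    by (intro modulated_has_vector_derivative DERIV_mult ad vd td DERIV_const)
  then show ?thesis
    unfolding U_def[abs_def]
    by (rule has_vector_derivative_eq_rhs) (simp add: Ut_def algebra_simps)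
qed

lemma cmod_U: "0 < t \<Longrightarrow> t \<le> T \<Longrightarrow> cmod (U t r) = amp t * \<bar>v (r / b t)\<bar>"
  using amp_pos[of t] by (simp add: U_def norm_mult complex_norm abs_mult)

text \<open>Because \<open>q = 4/d\<close>, the power \<open>q\<close> of \<open>b^(-d/2)\<close> is
  \<open>b^(-2)\<close>, so the nonlinearity scales like the Laplacian, and
  \<open>\<kappa> a^q = -1/2\<close> matches the coefficients. What remains is
  \<open>lens_identity\<close> multiplied by the phase.\<close>

lemma equation:
  assumes t: "0 < t" "t \<le> T"
  shows "\<i> * Ut t r + 1 / 2 * (G t r + of_nat d * H t r)
    = of_real (1 / 2 * \<Omega> t * r\<^sup>2) * U t r + of_real (\<kappa> * cmod (U t r) powr q) * U t r"
proof -
  have b: "b t > 0" using b_pos[OF t] .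
  let ?v = "v (r / b t)" and ?h = "h (r / b t)"
  have "cmod (U t r) powr q = (a powr q * (b t powr (- (d / 2))) powr q) * \<bar>?v\<bar> powr q"
    using a b by (simp add: cmod_U[OF t] amp_def powr_mult)
  moreover have "(b t powr (- (d / 2))) powr q = 1 / (b t)\<^sup>2"
  proof -
    have "- (d / 2) * q = -2" using d by (simp add: q)
    then have "(b t powr (- (d / 2))) powr q = b t powr (-2)" by (simp only: powr_powr)
    then show ?thesis using b by (simp only: powr_neg_numeral)
  qed
  ultimately have "\<kappa> * cmod (U t r) powr q = (\<kappa> * a powr q) * (\<bar>?v\<bar> powr q / (b t)\<^sup>2)"
    by simp
  then have n: "\<kappa> * cmod (U t r) powr q = - (1 / 2) * (\<bar>?v\<bar> powr q / (b t)\<^sup>2)"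
    using a(2) by simp
  define P where "P = \<bar>?v\<bar> powr q"
  have "\<i> * (Complex (amp t * (- (d / 2) * \<beta> t * ?v - \<beta> t * r\<^sup>2 * ?h / (b t)\<^sup>2)) (\<theta>t t r * (amp t * ?v)))
     + 1 / 2 * (Complex (amp t * (g (r / b t) - d * ?h) / (b t)\<^sup>2 - amp t * (\<beta> t)\<^sup>2 * r\<^sup>2 * ?v) (2 * amp t * \<beta> t * r\<^sup>2 * ?h / (b t)\<^sup>2)
        + of_nat d * Complex (amp t * ?h / (b t)\<^sup>2) (amp t * \<beta> t * ?v))
     = of_real (1 / 2 * \<Omega> t * r\<^sup>2) * Complex (amp t * ?v) 0 + of_real (- (1 / 2) * (P / (b t)\<^sup>2)) * Complex (amp t * ?v) 0"
    using lens_identity[of "amp t" d "\<beta> t" ?v "r\<^sup>2" ?h "inverse ((b t)\<^sup>2)" "\<Omega> t" e P]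
    unfolding g_def \<theta>t_def P_def[symmetric] divide_inverse[of _ "(b t)\<^sup>2"] of_real_of_nat_eq .
  from arg_cong[OF this, of "\<lambda>z. z * cis (\<theta> t r)"] show ?thesis
    unfolding n P_def[symmetric] unfolding Ut_def G_def H_def U_def
    by (simp only: distrib_right distrib_left mult.assoc)
qed

text \<open>Time \<open>f\<close> and radius \<open>y\<close> are arbitrary continuous functions of
  one point, which gives at once continuity in space at fixed time, in time at fixed radius, and
  jointly.\<close>

lemma cont:
  fixes f y :: "'x::topological_space \<Rightarrow> real"
  assumes f: "continuous_on S f" "\<And>x. x \<in> S \<Longrightarrow> 0 < f x \<and> f x \<le> T" and y: "continuous_on S y"
  shows "continuous_on S (\<lambda>x. b (f x))" "continuous_on S (\<lambda>x. \<beta> (f x))" "continuous_on S (\<lambda>x. amp (f x))"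
    "continuous_on S (\<lambda>x. v (y x / b (f x)))" "continuous_on S (\<lambda>x. h (y x / b (f x)))"
    "continuous_on S (\<lambda>x. cis (\<theta> (f x) (y x)))"
proof -
  have b: "continuous_on S (\<lambda>x. b (f x))"
    by (rule continuous_on_compose2[OF b_cont f(1)]) simp
  have c: "continuous_on S (\<lambda>x. c (f x))"
    by (rule continuous_on_compose2[OF c_cont f(1)]) simp
  have b0: "\<forall>x\<in>S. b (f x) \<noteq> 0" using f(2) b_pos by force
  have "continuous_on {0<..T} \<zeta>"
    using \<zeta>_deriv by (intro DERIV_continuous_on[OF has_field_derivative_at_within]) auto
  then have \<zeta>: "continuous_on S (\<lambda>x. \<zeta> (f x))"
    by (rule continuous_on_compose2[OF _ f(1)]) (use f(2) in auto)
  show "continuous_on S (\<lambda>x. b (f x))" by (rule b)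
  show \<beta>: "continuous_on S (\<lambda>x. \<beta> (f x))"
    unfolding \<beta>_def by (rule continuous_on_divide[OF c b b0])
  show "continuous_on S (\<lambda>x. amp (f x))"
    unfolding amp_def by (intro continuous_on_mult continuous_on_const continuous_on_powr b b0)
  have yb: "continuous_on S (\<lambda>x. y x / b (f x))"
    by (rule continuous_on_divide[OF y b b0])
  show "continuous_on S (\<lambda>x. v (y x / b (f x)))"
    by (rule continuous_on_compose2[OF v_cont yb]) simp
  show "continuous_on S (\<lambda>x. h (y x / b (f x)))"
    by (rule continuous_on_compose2[OF h_cont yb]) simp
  show "continuous_on S (\<lambda>x. cis (\<theta> (f x) (y x)))"
    unfolding \<theta>_def by (intro continuous_on_cis continuous_on_add continuous_on_divide continuous_on_mult \<beta> continuous_on_power y \<zeta> continuous_on_const) auto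
qed

lemma cont_UHG:
  fixes f y :: "'x::topological_space \<Rightarrow> real"
  assumes f: "continuous_on S f" "\<And>x. x \<in> S \<Longrightarrow> 0 < f x \<and> f x \<le> T" and y: "continuous_on S y"
  shows "continuous_on S (\<lambda>x. U (f x) (y x))" "continuous_on S (\<lambda>x. H (f x) (y x))"
    "continuous_on S (\<lambda>x. G (f x) (y x))" "continuous_on S (\<lambda>x. Ut (f x) (y x))"
proof -
  note c = cont[OF f y]
  have b0: "\<forall>x\<in>S. (b (f x))\<^sup>2 \<noteq> 0" using f(2) b_pos by force
  have \<Omega>: "continuous_on S (\<lambda>x. \<Omega> (f x))"
    by (rule continuous_on_compose2[OF \<Omega>_cont f(1)]) simp
  have vq: "continuous_on S (\<lambda>x. \<bar>v (y x / b (f x))\<bar> powr q)"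
    using q_pos by (intro continuous_on_powr' continuous_on_rabs c continuous_on_const) auto
  note i = c(2-6) continuous_on_mult continuous_on_Complex continuous_on_add continuous_on_diff
    continuous_on_power continuous_on_const continuous_on_divide[OF _ continuous_on_power[OF c(1)] b0] continuous_on_minus y
  show "continuous_on S (\<lambda>x. U (f x) (y x))" unfolding U_def by (intro i)
  show "continuous_on S (\<lambda>x. H (f x) (y x))" unfolding H_def by (intro i)
  show "continuous_on S (\<lambda>x. G (f x) (y x))" unfolding G_def g_def by (intro i vq)
  have "continuous_on S (\<lambda>x. \<theta>t (f x) (y x))"
    unfolding \<theta>t_def times_divide_eq_right[of _ _ 2, symmetric] divide_inverse[of _ 2] by (intro i \<Omega>)
  then show "continuous_on S (\<lambda>x. Ut (f x) (y x))"
    unfolding Ut_def by (intro i)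
qed

text \<open>On [t/2, T] the function \<open>b\<close> has positive bounds from both sides, so decay
  of the profile in \<open>r / b\<close> becomes decay in \<open>r\<close>, at the rate
  \<open>\<gamma>\<close> over the maximum of \<open>b\<close>. \<open>H\<close> appears multiplied
  by \<open>r\<close> because \<open>h_bound\<close> controls \<open>r h\<close>; the phase adds
  \<open>r \<beta> v\<close>, hence the linear factor.\<close>

lemma local_bounds:
  assumes t: "0 < t" "t \<le> T"
  shows "\<exists>S M \<delta>. open S \<and> t \<in> S \<and> \<delta> > 0 \<and> (\<forall>s\<in>{0<..T} \<inter> S. \<forall>r\<ge>0.
     cmod (U s r) \<le> M * exp (- \<delta> * r) \<and> r * cmod (H s r) \<le> M * ((1 + r) * exp (- \<delta> * r)))"
proof -
  let ?J = "{t / 2..T}"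
  have J: "?J \<noteq> {}" "compact ?J" using t by auto
  have I: "\<And>x. x \<in> ?J \<Longrightarrow> 0 < x \<and> x \<le> T" using t by auto
  have bc: "continuous_on ?J b" and \<beta>c: "continuous_on ?J \<beta>" and ac: "continuous_on ?J amp"
    using cont(1-3)[OF continuous_on_id I continuous_on_const[of ?J 0]] by auto
  obtain s1 where s1: "s1 \<in> ?J" "\<And>s. s \<in> ?J \<Longrightarrow> b s1 \<le> b s"
    using continuous_attains_inf[OF J(2,1) bc] by blast
  obtain s2 where s2: "s2 \<in> ?J" "\<And>s. s \<in> ?J \<Longrightarrow> b s \<le> b s2"
    using continuous_attains_sup[OF J(2,1) bc] by blast
  obtain s3 where s3: "s3 \<in> ?J" "\<And>s. s \<in> ?J \<Longrightarrow> \<bar>\<beta> s\<bar> \<le> \<bar>\<beta> s3\<bar>"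
    using continuous_attains_sup[OF J(2,1) continuous_on_rabs[OF \<beta>c]] by blast
  obtain s4 where s4: "s4 \<in> ?J" "\<And>s. s \<in> ?J \<Longrightarrow> amp s \<le> amp s4"
    using continuous_attains_sup[OF J(2,1) ac] by blast
  define m where "m = b s1"
  \<comment> \<open>One constant for both bounds: 1 for \<open>U\<close>, \<open>1 / m\<close> for
    the extra \<open>1 / b\<close> from differentiating \<open>v (r / b)\<close>, and the maximum of
    \<open>\<bar>\<beta>\<bar>\<close> for the gradient of the phase.\<close>
  define M where "M = amp s4 * C * (1 + 1 / m + \<bar>\<beta> s3\<bar>)"
  have m: "m > 0" using b_pos I[OF s1(1)] by (simp add: m_def)
  have bM: "b s2 > 0" using b_pos I[OF s2(1)] by simp
  have A: "amp s4 > 0" using amp_pos I[OF s4(1)] by simp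
  have C: "C \<ge> 0" using v_bound[of 0] by simp
  have main: "cmod (U s r) \<le> M * exp (- (\<gamma> / b s2) * r) \<and> r * cmod (H s r) \<le> M * ((1 + r) * exp (- (\<gamma> / b s2) * r))"
    if s: "s \<in> ?J" and r: "r \<ge> 0" for s r
  proof -
    have s': "0 < s" "s \<le> T" using I[OF s] by auto
    have b: "b s > 0" using b_pos[OF s'] .
    let ?E = "exp (- (\<gamma> / b s2) * r)"
    have E: "exp (- \<gamma> * (r / b s)) \<le> ?E"
      using s2(2)[OF s] b bM r \<gamma> by (simp add: frac_le divide_left_mono mult_left_mono)
    have CE: "C * exp (- \<gamma> * (r / b s)) \<le> C * ?E" using E C by (rule mult_left_mono)
    have v: "\<bar>v (r / b s)\<bar> \<le> C * ?E"
      using v_bound[of "r / b s"] CE b r by simp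
    have h: "\<bar>r / b s * h (r / b s)\<bar> \<le> C * ?E"
      using h_bound[of "r / b s"] CE b r by simp
    have am: "0 < amp s" "amp s \<le> amp s4" using amp_pos[OF s'] s4(2)[OF s] by auto
    have CE0: "0 \<le> C * ?E" using C by simp
    have "cmod (U s r) \<le> amp s4 * (C * ?E)"
      unfolding cmod_U[OF s'] using am v A CE0 by (intro mult_mono) auto
    also have "\<dots> \<le> amp s4 * (C * ?E) * (1 + 1 / m + \<bar>\<beta> s3\<bar>)"
      using mult_left_mono[of 1 "1 + 1 / m + \<bar>\<beta> s3\<bar>" "amp s4 * (C * ?E)"] A CE0 m by simp
    finally have U: "cmod (U s r) \<le> M * ?E" by (simp add: M_def mult_ac)
    have "r * cmod (H s r) \<le> r * (\<bar>amp s * h (r / b s) / (b s)\<^sup>2\<bar> + \<bar>amp s * \<beta> s * v (r / b s)\<bar>)"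
      unfolding H_def by (intro mult_left_mono cmod_Complex_cis_le r)
    also have "\<dots> = amp s * (\<bar>r / b s * h (r / b s)\<bar> * (1 / b s) + r * (\<bar>\<beta> s\<bar> * \<bar>v (r / b s)\<bar>))"
      using am b r by (simp add: abs_mult power2_eq_square field_simps)
    also have "\<dots> \<le> amp s4 * ((C * ?E) * (1 / m) + r * (\<bar>\<beta> s3\<bar> * (C * ?E)))"
    proof (rule mult_mono[OF am(2)])
      have "1 / b s \<le> 1 / m" using s1(2)[OF s] m unfolding m_def by (intro frac_le) auto
      then have 1: "\<bar>r / b s * h (r / b s)\<bar> * (1 / b s) \<le> (C * ?E) * (1 / m)"
        by (rule mult_mono[OF h]) (use CE0 b in auto)
      have "\<bar>\<beta> s\<bar> * \<bar>v (r / b s)\<bar> \<le> \<bar>\<beta> s3\<bar> * (C * ?E)"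
        by (rule mult_mono[OF s3(2)[OF s] v]) auto
      from add_mono[OF 1 mult_left_mono[OF this r]]
      show "\<bar>r / b s * h (r / b s)\<bar> * (1 / b s) + r * (\<bar>\<beta> s\<bar> * \<bar>v (r / b s)\<bar>)
        \<le> (C * ?E) * (1 / m) + r * (\<bar>\<beta> s3\<bar> * (C * ?E))" .
      show "0 \<le> \<bar>r / b s * h (r / b s)\<bar> * (1 / b s) + r * (\<bar>\<beta> s\<bar> * \<bar>v (r / b s)\<bar>)"
        using r b by (intro add_nonneg_nonneg mult_nonneg_nonneg) auto
    qed (use A in auto)
    also have "\<dots> = amp s4 * C * ((1 / m + \<bar>\<beta> s3\<bar> * r) * ?E)"
      by (simp add: algebra_simps)
    also have "\<dots> \<le> amp s4 * C * (((1 + 1 / m + \<bar>\<beta> s3\<bar>) * (1 + r)) * ?E)"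
    proof (intro mult_left_mono mult_right_mono)
      have "1 / m * r \<ge> 0" using m r by simp
      then show "1 / m + \<bar>\<beta> s3\<bar> * r \<le> (1 + 1 / m + \<bar>\<beta> s3\<bar>) * (1 + r)"
        using r by (simp add: algebra_simps add_divide_distrib)
    qed (use A C in auto)
    finally have "r * cmod (H s r) \<le> M * ((1 + r) * ?E)" by (simp add: M_def mult_ac)
    with U show ?thesis by blast
  qed
  show ?thesis
    by (rule exI[of _ "{t / 2<..}"], rule exI[of _ M], rule exI[of _ "\<gamma> / b s2"])
       (use t \<gamma> bM main in auto)
qed

text \<open>The gradient components are \<open>x_i H(|x|)\<close> with
  \<open>|x_i| \<le> |x|\<close>, so the bound on \<open>r |H|\<close> from
  \<open>local_bounds\<close> is of the form that \<open>continuous_into_SigmaI\<close> asks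
  for.\<close>

lemma solution_in_Sigma:
  fixes u :: "real \<Rightarrow> 'a::euclidean_space \<Rightarrow> complex"
  defines "u \<equiv> \<lambda>t x. U t (norm x)"
  shows "continuous_into_Sigma {0<..T} u"
    "\<And>t. t \<in> {0<..T} \<Longrightarrow> grad_L2_norm (u t) = sqrt (\<Sum>i\<in>Basis. (L2_norm (\<lambda>x::'a. (x \<bullet> i) *\<^sub>R H t (norm x)))\<^sup>2)"
    "\<And>i t. i \<in> Basis \<Longrightarrow> t \<in> {0<..T} \<Longrightarrow> (\<lambda>x::'a. (x \<bullet> i) *\<^sub>R H t (norm x)) \<in> L2"
proof -
  let ?g = "\<lambda>i t (x::'a). (x \<bullet> i) *\<^sub>R H t (norm x)"
  have Hc: "continuous_on UNIV (H t)" if "t \<in> {0<..T}" for t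
    using cont_UHG(2)[OF continuous_on_const[of UNIV t] _ continuous_on_id] that by simp
  have Hn: "continuous_on UNIV (\<lambda>x::'a. H t (norm x))" and Un: "continuous_on UNIV (\<lambda>x::'a. U t (norm x))"
    if "t \<in> {0<..T}" for t
    using cont_UHG(1,2)[OF continuous_on_const[of UNIV t] _ continuous_on_norm_id] that by simp_all
  have Ut: "continuous_on {0<..T} (\<lambda>t. U t r)" and Ht: "continuous_on {0<..T} (\<lambda>t. H t r)" for r
    using cont_UHG(1,2)[OF continuous_on_id[of "{0<..T}"] _ continuous_on_const] by simp_all
  have weak: "is_weak_partial i (u s) (?g i s)" if "i \<in> Basis" "s \<in> {0<..T}" for i s
    unfolding is_weak_partial_def u_def
    using pairing_radial_gradient[OF U_deriv_r Hc] that by auto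
  have uc: "continuous_on UNIV (u s)" if "s \<in> {0<..T}" for s
    unfolding u_def by (rule Un[OF that])
  have gc: "continuous_on UNIV (?g i s)" if "s \<in> {0<..T}" for i s
    by (intro continuous_on_scaleR continuous_on_inner continuous_on_id continuous_on_const Hn[OF that])
  have bound: "\<exists>S M \<gamma>. open S \<and> t \<in> S \<and> \<gamma> > 0 \<and>
        (\<forall>s\<in>{0<..T} \<inter> S. \<forall>x. cmod (u s x) \<le> M * exp (- \<gamma> * norm x) \<and>
          (\<forall>i\<in>Basis. cmod (?g i s x) \<le> M * ((1 + norm x) * exp (- \<gamma> * norm x))))" if t: "t \<in> {0<..T}" for t
  proof -
    obtain S M \<delta> where S: "open S" "t \<in> S" "\<delta> > 0"
      and b: "\<And>s r. s \<in> {0<..T} \<inter> S \<Longrightarrow> r \<ge> 0 \<Longrightarrow> cmod (U s r) \<le> M * exp (- \<delta> * r) \<and> r * cmod (H s r) \<le> M * ((1 + r) * exp (- \<delta> * r))"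
      using local_bounds[of t] t by (metis greaterThanAtMost_iff)
    have "cmod (?g i s x) \<le> M * ((1 + norm x) * exp (- \<delta> * norm x))" if "i \<in> Basis" "s \<in> {0<..T} \<inter> S" for i s x
    proof -
      have "cmod (?g i s x) \<le> norm x * cmod (H s (norm x))"
        using Basis_le_norm[OF that(1)] by (simp add: mult_right_mono)
      then show ?thesis using b[OF that(2) norm_ge_zero[of x]] by linarith
    qed
    then show ?thesis
      using S b[OF _ norm_ge_zero] unfolding u_def by (intro exI[of _ S] exI[of _ M] exI[of _ \<delta>]) blast
  qed
  have ulim: "((\<lambda>s. u s x) \<longlongrightarrow> u t x) (at t within {0<..T})" if "t \<in> {0<..T}" for t x
    using Ut[of "norm x"] that by (simp add: u_def continuous_on_def)
  have glim: "((\<lambda>s. ?g i s x) \<longlongrightarrow> ?g i t x) (at t within {0<..T})" if "t \<in> {0<..T}" for t i x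
    using Ht[of "norm x"] that by (intro tendsto_scaleR tendsto_const) (simp add: continuous_on_def)
  note r = continuous_into_SigmaI[where g="?g" and u=u and I="{0<..T}", OF weak uc gc bound ulim glim]
  show "continuous_into_Sigma {0<..T} u"
    by (rule r(1))
  show "grad_L2_norm (u t) = sqrt (\<Sum>i\<in>Basis. (L2_norm (?g i t))\<^sup>2)" if "t \<in> {0<..T}" for t
    by (rule r(2)) (use that in simp_all)
  show "?g i t \<in> L2" if "i \<in> Basis" "t \<in> {0<..T}" for i t
    by (rule r(3)) (use that in simp_all)
qed

lemma solves:
  fixes u :: "real \<Rightarrow> 'a::euclidean_space \<Rightarrow> complex"
  defines "u \<equiv> \<lambda>t x. U t (norm x)"
  assumes dim: "d = DIM('a)" and \<sigma>: "2 * \<sigma> = q"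
  shows "solves_nls \<sigma> \<kappa> \<Omega> {0<..T} u"
  unfolding solves_nls_def
proof (intro ballI conjI allI impI)
  fix t assume t: "t \<in> {0<..T}"
  then have t': "0 < t" "t \<le> T" by auto
  note nc = cont_UHG[OF continuous_on_const[of UNIV t] _ continuous_on_norm_id]
  have cs: "continuous_on UNIV (\<lambda>x::'a. U t (norm x))" "continuous_on UNIV (\<lambda>x::'a. H t (norm x))"
    "continuous_on UNIV (\<lambda>x::'a. G t (norm x))" "continuous_on UNIV (\<lambda>x::'a. Ut t (norm x))"
    using nc t' by simp_all
  have Hr: "continuous_on UNIV (H t)" "continuous_on UNIV (G t)"
    using cont_UHG(2,3)[OF continuous_on_const[of UNIV t] _ continuous_on_id] t' by simp_all
  \<comment> \<open>Read from right to left, the pointwise equation shows that the right-hand side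
    is continuous, hence locally integrable, and splits its pairing into the time derivative and the
    Laplacian.\<close>
  have rhs: "nls_rhs \<sigma> \<kappa> \<Omega> u t = (\<lambda>x. \<i> * Ut t (norm x) + 1 / 2 * (G t (norm x) + of_nat DIM('a) * H t (norm x)))"
    using equation[OF t'] by (simp add: nls_rhs_def u_def \<sigma> dim fun_eq_iff)
  have rc: "continuous_on UNIV (nls_rhs \<sigma> \<kappa> \<Omega> u t)"
    unfolding rhs by (intro continuous_on_add continuous_on_mult continuous_on_const cs)
  show "loc_integrable (nls_rhs \<sigma> \<kappa> \<Omega> u t)"
    unfolding loc_integrable_def set_integrable_def
  proof (intro allI impI)
    fix K :: "'a set" assume K: "compact K"
    have "integrable lborel (\<lambda>x. indicator K x *\<^sub>R nls_rhs \<sigma> \<kappa> \<Omega> u t x)"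
      by (intro borel_integrable_compact K continuous_on_subset[OF rc]) simp
    then show "integrable lebesgue (\<lambda>x. indicator K x *\<^sub>R nls_rhs \<sigma> \<kappa> \<Omega> u t x)"
      by (subst integrable_completion) (auto dest: borel_measurable_integrable)
  qed
  fix \<phi> :: "'a \<Rightarrow> complex" assume \<phi>: "test_function \<phi>"
  show "\<exists>D. ((\<lambda>s. pairing (u s) \<phi>) has_vector_derivative D) (at t within {0<..T}) \<and>
      \<i> * D + 1 / 2 * pairing (u t) (laplacian \<phi>) = pairing (nls_rhs \<sigma> \<kappa> \<Omega> u t) \<phi>"
  proof (intro exI conjI)
    show "((\<lambda>s. pairing (u s) \<phi>) has_vector_derivative pairing (\<lambda>x. Ut t (norm x)) \<phi>) (at t within {0<..T})"
    proof (rule pairing_has_vector_derivative[OF _ _ _ _ t \<phi>])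
      show "((\<lambda>s. u s x) has_vector_derivative Ut s (norm x)) (at s within {0<..T})" if "s \<in> {0<..T}" for s x
        unfolding u_def using U_deriv_t[of s "norm x"] that by (auto intro: has_vector_derivative_at_within)
      show "continuous_on UNIV (u s)" if "s \<in> {0<..T}" for s
        unfolding u_def using cont_UHG(1)[OF continuous_on_const[of UNIV s] _ continuous_on_norm_id] that by simp
      show "continuous_on ({0<..T} \<times> UNIV) (\<lambda>(t, x::'a). Ut t (norm x))"
        unfolding split_beta
        by (rule cont_UHG(4)) (auto intro!: continuous_intros)
    qed simp
    let ?P = "\<lambda>f. pairing (\<lambda>x. f t (norm x)) \<phi>"
    have lap: "pairing (u t) (laplacian \<phi>) = pairing (\<lambda>x. G t (norm x) + of_nat DIM('a) * H t (norm x)) \<phi>"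
      unfolding u_def by (rule pairing_radial_laplacian[OF U_deriv_r[OF t'] Hr(1) H_deriv_r[OF t'] Hr(2) G_0 \<phi>])
    have i: "integrable lebesgue (\<lambda>x. f x * \<phi> x)" if "continuous_on UNIV f" for f
      by (rule integrable_mult_test_function[OF that \<phi>])
    have "pairing (nls_rhs \<sigma> \<kappa> \<Omega> u t) \<phi>
      = (\<integral>x. \<i> * (Ut t (norm x) * \<phi> x) + 1 / 2 * ((G t (norm x) + of_nat DIM('a) * H t (norm x)) * \<phi> x) \<partial>lebesgue)"
      unfolding rhs pairing_def by (intro Bochner_Integration.integral_cong refl) (simp only: distrib_right mult.assoc)
    also have "\<dots> = \<i> * ?P Ut + 1 / 2 * pairing (\<lambda>x. G t (norm x) + of_nat DIM('a) * H t (norm x)) \<phi>"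
      unfolding pairing_def
      by (subst Bochner_Integration.integral_add)
         (auto intro!: integrable_mult_right i continuous_on_add continuous_on_mult continuous_on_const cs)
    finally show "\<i> * ?P Ut + 1 / 2 * pairing (u t) (laplacian \<phi>) = pairing (nls_rhs \<sigma> \<kappa> \<Omega> u t) \<phi>"
      unfolding lap by simp
  qed
qed

text \<open>Only the part of \<open>H\<close> that comes from the modulus is kept; the phase can
  only enlarge its absolute value. On a cube of side proportional to \<open>b\<close> the square of
  \<open>x_i H\<close> is at least of order \<open>amp^2 / b^2\<close>, and the volume is of order
  \<open>b^d\<close>. As \<open>amp^2 b^d = a^2\<close>, the integral is at least of order
  \<open>1 / b^2\<close>.\<close>

lemma blow_up:
  fixes u :: "real \<Rightarrow> 'a::euclidean_space \<Rightarrow> complex"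
  defines "u \<equiv> \<lambda>t x. U t (norm x)"
  assumes dim: "d = DIM('a)"
  shows "filterlim (\<lambda>t. grad_L2_norm (u t)) at_top (at_right 0)"
proof -
  have "(h \<longlongrightarrow> h 0) (at 0)" using h_cont by (simp add: continuous_on_eq_continuous_at isCont_def)
  then have "eventually (\<lambda>r. dist (h r) (h 0) < \<bar>h 0\<bar> / 2) (at 0)"
    using h_0 by (intro tendstoD) auto
  then obtain r0 where r0: "r0 > 0" "\<And>r. r \<noteq> 0 \<Longrightarrow> \<bar>r\<bar> < r0 \<Longrightarrow> \<bar>h r - h 0\<bar> < \<bar>h 0\<bar> / 2"
    by (auto simp: eventually_at dist_real_def)
  define m where "m = \<bar>h 0\<bar> / 2"
  have m: "m > 0" using h_0 by (simp add: m_def)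
  have hm: "m \<le> \<bar>h r\<bar>" if "\<bar>r\<bar> < r0" for r
  proof (cases "r = 0")
    case False
    then show ?thesis using r0(2)[OF False that] unfolding m_def by linarith
  qed (simp add: m_def)
  \<comment> \<open>The cube has coordinates between \<open>\<rho> b\<close> and
    \<open>2 \<rho> b\<close>. Its points have norm at most \<open>2 d \<rho> b = r0 b / 2\<close>,
    so the scaled radius stays where \<open>h\<close> is bounded away from 0, and the lower end
    keeps \<open>x_i\<close> away from 0.\<close>
  define \<rho> where "\<rho> = r0 / (4 * d)"
  have \<rho>: "\<rho> > 0" using r0 d by (simp add: \<rho>_def)
  define K where "K = sqrt ((\<rho> * a * m)\<^sup>2 * \<rho> ^ d)"
  have K: "K > 0" using \<rho> a m by (simp add: K_def)
  obtain i :: 'a where i: "i \<in> Basis" using nonempty_Basis by blast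
  have lower: "K / b t \<le> grad_L2_norm (u t)" if t: "t \<in> {0<..T}" for t
  proof -
    have t': "0 < t" "t \<le> T" using t by auto
    have bt: "b t > 0" using b_pos[OF t'] .
    let ?g = "\<lambda>x. (x \<bullet> i) *\<^sub>R H t (norm x)"
    define B where "B = cbox ((\<rho> * b t) *\<^sub>R One) ((2 * (\<rho> * b t)) *\<^sub>R One :: 'a)"
    define k where "k = (\<rho> * b t * (amp t * m / (b t)\<^sup>2))\<^sup>2"
    have pb: "0 < \<rho> * b t" using \<rho> bt by simp
    have inB: "k \<le> (cmod (?g x))\<^sup>2" if x: "x \<in> B" for x
    proof -
      have xj: "\<rho> * b t \<le> x \<bullet> j" "x \<bullet> j \<le> 2 * (\<rho> * b t)" if "j \<in> Basis" for j
        using x that by (auto simp: B_def mem_box)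
      have "norm x \<le> (\<Sum>j\<in>Basis. \<bar>x \<bullet> j\<bar>)" by (rule norm_le_l1)
      also have "\<dots> \<le> (\<Sum>j\<in>(Basis::'a set). 2 * (\<rho> * b t))"
        using xj pb by (intro sum_mono) (smt (verit))
      also have "\<dots> = r0 / 2 * b t" using d by (simp add: \<rho>_def dim)
      finally have "norm x / b t < r0"
        using bt r0(1) by (simp add: divide_less_eq) (smt (verit) mult_pos_pos)
      then have hx: "m \<le> \<bar>h (norm x / b t)\<bar>" using bt by (intro hm) simp
      have "amp t * m / (b t)\<^sup>2 \<le> \<bar>amp t * h (norm x / b t) / (b t)\<^sup>2\<bar>"
        using hx amp_pos[OF t'] by (simp add: abs_mult divide_right_mono mult_left_mono)
      also have "\<dots> \<le> cmod (H t (norm x))"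
        unfolding H_def norm_mult norm_cis using abs_Re_le_cmod[of "Complex (amp t * h (norm x / b t) / (b t)\<^sup>2) (amp t * \<beta> t * v (norm x / b t))"] by simp
      finally have H: "amp t * m / (b t)\<^sup>2 \<le> cmod (H t (norm x))" .
      have "\<rho> * b t * (amp t * m / (b t)\<^sup>2) \<le> cmod (?g x)"
        unfolding norm_scaleR using xj(1)[OF i] H pb amp_pos[OF t'] m by (intro mult_mono) auto
      then show ?thesis
        unfolding k_def using pb amp_pos[OF t'] m by (intro power_mono) auto
    qed
    have L2: "?g \<in> L2" by (rule solution_in_Sigma(3)[OF i t])
    have mB: "measure lebesgue B = (\<rho> * b t) ^ d"
    proof -
      have "measure lborel B = (\<Prod>j\<in>(Basis::'a set). \<rho> * b t)"
        unfolding B_def using pb by (simp add: measure_lborel_cbox_eq inner_diff_left)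
      moreover have "measure lebesgue B = measure lborel B"
        by (rule measure_completion) (simp add: B_def)
      ultimately show ?thesis by (simp add: dim)
    qed
    have "(K / b t)\<^sup>2 = k * measure lebesgue B"
    proof -
      have "(amp t)\<^sup>2 * b t ^ d = a\<^sup>2"
      proof -
        have "(b t powr (- (d / 2)))\<^sup>2 * b t ^ d = b t powr (- (d / 2) + - (d / 2) + d)"
          using bt by (simp only: power2_eq_square powr_add powr_realpow)
        then show ?thesis using bt by (simp add: amp_def power_mult_distrib)
      qed
      moreover have "k * (\<rho> * b t) ^ d = (\<rho> * m)\<^sup>2 * \<rho> ^ d * ((amp t)\<^sup>2 * b t ^ d) / (b t)\<^sup>2"
        using bt by (simp add: k_def power_mult_distrib power_divide field_simps)
      ultimately show ?thesis
        unfolding mB using \<rho> by (simp add: K_def power_divide power_mult_distrib)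
    qed
    also have "\<dots> = (\<integral>x. k * indicator B x \<partial>lebesgue)" by (simp add: B_def)
    also have "\<dots> \<le> (\<integral>x. (cmod (?g x))\<^sup>2 \<partial>lebesgue)"
    proof (rule integral_mono)
      show "integrable lebesgue (\<lambda>x. k * indicat_real B x)"
        by (intro integrable_mult_right integrable_real_indicator) (auto simp: B_def emeasure_lborel_cbox_eq)
      show "integrable lebesgue (\<lambda>x. (cmod (?g x))\<^sup>2)" using L2 by (simp add: L2_def)
      show "k * indicat_real B x \<le> (cmod (?g x))\<^sup>2" for x
        using inB[of x] by (auto simp: indicator_def)
    qed
    also have "\<dots> = (L2_norm ?g)\<^sup>2" by (simp add: L2_norm_def)
    also have "\<dots> \<le> (\<Sum>i\<in>Basis. (L2_norm (\<lambda>x::'a. (x \<bullet> i) *\<^sub>R H t (norm x)))\<^sup>2)"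
      by (rule member_le_sum[OF i]) auto
    finally have "K / b t \<le> sqrt (\<Sum>i\<in>Basis. (L2_norm (\<lambda>x::'a. (x \<bullet> i) *\<^sub>R H t (norm x)))\<^sup>2)"
      by (rule real_le_rsqrt)
    then show ?thesis
      using solution_in_Sigma(2)[where 'a='a, OF t] by (simp add: u_def)
  qed
  have ev: "eventually (\<lambda>t. t \<in> {0<..T}) (at_right 0)"
    using T by (auto simp: eventually_at_right_field intro!: exI[of _ T])
  have "(b \<longlongrightarrow> b 0) (at 0)" using b_cont by (simp add: continuous_on_eq_continuous_at isCont_def)
  then have "(b \<longlongrightarrow> 0) (at_right 0)" by (simp add: b_0 filterlim_at_split)
  moreover have "eventually (\<lambda>t. 0 < b t) (at_right 0)"
    using ev by eventually_elim (auto intro: b_pos)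
  ultimately have "filterlim (\<lambda>t. inverse (b t)) at_top (at_right 0)"
    by (rule filterlim_inverse_at_top)
  then have "filterlim (\<lambda>t. K * inverse (b t)) at_top (at_right 0)"
    by (rule filterlim_tendsto_pos_mult_at_top[OF tendsto_const K])
  then show ?thesis
    by (rule filterlim_at_top_mono)
       (use ev lower in \<open>auto elim!: eventually_mono simp: divide_inverse\<close>)
qed

end

theorem proposition1p9:
  fixes \<Omega> :: "real \<Rightarrow> real" and \<sigma> \<kappa> :: real
  assumes "\<sigma> = 2 / real CARD('n::finite)"
    and "\<kappa> < 0"
    and "continuous_on UNIV \<Omega>"
  shows "\<exists>T>0. \<exists>u :: real \<Rightarrow> real ^ 'n \<Rightarrow> complex.
           continuous_into_Sigma {0<..T} u \<and>
           solves_nls \<sigma> \<kappa> \<Omega> {0<..T} u \<and>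
           filterlim (\<lambda>t. grad_L2_norm (u t)) at_top (at_right 0)"
proof -
  let ?d = "DIM(real ^ 'n)"
  have d: "?d \<ge> 1" by (simp add: Suc_leI)
  define q where "q = 4 / real ?d"
  have q: "q > 0" using d by (simp add: q_def)
  \<comment> \<open>The profile equation has coefficient -1 for the nonlinearity next to the full
    Laplacian, hence \<open>-1/2\<close> next to half of it; the amplitude absorbs
    \<open>\<kappa>\<close>, and \<open>\<kappa> < 0\<close> makes \<open>a\<close> a positive real
    number.\<close>
  define a where "a = (- 1 / (2 * \<kappa>)) powr (1 / q)"
  have a: "a > 0" "\<kappa> * a powr q = - 1 / 2"
    using assms(2) q by (simp_all add: a_def powr_powr divide_neg_neg)
  obtain e \<gamma> C v h where "radial_profile ?d q e \<gamma> C v h"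
    using radial_profile_exists[OF d] unfolding q_def by metis
  moreover obtain T b c \<zeta> where "oscillator (e / 2) T b c \<zeta> \<Omega>"
    using oscillator_exists[OF assms(3)] by metis
  ultimately interpret lens_transform ?d q e \<gamma> C v h T b c \<zeta> \<Omega> a \<kappa>
    using a assms(3) by (simp add: lens_transform_def lens_transform_axioms_def)
  have "2 * \<sigma> = q" using assms(1) by (simp add: q_def)
  from solution_in_Sigma(1)[where 'a="real ^ 'n"] solves[where 'a="real ^ 'n", OF refl this] blow_up[where 'a="real ^ 'n", OF refl]
  show ?thesis using T by blast
qed

end
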